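(* Let $k$ be a field of characteristic $0$. Assume that the birational Grothendieck anabelian section conjecture (BGASC) holds true for the $k$-curve $\mathbb{P}^1_k$. Then the BGASC holds true for every projective, smooth, and geometrically connected $k$-curve $X$.
   Context: Let $k$ be a field of characteristic $0$ and $X$ a proper, smooth, geometrically connected algebraic curve over $k$ (of any genus) with function field $K_X$. Fix a separable closure $K_X^{\mathrm{sep}}$ of $K_X$, let $\bar k$ be the algebraic closure of $k$ in $K_X^{\mathrm{sep}}$, and put $G_k=\mathrm{Gal}(\bar k/k)$, $G_X=\mathrm{Gal}(K_X^{\mathrm{sep}}/K_X)$, $G_{\overline X}=\mathrm{Gal}(K_X^{\mathrm{sep}}/K_X\bar k)$. There is an exact sequence of profinite groups $1\to G_{\overline X}\to G_X\xrightarrow{\mathrm{pr}_X} G_k\to 1$. A section of $\mathrm{pr}_X$ is a continuous homomorphism $s:G_k\to G_X$ with $\mathrm{pr}_X\circ s=\mathrm{id}_{G_k}$. For $x\in X(k)$, a decomposition subgroup $D_x\subset G_X$ associated to $x$ is the decomposition group of an extension to $K_X^{\mathrm{sep}}$ of the discrete valuation of $K_X$ defined by $x$; it is well defined up to conjugation by elements of $G_{\overline X}$. "The BGASC holds true for the $k$-curve $X$" means: for every section $s:G_k\to G_X$ of $\mathrm{pr}_X$, there is a unique rational point $x\in X(k)$ such that $s(G_k)$ is contained in a decomposition subgroup $D_x\subset G_X$ associated to $x$. *)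

theory Defs
  imports
    "HOL-Algebra.Algebraic_Closure_Type"
    "HOL-Algebra.Bij"
    "HOL-Algebra.Generated_Fields"
    "HOL-Analysis.Abstract_Topology"
    "HOL-Computational_Algebra.Fraction_Field"
    "HOL-Library.Function_Algebras"
    "HOL-Library.Poly_Mapping"
begin

section \<open>Polynomials in the variables \<open>x\<^sub>0, x\<^sub>1, \<dots>\<close>\<close>

text \<open>
  A monomial is its finitely supported exponent function; multiplication in
  \<^typ>\<open>('m, 'k) poly_mapping\<close> is convolution, hence polynomial multiplication.
\<close>

type_synonym monom = "nat \<Rightarrow>\<^sub>0 nat"
type_synonym 'k mpoly = "monom \<Rightarrow>\<^sub>0 'k"

definition Var :: "nat \<Rightarrow> 'k::comm_ring_1 mpoly" where
  "Var i = Poly_Mapping.single (Poly_Mapping.single i 1) 1"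

definition Const :: "'k::comm_ring_1 \<Rightarrow> 'k mpoly" where
  "Const c = Poly_Mapping.single 0 c"

definition mdeg :: "monom \<Rightarrow> nat" where
  "mdeg m = (\<Sum>i\<in>Poly_Mapping.keys m. Poly_Mapping.lookup m i)"

definition mpoly_carrier :: "nat \<Rightarrow> 'k::comm_ring_1 mpoly set" where
  "mpoly_carrier n = {f. \<forall>m\<in>Poly_Mapping.keys f. Poly_Mapping.keys m \<subseteq> {..n}}"

definition mpoly_ring :: "nat \<Rightarrow> 'k::comm_ring_1 mpoly ring" where
  "mpoly_ring n =
     \<lparr> carrier = mpoly_carrier n, monoid.mult = (*), one = 1, zero = 0, add = (+) \<rparr>"

definition homogeneous :: "nat \<Rightarrow> nat \<Rightarrow> 'k::comm_ring_1 mpoly \<Rightarrow> bool" where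
  "homogeneous n d f \<longleftrightarrow> f \<in> mpoly_carrier n \<and> (\<forall>m\<in>Poly_Mapping.keys f. mdeg m = d)"

definition hom_component :: "nat \<Rightarrow> 'k::comm_ring_1 mpoly \<Rightarrow> 'k mpoly" where
  "hom_component d f =
     (\<Sum>m\<in>{m\<in>Poly_Mapping.keys f. mdeg m = d}. Poly_Mapping.single m (Poly_Mapping.lookup f m))"

text \<open>Evaluation at \<open>a\<close>, the coefficients being transported along \<open>\<phi>\<close>.\<close>

definition mpoly_eval ::
  "('k \<Rightarrow> 'l) \<Rightarrow> 'k::comm_ring_1 mpoly \<Rightarrow> (nat \<Rightarrow> 'l::comm_ring_1) \<Rightarrow> 'l" where
  "mpoly_eval \<phi> f a =
     (\<Sum>m\<in>Poly_Mapping.keys f. \<phi> (Poly_Mapping.lookup f m) *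
        (\<Prod>i\<in>Poly_Mapping.keys m. a i ^ Poly_Mapping.lookup m i))"

text \<open>The exponent subtraction truncates at 0 only where the coefficient is 0 anyway.\<close>

definition partial_deriv :: "nat \<Rightarrow> 'k::comm_ring_1 mpoly \<Rightarrow> 'k mpoly" where
  "partial_deriv i f =
     (\<Sum>m\<in>Poly_Mapping.keys f. Poly_Mapping.single (m - Poly_Mapping.single i 1)
        (of_nat (Poly_Mapping.lookup m i) * Poly_Mapping.lookup f m))"


section \<open>Integral closed subschemes of projective space\<close>

text \<open>
  \<open>Proj k[x\<^sub>0,\<dots>,x\<^sub>n]/I\<close>, embedded in \<open>n\<close>-dimensional projective space, is given by
  \<open>n\<close> and \<open>I\<close>. Integral closed subschemes correspond bijectively to the homogeneous
  prime ideals \<open>I\<close> not containing all of \<open>x\<^sub>0,\<dots>,x\<^sub>n\<close>.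
\<close>

record (overloaded) 'k projective =
  ambient_dim :: nat
  ideal_of :: "'k mpoly set"

definition projective_variety :: "'k::field projective \<Rightarrow> bool" where
  "projective_variety C \<longleftrightarrow>
     primeideal (ideal_of C) (mpoly_ring (ambient_dim C)) \<and>
     (\<forall>f\<in>ideal_of C. \<forall>d. hom_component d f \<in> ideal_of C) \<and>
     (\<exists>i\<le>ambient_dim C. Var i \<notin> ideal_of C)"

definition projective_line :: "'k::field projective" where
  "projective_line = \<lparr> ambient_dim = 1, ideal_of = {0} \<rparr>"

text \<open>
  A point of projective space over the field \<open>'f\<close> is the set of all its homogeneous
  coordinate vectors, padded with zeros to functions on \<open>nat\<close>.
\<close>

definition proj_space :: "nat \<Rightarrow> (nat \<Rightarrow> 'f::field) set set" where
  "proj_space n =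
     {{(\<lambda>i. c * a i) |c. c \<noteq> 0} |a. (\<exists>i\<le>n. a i \<noteq> 0) \<and> (\<forall>i>n. a i = 0)}"

definition points :: "('k::field \<Rightarrow> 'f::field) \<Rightarrow> 'k projective \<Rightarrow> (nat \<Rightarrow> 'f) set set" where
  "points \<phi> C =
     {x\<in>proj_space (ambient_dim C). \<forall>a\<in>x. \<forall>f\<in>ideal_of C. mpoly_eval \<phi> f a = 0}"

abbreviation rational_points :: "'k::field projective \<Rightarrow> (nat \<Rightarrow> 'k) set set" where
  "rational_points \<equiv> points id"

abbreviation geometric_points :: "'k::field projective \<Rightarrow> (nat \<Rightarrow> 'k alg_closure) set set" where
  "geometric_points \<equiv> points to_ac"


section \<open>Function field\<close>

text \<open>
  Fractions \<open>f/g\<close> of forms of equal degree with \<open>g \<notin> I\<close>, modulo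
  \<open>f/g \<sim> f'/g' \<longleftrightarrow> f g' - f' g \<in> I\<close>.
\<close>

definition hom_fractions :: "'k::field projective \<Rightarrow> ('k mpoly \<times> 'k mpoly) set" where
  "hom_fractions C =
     {(f, g). \<exists>d. homogeneous (ambient_dim C) d f \<and> homogeneous (ambient_dim C) d g \<and>
                  g \<notin> ideal_of C}"

definition frac_class ::
  "'k::field projective \<Rightarrow> 'k mpoly \<Rightarrow> 'k mpoly \<Rightarrow> ('k mpoly \<times> 'k mpoly) set" where
  "frac_class C f g = {(f', g') \<in> hom_fractions C. f * g' - f' * g \<in> ideal_of C}"

definition function_field :: "'k::field projective \<Rightarrow> ('k mpoly \<times> 'k mpoly) set ring" where
  "function_field C =
     \<lparr> carrier = {frac_class C f g |f g. (f, g) \<in> hom_fractions C},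
       monoid.mult = (\<lambda>A B. \<Union>(f, g)\<in>A. \<Union>(f', g')\<in>B. frac_class C (f * f') (g * g')),
       one = frac_class C 1 1,
       zero = frac_class C 0 1,
       add = (\<lambda>A B. \<Union>(f, g)\<in>A. \<Union>(f', g')\<in>B. frac_class C (f * g' + f' * g) (g * g')) \<rparr>"

definition constants :: "'k::field projective \<Rightarrow> ('k mpoly \<times> 'k mpoly) set set" where
  "constants C = {frac_class C (Const c) 1 |c. True}"

definition local_ring ::
  "'k::field projective \<Rightarrow> (nat \<Rightarrow> 'k) set \<Rightarrow> ('k mpoly \<times> 'k mpoly) set set" where
  "local_ring C x =
     {A\<in>carrier (function_field C). \<exists>(f, g)\<in>A. \<forall>a\<in>x. mpoly_eval id g a \<noteq> 0}"


section \<open>Smooth, geometrically connected projective curves\<close>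

text \<open>The dimension of a variety is the transcendence degree of its function field.\<close>

definition one_dimensional :: "'k::field projective \<Rightarrow> bool" where
  "one_dimensional C \<longleftrightarrow>
     (\<exists>t\<in>carrier (function_field C).
        ring.transcendental (function_field C) (constants C) t \<and>
        (\<forall>y\<in>carrier (function_field C).
           ring.algebraic (function_field C)
             (generate_field (function_field C) (insert t (constants C))) y))"

text \<open>
  The rank of the Jacobian matrix at \<open>a\<close>, as the dimension of its row space. All elements
  of the ideal are used as equations: at a zero of the ideal, the gradients of any system of
  generators span the same space.
\<close>

definition jacobian_rank :: "'k::field projective \<Rightarrow> (nat \<Rightarrow> 'k alg_closure) \<Rightarrow> nat" where
  "jacobian_rank C a =
     vector_space.dim (\<lambda>c v i. c * v i)
       {(\<lambda>i. mpoly_eval to_ac (partial_deriv i f) a) |f. f \<in> ideal_of C}"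

text \<open>
  Jacobian criterion for a curve in \<open>n\<close>-dimensional projective space: its codimension is
  \<open>n - 1\<close>.
\<close>

definition smooth_curve :: "'k::field projective \<Rightarrow> bool" where
  "smooth_curve C \<longleftrightarrow>
     (\<forall>x\<in>geometric_points C. \<forall>a\<in>x. jacobian_rank C a = ambient_dim C - 1)"

definition zariski :: "nat \<Rightarrow> (nat \<Rightarrow> 'f::field) set topology" where
  "zariski n = topology_generated_by
     {{x\<in>proj_space n. \<forall>a\<in>x. mpoly_eval id f a \<noteq> 0} |f. \<exists>d. homogeneous n d f}"

definition geometrically_connected :: "'k::field projective \<Rightarrow> bool" where
  "geometrically_connected C \<longleftrightarrow>
     geometric_points C \<noteq> {} \<and>
     connectedin (zariski (ambient_dim C)) (geometric_points C)"

definition smooth_geom_connected_curve :: "'k::field projective \<Rightarrow> bool" where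
  "smooth_geom_connected_curve C \<longleftrightarrow>
     projective_variety C \<and> one_dimensional C \<and> smooth_curve C \<and> geometrically_connected C"


section \<open>Galois groups\<close>

text \<open>
  Automorphisms of the subfield \<open>E\<close> over its subfield \<open>F\<close>, as functions that are
  \<^const>\<open>undefined\<close> outside \<open>E\<close>.
\<close>

definition Gal :: "'l::field set \<Rightarrow> 'l set \<Rightarrow> ('l \<Rightarrow> 'l) monoid" where
  "Gal E F = BijGroup E
     \<lparr> carrier := {\<sigma>\<in>Bij E.
         (\<forall>x\<in>E. \<forall>y\<in>E. \<sigma> (x + y) = \<sigma> x + \<sigma> y \<and> \<sigma> (x * y) = \<sigma> x * \<sigma> y) \<and>
         (\<forall>x\<in>F. \<sigma> x = x)} \<rparr>"

text \<open>
  The generating sets are the cosets of the groups \<open>Gal(E/F(S))\<close> with \<open>S\<close> finite. As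
  \<open>E\<close> is algebraic over \<open>F\<close> in all uses, the fields \<open>F(S)\<close> are precisely
  the finite subextensions of \<open>E/F\<close>.
\<close>

definition krull_topology :: "'l::field set \<Rightarrow> 'l set \<Rightarrow> ('l \<Rightarrow> 'l) topology" where
  "krull_topology E F = topology_generated_by
     {{\<tau>\<in>carrier (Gal E F). \<forall>x\<in>S. \<tau> x = \<sigma> x} |\<sigma> S.
        \<sigma> \<in> carrier (Gal E F) \<and> finite S \<and> S \<subseteq> E}"


section \<open>The birational section conjecture\<close>

text \<open>
  A separable closure of the function field \<open>K\<close> of \<open>C\<close> is given by an embedding \<open>\<iota>\<close> of
  \<open>K\<close> into a field \<open>'l\<close>. Separable closures are algebraic closures here because \<open>K\<close> has
  characteristic 0.
\<close>

definition separable_closure ::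
  "'k::field_char_0 projective \<Rightarrow> (('k mpoly \<times> 'k mpoly) set \<Rightarrow> 'l::field) \<Rightarrow> bool" where
  "separable_closure C \<iota> \<longleftrightarrow>
     \<iota> \<in> ring_hom (function_field C) (ring_of_type_algebra :: 'l ring) \<and>
     algebraic_closure (ring_of_type_algebra :: 'l ring) (\<iota> ` carrier (function_field C))"

definition base_closure ::
  "'k::field projective \<Rightarrow> (('k mpoly \<times> 'k mpoly) set \<Rightarrow> 'l::field) \<Rightarrow> 'l set" where
  "base_closure C \<iota> =
     {y. ring.algebraic (ring_of_type_algebra :: 'l ring) (\<iota> ` constants C) y}"

abbreviation G_k ::
  "'k::field projective \<Rightarrow> (('k mpoly \<times> 'k mpoly) set \<Rightarrow> 'l::field) \<Rightarrow> ('l \<Rightarrow> 'l) monoid" where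
  "G_k C \<iota> \<equiv> Gal (base_closure C \<iota>) (\<iota> ` constants C)"

abbreviation G_X ::
  "'k::field projective \<Rightarrow> (('k mpoly \<times> 'k mpoly) set \<Rightarrow> 'l::field) \<Rightarrow> ('l \<Rightarrow> 'l) monoid" where
  "G_X C \<iota> \<equiv> Gal UNIV (\<iota> ` carrier (function_field C))"

definition pr_X ::
  "'k::field projective \<Rightarrow> (('k mpoly \<times> 'k mpoly) set \<Rightarrow> 'l::field) \<Rightarrow> ('l \<Rightarrow> 'l) \<Rightarrow> ('l \<Rightarrow> 'l)"
  where "pr_X C \<iota> \<sigma> = restrict \<sigma> (base_closure C \<iota>)"

definition is_section ::
  "'k::field projective \<Rightarrow> (('k mpoly \<times> 'k mpoly) set \<Rightarrow> 'l::field) \<Rightarrow>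
    (('l \<Rightarrow> 'l) \<Rightarrow> ('l \<Rightarrow> 'l)) \<Rightarrow> bool" where
  "is_section C \<iota> s \<longleftrightarrow>
     s \<in> hom (G_k C \<iota>) (G_X C \<iota>) \<and>
     continuous_map (krull_topology (base_closure C \<iota>) (\<iota> ` constants C))
       (krull_topology UNIV (\<iota> ` carrier (function_field C))) s \<and>
     (\<forall>g\<in>carrier (G_k C \<iota>). pr_X C \<iota> (s g) = g)"

text \<open>Valuations are written additively; their value at 0, morally infinity, is ignored.\<close>

definition valuation ::
  "('a, 'm) ring_scheme \<Rightarrow> ('a \<Rightarrow> 'v::linordered_ab_group_add) \<Rightarrow> bool" where
  "valuation R v \<longleftrightarrow>
     (\<forall>a\<in>carrier R - {\<zero>\<^bsub>R\<^esub>}. \<forall>b\<in>carrier R - {\<zero>\<^bsub>R\<^esub>}.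
        v (a \<otimes>\<^bsub>R\<^esub> b) = v a + v b \<and>
        (a \<oplus>\<^bsub>R\<^esub> b \<noteq> \<zero>\<^bsub>R\<^esub> \<longrightarrow> min (v a) (v b) \<le> v (a \<oplus>\<^bsub>R\<^esub> b)))"

text \<open>The normalized discrete valuation whose valuation ring is the local ring at \<open>x\<close>.\<close>

definition point_valuation ::
  "'k::field projective \<Rightarrow> (nat \<Rightarrow> 'k) set \<Rightarrow> (('k mpoly \<times> 'k mpoly) set \<Rightarrow> int) \<Rightarrow> bool" where
  "point_valuation C x v \<longleftrightarrow>
     valuation (function_field C) v \<and>
     v ` (carrier (function_field C) - {\<zero>\<^bsub>function_field C\<^esub>}) = UNIV \<and>
     {a\<in>carrier (function_field C). a = \<zero>\<^bsub>function_field C\<^esub> \<or> 0 \<le> v a} = local_ring C x"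

text \<open>
  Real values suffice for the extensions \<open>w\<close> of a discrete valuation \<open>v\<close> to an algebraic
  extension field: the value group of \<open>w\<close> is torsion over the integers.
\<close>

definition decomposition_groups ::
  "'k::field projective \<Rightarrow> (('k mpoly \<times> 'k mpoly) set \<Rightarrow> 'l::field) \<Rightarrow> (nat \<Rightarrow> 'k) set \<Rightarrow>
    ('l \<Rightarrow> 'l) set set" where
  "decomposition_groups C \<iota> x =
     {{\<sigma>\<in>carrier (G_X C \<iota>). \<forall>y. y \<noteq> 0 \<longrightarrow> w (\<sigma> y) = w y} |w :: 'l \<Rightarrow> real.
        valuation (ring_of_type_algebra :: 'l ring) w \<and>
        (\<exists>v. point_valuation C x v \<and>
           (\<forall>a\<in>carrier (function_field C) - {\<zero>\<^bsub>function_field C\<^esub>}.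
              w (\<iota> a) = real_of_int (v a)))}"

text \<open>
  Every function field of a curve over \<open>'k\<close> is a finite extension of a copy of the rational
  function field \<open>'k(t)\<close>. Hence the algebraic closure of \<open>'k(t)\<close> is, through suitable
  embeddings \<open>\<iota>\<close>, a separable closure of all of these fields at once, and every separable
  closure is isomorphic to one of this form.
\<close>

type_synonym 'k sep_field = "'k poly fract alg_closure"

definition BGASC :: "'k::field_char_0 projective \<Rightarrow> bool" where
  "BGASC C \<longleftrightarrow>
     (\<forall>\<iota> :: ('k mpoly \<times> 'k mpoly) set \<Rightarrow> 'k sep_field. separable_closure C \<iota> \<longrightarrow>
       (\<forall>s. is_section C \<iota> s \<longrightarrow>
         (\<exists>!x. x \<in> rational_points C \<and>
               (\<exists>D\<in>decomposition_groups C \<iota> x. s ` carrier (G_k C \<iota>) \<subseteq> D))))"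

end

(*
  Let t be a transcendental function on the curve C. It makes the function field K of C a finite
  extension of k(t), so the Galois group of K is a subgroup of that of k(t), and a section s for C is
  also a section for the projective line. There it fixes a valuation w of the common separable
  closure L that lies over a rational point. The residue field of w on L is the algebraic closure of
  k, so every w-integral b in K has a residue c algebraic over k; as s(g) fixes both b and w, it
  moves c to itself for each g, so c lies in k. Hence the restriction of w to K has residue field k, is
  centred at a rational point of C, and smoothness (the Jacobian criterion with Nakayama's lemma)
  identifies it with the valuation of that point.

  For uniqueness, two distinct rational points x, x' are separated by a function u that vanishes at x
  and not at x'. Applying uniqueness on the projective line to the coordinate u gives a
  contradiction.
*)

theory Submission
  imports Defs
begin

section \<open>Subfields and algebraic elements\<close>

text \<open>The group \<open>G_k\<close> is realized inside the separable closure, as automorphisms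
  of the algebraic closure of the constants. Embedding k(t) into the same field by sending the
  coordinate of the line to \<open>\<iota> t\<close> therefore leaves \<open>G_k\<close> unchanged,
  and the section itself is not modified. Any transcendental element of K can play the role of t;
  uniqueness uses this freedom, because the separating function depends on the two points. That k is
  the fixed field of \<open>G_k\<close> needs enough automorphisms of a possibly infinite algebraic
  extension; Zorn's lemma provides them from graphs of partial isomorphisms. Valuations of the
  separable closure are real-valued, and a restriction to K is only proportional to the normalized
  discrete valuation of a point. Hence the positive factors \<open>c\<close> that accompany the
  centres; decomposition groups do not see them. The curve and the line are both treated by one
  statement about centres on smooth curves, which uses of the valuation only that it is trivial on
  k, is nontrivial on the function field and has residue field k there.\<close>

abbreviation type_ring :: "'l::field ring" where
  "type_ring \<equiv> ring_of_type_algebra"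

lemma type_ring_simps [simp]:
  "carrier (type_ring :: 'l::field ring) = UNIV"
  "x \<otimes>\<^bsub>type_ring\<^esub> y = x * (y :: 'l)"
  "x \<oplus>\<^bsub>type_ring\<^esub> y = x + (y :: 'l)"
  "\<one>\<^bsub>type_ring\<^esub> = (1 :: 'l)"
  "\<zero>\<^bsub>type_ring\<^esub> = (0 :: 'l)"
  by (simp_all add: ring_of_type_algebra_def)

context
begin

interpretation type_ring: field "type_ring :: 'l::field ring"
  by (rule field_from_type_algebra)

lemma type_ring_a_inv [simp]: "\<ominus>\<^bsub>type_ring\<^esub> x = - (x :: 'l::field)"
  by (rule type_ring.minus_equality) auto

lemma type_ring_m_inv: "x \<noteq> 0 \<Longrightarrow> inv\<^bsub>type_ring\<^esub> x = inverse (x :: 'l::field)"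
  by (rule type_ring.comm_inv_char) auto

lemma type_ring_pow [simp]: "x [^]\<^bsub>type_ring\<^esub> (n::nat) = (x :: 'l::field) ^ n"
  by (induction n) (auto simp: mult.commute)

lemma subfield_type_ring_iff:
  fixes F :: "'l::field set"
  shows "subfield F type_ring \<longleftrightarrow> 1 \<in> F \<and> (\<forall>x\<in>F. \<forall>y\<in>F. x + y \<in> F \<and> x * y \<in> F) \<and>
    (\<forall>x\<in>F. - x \<in> F \<and> inverse x \<in> F)" (is "_ \<longleftrightarrow> ?R")
proof
  assume F: "subfield F type_ring"
  note s = subringE[OF subfieldE(1)[OF F]]
  have "inverse x \<in> F" if "x \<in> F" for x
  proof (cases "x = 0")
    case False
    then show ?thesis using type_ring.subfield_m_inv(1)[OF F, of x] that by (simp add: type_ring_m_inv)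
  qed (use that in auto)
  then show ?R using s by auto
next
  assume R: ?R
  show "subfield F type_ring"
  proof (rule type_ring.subfieldI')
    show "subring F type_ring"
      by (rule type_ring.subringI) (use R in auto)
  qed (use R in \<open>auto simp: type_ring_m_inv\<close>)
qed

lemma subfield_closed:
  fixes F :: "'l::field set"
  assumes "subfield F type_ring"
  shows "1 \<in> F" "0 \<in> F" "x \<in> F \<Longrightarrow> y \<in> F \<Longrightarrow> x + y \<in> F" "x \<in> F \<Longrightarrow> y \<in> F \<Longrightarrow> x * y \<in> F"
    "x \<in> F \<Longrightarrow> - x \<in> F" "x \<in> F \<Longrightarrow> inverse x \<in> F" "x \<in> F \<Longrightarrow> y \<in> F \<Longrightarrow> x - y \<in> F"
    "x \<in> F \<Longrightarrow> y \<in> F \<Longrightarrow> x / y \<in> F" "x \<in> F \<Longrightarrow> x ^ n \<in> F"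
proof -
  note s = assms[unfolded subfield_type_ring_iff]
  show 1: "1 \<in> F" "x \<in> F \<Longrightarrow> y \<in> F \<Longrightarrow> x + y \<in> F" "x \<in> F \<Longrightarrow> y \<in> F \<Longrightarrow> x * y \<in> F"
    "x \<in> F \<Longrightarrow> - x \<in> F" "x \<in> F \<Longrightarrow> inverse x \<in> F"
    using s by auto
  have "1 + (- 1) \<in> F" using s by blast
  then show "0 \<in> F" by simp
  show "x \<in> F \<Longrightarrow> y \<in> F \<Longrightarrow> x - y \<in> F"
    using s by (metis diff_conv_add_uminus)
  show "x \<in> F \<Longrightarrow> y \<in> F \<Longrightarrow> x / y \<in> F"
    using s by (metis divide_inverse)
  show "x \<in> F \<Longrightarrow> x ^ n \<in> F" by (induction n) (use s in auto)
qed

lemma subfield_sum: "subfield F type_ring \<Longrightarrow> (\<And>i. i \<in> A \<Longrightarrow> f i \<in> F) \<Longrightarrow> sum f A \<in> (F :: 'l::field set)"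
  by (induction A rule: infinite_finite_induct) (auto intro: subfield_closed)

section \<open>Algebraicity in terms of type-class polynomials\<close>

definition poly_over :: "'l::field set \<Rightarrow> 'l poly \<Rightarrow> bool" where
  "poly_over F p \<longleftrightarrow> (\<forall>i. Polynomial.coeff p i \<in> F)"

definition alg_over :: "'l::field set \<Rightarrow> 'l \<Rightarrow> bool" where
  "alg_over F y \<longleftrightarrow> (\<exists>p. p \<noteq> 0 \<and> poly_over F p \<and> poly p y = 0)"

lemma alg_over_mono: "F \<subseteq> F' \<Longrightarrow> alg_over F y \<Longrightarrow> alg_over F' y"
  by (auto simp: alg_over_def poly_over_def)

text \<open>HOL-Algebra lists coefficients from the leading one down, \<open>Poly\<close> from the
  constant one up; hence \<open>rev\<close>.\<close>

lemma eval_type_ring: "ring.eval type_ring xs (y :: 'l::field) = poly (Poly (rev xs)) y"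
  by (induction xs) (simp_all add: Poly_append poly_monom mult.commute)

lemma algebraic_iff_alg_over:
  fixes F :: "'l::field set"
  assumes F: "subfield F type_ring"
  shows "ring.algebraic type_ring F y \<longleftrightarrow> alg_over F y"
proof
  assume "ring.algebraic type_ring F y"
  then obtain p where p: "p \<in> carrier (F[X]\<^bsub>type_ring\<^esub>)" "p \<noteq> []" "type_ring.eval p y = 0"
    using type_ring.algebraicE[OF subfieldE(1)[OF F], of y] by (auto simp: over_def)
  have "hd p \<noteq> 0" "set p \<subseteq> F" using p(1,2) by (auto simp: univ_poly_def polynomial_def)
  \<comment> \<open>The head of a normalized list is nonzero; after reversal it is the coefficient
    at index \<open>length p - 1\<close>.\<close>
  have "Poly (rev p) \<noteq> 0"
  proof
    assume "Poly (rev p) = 0"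
    then have "Polynomial.coeff (Poly (rev p)) (length p - 1) = 0" by simp
    then show False using p(2) \<open>hd p \<noteq> 0\<close>
      by (simp add: nth_default_def rev_nth hd_conv_nth split: if_splits)
  qed
  moreover have "poly_over F (Poly (rev p))"
    using \<open>set p \<subseteq> F\<close> subfield_closed(2)[OF F]
    by (auto simp: poly_over_def nth_default_def rev_nth)
  ultimately show "alg_over F y" using p(3) by (auto simp: alg_over_def eval_type_ring)
next
  assume "alg_over F y"
  then obtain p where p: "p \<noteq> 0" "poly_over F p" "poly p y = 0" by (auto simp: alg_over_def)
  have "rev (coeffs p) \<in> carrier (F[X]\<^bsub>type_ring\<^esub>)"
    using p by (auto simp: univ_poly_def polynomial_def hd_rev last_coeffs_eq_coeff_degree poly_over_def coeffs_def)
  moreover have "type_ring.eval (rev (coeffs p)) y = 0" using p by (simp add: eval_type_ring)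
  ultimately have "(type_ring.algebraic over F) y"
    using type_ring.algebraicI[of "rev (coeffs p)" F y] p by simp
  then show "ring.algebraic type_ring F y" by (simp add: over_def)
qed

lemma subfield_alg_over:
  fixes F :: "'l::field set"
  assumes F: "subfield F type_ring"
  shows "subfield {y. alg_over F y} type_ring"
  using type_ring.subfield_of_algebraics[OF F] algebraic_iff_alg_over[OF F] by (simp add: over_def)

lemma alg_over_self: "subfield F type_ring \<Longrightarrow> y \<in> F \<Longrightarrow> alg_over F (y :: 'l::field)"
  unfolding alg_over_def poly_over_def
  by (rule exI[of _ "[:-y, 1:]"]) (auto simp: coeff_pCons subfield_closed split: nat.splits)

text \<open>The coefficients of a relation for \<open>y\<close> are algebraic over \<open>F\<close>,
  so they generate a finite extension \<open>E\<close> of \<open>F\<close>. Adjoining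
  \<open>y\<close> to \<open>E\<close> is a finite step as well, and in a finite extension
  everything is algebraic.\<close>

lemma alg_over_trans:
  fixes F :: "'l::field set"
  assumes F: "subfield F type_ring" and y: "alg_over {z. alg_over F z} y"
  shows "alg_over F y"
proof -
  obtain p where p: "p \<noteq> 0" "poly_over {z. alg_over F z} p" "poly p y = 0" using y by (auto simp: alg_over_def)
  define xs where "xs = coeffs p"
  define E where "E = type_ring.finite_extension F xs"
  have alg: "(type_ring.algebraic over F) x" if "x \<in> set xs" for x
    using that p(1,2) by (auto simp: xs_def over_def poly_over_def coeffs_def algebraic_iff_alg_over[OF F])
  have E: "subfield E type_ring" unfolding E_def
    by (rule type_ring.finite_extension_is_subfield[OF F]) (use alg in auto)
  have xsE: "set xs \<subseteq> E" unfolding E_def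
    using type_ring.finite_extension_mem[OF subfieldE(1)[OF F], of xs] by auto
  have "poly_over E p" unfolding poly_over_def
  proof
    fix i show "Polynomial.coeff p i \<in> E"
      using xsE subfield_closed(2)[OF E] range_coeff[of p] rangeI[of "Polynomial.coeff p" i]
      unfolding xs_def by auto
  qed
  then have yE: "(type_ring.algebraic over E) y"
    using p algebraic_iff_alg_over[OF E, of y] by (auto simp: over_def alg_over_def)
  have "type_ring.finite_dimension F E" unfolding E_def
    by (rule type_ring.finite_extension_finite_dimension(1)[OF F]) (use alg in auto)
  then have "type_ring.finite_dimension F (type_ring.simple_extension E y)"
    using type_ring.telescopic_base_dim(1)[OF F E _
        type_ring.finite_dimensionI[OF type_ring.dimension_simple_extension[OF E _ yE]]] by auto
  then have "(type_ring.algebraic over F) y"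
    using type_ring.finite_dimension_imp_algebraic[OF F
      type_ring.simple_extension_is_subring[OF subfieldE(1)[OF E]]]
      type_ring.simple_extension_mem[OF subfieldE(1)[OF E]] by auto
  then show ?thesis using algebraic_iff_alg_over[OF F] by (simp add: over_def)
qed

end

section \<open>Extending partial isomorphisms of fields\<close>

text \<open>
  The graph of an isomorphism between two subfields that fixes \<open>F\<close>. Closure under
  \<open>inverse\<close> includes the pair \<open>(0, 0)\<close> because \<open>inverse 0 = 0\<close>.
\<close>

definition partial_iso :: "'l::field set \<Rightarrow> ('l \<times> 'l) set \<Rightarrow> bool" where
  "partial_iso F G \<longleftrightarrow> (\<forall>a\<in>F. (a, a) \<in> G) \<and>
     (\<forall>a b c d. (a, b) \<in> G \<longrightarrow> (c, d) \<in> G \<longrightarrow> (a + c, b + d) \<in> G \<and> (a * c, b * d) \<in> G) \<and>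
     (\<forall>a b. (a, b) \<in> G \<longrightarrow> (- a, - b) \<in> G \<and> (inverse a, inverse b) \<in> G \<and> (a = 0 \<longleftrightarrow> b = 0))"

lemma root_degree_pos: "p \<noteq> 0 \<Longrightarrow> poly p (x::'l::field) = 0 \<Longrightarrow> Polynomial.degree p > 0"
  by (auto elim!: degree_eq_zeroE intro!: Nat.gr0I)

text \<open>The polynomial \<open>q\<close> is the transport of \<open>p\<close> along the
  isomorphism with graph \<open>G\<close>. In the form of a relation, every construction below acts
  on both sides at once.\<close>

definition poly_rel :: "('l::field \<times> 'l) set \<Rightarrow> 'l poly \<Rightarrow> 'l poly \<Rightarrow> bool" where
  "poly_rel G p q \<longleftrightarrow> (\<forall>i. (Polynomial.coeff p i, Polynomial.coeff q i) \<in> G)"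

context
  fixes F :: "'l::field set" and G
  assumes F: "subfield F type_ring" and G: "partial_iso F G"
begin

lemma partial_iso_closed:
  "a \<in> F \<Longrightarrow> (a, a) \<in> G"
  "(a, b) \<in> G \<Longrightarrow> (c, d) \<in> G \<Longrightarrow> (a + c, b + d) \<in> G"
  "(a, b) \<in> G \<Longrightarrow> (c, d) \<in> G \<Longrightarrow> (a * c, b * d) \<in> G"
  "(a, b) \<in> G \<Longrightarrow> (- a, - b) \<in> G"
  "(a, b) \<in> G \<Longrightarrow> (inverse a, inverse b) \<in> G"
  "(a, b) \<in> G \<Longrightarrow> a = 0 \<longleftrightarrow> b = 0"
  "(0, 0) \<in> G" "(1, 1) \<in> G"
proof -
  note * = G[unfolded partial_iso_def]
  show id: "a \<in> F \<Longrightarrow> (a, a) \<in> G" for a using conjunct1[OF *] by simp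
  then show "(0, 0) \<in> G" "(1, 1) \<in> G" using subfield_closed(1,2)[OF F] by simp_all
  show "(a, b) \<in> G \<Longrightarrow> (c, d) \<in> G \<Longrightarrow> (a + c, b + d) \<in> G"
    "(a, b) \<in> G \<Longrightarrow> (c, d) \<in> G \<Longrightarrow> (a * c, b * d) \<in> G"
    using conjunct1[OF conjunct2[OF *]] by simp_all
  show "(a, b) \<in> G \<Longrightarrow> (- a, - b) \<in> G"
    "(a, b) \<in> G \<Longrightarrow> (inverse a, inverse b) \<in> G"
    "(a, b) \<in> G \<Longrightarrow> a = 0 \<longleftrightarrow> b = 0"
    using conjunct2[OF conjunct2[OF *]] by simp_all
qed

lemma partial_iso_minus: "(a, b) \<in> G \<Longrightarrow> (c, d) \<in> G \<Longrightarrow> (a - c, b - d) \<in> G"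
  using partial_iso_closed(2)[OF _ partial_iso_closed(4), of a b c d] by simp

text \<open>Single-valuedness and injectivity are not built into \<open>partial_iso\<close>; they
  come from its condition on zeros, applied to a difference.\<close>

lemma partial_iso_unique: "(a, b) \<in> G \<Longrightarrow> (a, c) \<in> G \<Longrightarrow> b = c"
  "(b, a) \<in> G \<Longrightarrow> (c, a) \<in> G \<Longrightarrow> b = c"
  using partial_iso_closed(6)[OF partial_iso_minus[of a b a c]]
    partial_iso_closed(6)[OF partial_iso_minus[of b a c a]] by simp_all

lemma partial_iso_sum: "(\<And>i. i \<in> A \<Longrightarrow> (f i, g i) \<in> G) \<Longrightarrow> (sum f A, sum g A) \<in> G"
  by (induction A rule: infinite_finite_induct) (auto intro: partial_iso_closed)

lemma poly_rel_add: "poly_rel G p p' \<Longrightarrow> poly_rel G q q' \<Longrightarrow> poly_rel G (p + q) (p' + q')"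
  by (simp add: poly_rel_def partial_iso_closed)

lemma poly_rel_minus: "poly_rel G p p' \<Longrightarrow> poly_rel G q q' \<Longrightarrow> poly_rel G (p - q) (p' - q')"
  by (simp add: poly_rel_def partial_iso_minus)

lemma poly_rel_uminus: "poly_rel G p p' \<Longrightarrow> poly_rel G (- p) (- p')"
  by (simp add: poly_rel_def partial_iso_closed)

lemma poly_rel_mult: "poly_rel G p p' \<Longrightarrow> poly_rel G q q' \<Longrightarrow> poly_rel G (p * q) (p' * q')"
  by (auto simp add: poly_rel_def coeff_mult intro!: partial_iso_closed partial_iso_sum)

lemma poly_rel_monom: "(a, b) \<in> G \<Longrightarrow> poly_rel G (Polynomial.monom a n) (Polynomial.monom b n)"
  by (auto simp add: poly_rel_def partial_iso_closed)

lemma poly_rel_const: "(a, b) \<in> G \<Longrightarrow> poly_rel G [:a:] [:b:]"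
  using poly_rel_monom[of a b 0] by (simp add: monom_0)

lemma poly_rel_1: "poly_rel G 1 1"
  using poly_rel_const[OF partial_iso_closed(8)] by (simp add: one_pCons)

lemma poly_rel_0: "poly_rel G 0 0"
  using poly_rel_const[OF partial_iso_closed(7)] by simp

lemma poly_rel_coeff_eq_0: "poly_rel G p q \<Longrightarrow> Polynomial.coeff p i = 0 \<longleftrightarrow> Polynomial.coeff q i = 0"
  unfolding poly_rel_def by (rule partial_iso_closed(6)) blast

lemma poly_rel_eq_0: "poly_rel G p q \<Longrightarrow> p = 0 \<longleftrightarrow> q = 0"
  unfolding poly_eq_iff by (simp add: poly_rel_coeff_eq_0)

lemma poly_rel_degree: "poly_rel G p q \<Longrightarrow> Polynomial.degree p = Polynomial.degree q"
  unfolding Polynomial.degree_def by (simp add: poly_rel_coeff_eq_0)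

lemma poly_rel_exists: "poly_over (Domain G) p \<Longrightarrow> \<exists>q. poly_rel G p q"
proof -
  assume p: "poly_over (Domain G) p"
  define \<phi> where "\<phi> a = (SOME b. (a, b) \<in> G)" for a
  have \<phi>: "(a, \<phi> a) \<in> G" if "a \<in> Domain G" for a
    unfolding \<phi>_def by (rule someI_ex) (use that in auto)
  \<comment> \<open>The choice function must fix 0 for \<open>map_poly\<close> to act
    coefficientwise.\<close>
  have "\<phi> 0 = 0" using \<phi>[of 0] partial_iso_closed(6,7) by blast
  then have "poly_rel G p (map_poly \<phi> p)"
    using p \<phi> by (auto simp: poly_rel_def coeff_map_poly poly_over_def)
  then show ?thesis ..
qed

lemma poly_rel_over: "poly_rel G p q \<Longrightarrow> poly_over (Domain G) p"
  by (auto simp: poly_rel_def poly_over_def)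

text \<open>Long division carried out on both sides with corresponding coefficients, by induction on
  a bound for the degree of \<open>p\<close>. The remainder is bounded through its coefficients
  rather than its degree so that a constant divisor, whose remainder is 0, is covered.\<close>

lemma poly_rel_division:
  assumes m: "poly_rel G m m'" "m \<noteq> 0"
  assumes "poly_rel G p p'"
  shows "\<exists>s s' r r'. poly_rel G s s' \<and> poly_rel G r r' \<and> p = m * s + r \<and> p' = m' * s' + r' \<and>
           (\<forall>i\<ge>Polynomial.degree m. Polynomial.coeff r i = 0)"
proof -
  define d where "d = Polynomial.degree m"
  have d': "Polynomial.degree m' = d" using poly_rel_degree[OF m(1)] by (simp add: d_def)
  have "\<exists>s s' r r'. poly_rel G s s' \<and> poly_rel G r r' \<and> p = m * s + r \<and> p' = m' * s' + r' \<and>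
           (\<forall>i\<ge>d. Polynomial.coeff r i = 0)"
    if "\<forall>i\<ge>n. Polynomial.coeff p i = 0" "poly_rel G p p'" for n p p'
    using that
  proof (induction n arbitrary: p p')
    case 0
    then show ?case
      by (intro exI[of _ 0] exI[of _ p] exI[of _ p']) (auto simp: poly_rel_0)
  next
    case (Suc n)
    show ?case
    proof (cases "Suc n \<le> d")
      case True
      with Suc.prems show ?thesis
        by (intro exI[of _ 0] exI[of _ p] exI[of _ p']) (auto simp: poly_rel_0)
    next
      case False
      \<comment> \<open>Subtracting \<open>m\<close> times the monomial with coefficient
        \<open>c\<close> cancels the top coefficient of \<open>p\<close>, which lowers the bound by
        one.\<close>
      define c where "c = Polynomial.coeff p n * inverse (Polynomial.coeff m d)"
      define c' where "c' = Polynomial.coeff p' n * inverse (Polynomial.coeff m' d)"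
      have c: "(c, c') \<in> G" using Suc.prems(2) m(1)
        unfolding c_def c'_def poly_rel_def by (intro partial_iso_closed) auto
      define t where "t = Polynomial.monom c (n - d)"
      define t' where "t' = Polynomial.monom c' (n - d)"
      have t: "poly_rel G t t'" unfolding t_def t'_def by (rule poly_rel_monom[OF c])
      have "\<forall>i\<ge>n. Polynomial.coeff (p - m * t) i = 0"
      proof (intro allI impI)
        fix i assume i: "n \<le> i"
        have "Polynomial.coeff m d \<noteq> 0" using m(2) by (simp add: d_def)
        then show "Polynomial.coeff (p - m * t) i = 0"
          using i False Suc.prems(1)
          by (cases "i = n") (auto simp: t_def mult.commute[of m] coeff_monom_mult c_def d_def coeff_eq_0)
      qed
      from Suc.IH[OF this poly_rel_minus[OF Suc.prems(2) poly_rel_mult[OF m(1) t]]]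
      obtain s s' r r' where sr: "poly_rel G s s'" "poly_rel G r r'" "p - m * t = m * s + r"
         "p' - m' * t' = m' * s' + r'" "\<forall>i\<ge>d. Polynomial.coeff r i = 0" by blast
      show ?thesis
        by (rule exI[of _ "t + s"], rule exI[of _ "t' + s'"], rule exI[of _ r], rule exI[of _ r'])
          (use sr poly_rel_add[OF t sr(1)] in \<open>auto simp: algebra_simps\<close>)
    qed
  qed
  from this[of "Suc (Polynomial.degree p)", OF _ assms(3)] show ?thesis
    unfolding d_def by (auto simp: coeff_eq_0)
qed

section \<open>Adjoining a root of a polynomial of minimal degree\<close>

context
  fixes x y and m m' :: "'l poly"
  assumes m: "poly_rel G m m'" "m \<noteq> 0" "poly m x = 0" "poly m' y = 0"
    and min: "\<And>q. q \<noteq> 0 \<Longrightarrow> poly_over (Domain G) q \<Longrightarrow> poly q x = 0 \<Longrightarrow> Polynomial.degree m \<le> Polynomial.degree q"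
begin

lemma min_poly_degree: "Polynomial.degree m > 0"
  by (rule root_degree_pos[OF m(2,3)])

lemma poly_reduce:
  assumes "poly_rel G q q'"
  obtains r r' where "poly_rel G r r'" "poly q x = poly r x" "poly q' y = poly r' y"
    "Polynomial.degree r < Polynomial.degree m"
proof -
  from poly_rel_division[OF m(1,2) assms] obtain s s' r r' where
    "poly_rel G r r'" "q = m * s + r" "q' = m' * s' + r'"
    "\<forall>i\<ge>Polynomial.degree m. Polynomial.coeff r i = 0" by blast
  moreover from this have "Polynomial.degree r < Polynomial.degree m"
    using min_poly_degree by (intro degree_lessI) auto
  ultimately show ?thesis using that m by auto
qed

text \<open>The remainder of \<open>q\<close> modulo \<open>m\<close> has degree below that of
  \<open>m\<close>. By minimality it vanishes at \<open>x\<close> only if it is the zero polynomial,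
  and then so is its transport.\<close>

lemma poly_rel_root:
  assumes "poly_rel G q q'" "poly q x = 0"
  shows "poly q' y = 0"
proof -
  obtain r r' where r: "poly_rel G r r'" "poly q x = poly r x" "poly q' y = poly r' y"
    "Polynomial.degree r < Polynomial.degree m" using poly_reduce[OF assms(1)] .
  have "r = 0" using min[OF _ poly_rel_over[OF r(1)]] r(2,4) assms(2) by (cases "r = 0") auto
  then have "r' = 0" using poly_rel_eq_0[OF r(1)] by simp
  then show ?thesis using r by simp
qed

text \<open>Minimality of \<open>m\<close> makes the polynomial expressions in \<open>x\<close> a
  field. The inverse comes from dividing \<open>m\<close> by \<open>q\<close>, not \<open>q\<close>
  by \<open>m\<close>: from \<open>m = q * s + r\<close> follows \<open>r(x) = - q(x) s(x)\<close>,
  and \<open>r\<close> has smaller degree than \<open>q\<close>.\<close>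

lemma poly_rel_inverse:
  assumes "poly_rel G q q'" "poly q x \<noteq> 0"
  shows "\<exists>s s'. poly_rel G s s' \<and> poly q x * poly s x = 1"
proof -
  have *: "\<exists>s s'. poly_rel G s s' \<and> poly q x * poly s x = 1"
    if "poly_rel G q q'" "poly q x \<noteq> 0" "Polynomial.degree q < Polynomial.degree m" for q q'
    using that
  proof (induction "Polynomial.degree q" arbitrary: q q' rule: less_induct)
    case less
    show ?case
    proof (cases "Polynomial.degree q = 0")
      case True
      then obtain a where q: "q = [:a:]" by (auto elim: degree_eq_zeroE)
      from poly_rel_degree[OF less.prems(1)] True obtain b where q': "q' = [:b:]"
        by (auto elim: degree_eq_zeroE)
      have "Polynomial.coeff q 0 = a" "Polynomial.coeff q' 0 = b" by (auto simp: q q')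
      then have "(a, b) \<in> G" using less.prems(1) unfolding poly_rel_def by blast
      then have "poly_rel G [:inverse a:] [:inverse b:]" by (intro poly_rel_const partial_iso_closed)
      then show ?thesis using less.prems(2) q by (intro exI conjI) auto
    next
      case False
      have q0: "q \<noteq> 0" using False by auto
      from poly_rel_division[OF less.prems(1) q0 m(1)] obtain s s' r r' where
        sr: "poly_rel G s s'" "poly_rel G r r'" "m = q * s + r"
        "\<forall>i\<ge>Polynomial.degree q. Polynomial.coeff r i = 0" by blast
      have deg: "Polynomial.degree r < Polynomial.degree q"
        using sr(4) False by (intro degree_lessI) auto
      have 0: "poly q x * poly s x + poly r x = 0" using m(3) unfolding sr(3) by simp
      show ?thesis
      proof (cases "poly r x = 0")
        case True
        \<comment> \<open>A root \<open>x\<close> of \<open>s\<close> contradicts minimality: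
          \<open>s\<close> is nonzero of degree \<open>deg m - deg q\<close>, and \<open>q\<close>
          is not constant.\<close>
        then have "poly s x = 0" using 0 less.prems(2) by simp
        moreover have "s \<noteq> 0" using sr(3) deg less.prems(3) by auto
        ultimately have "Polynomial.degree m \<le> Polynomial.degree s"
          using min[OF _ poly_rel_over[OF sr(1)]] by simp
        moreover have "Polynomial.degree (q * s + r) = Polynomial.degree q + Polynomial.degree s"
          using deg q0 \<open>s \<noteq> 0\<close> by (subst degree_add_eq_left) (auto simp: degree_mult_eq)
        ultimately show ?thesis using False sr(3) by simp
      next
        case False
        from less.hyps[OF deg sr(2) False] deg less.prems(3) obtain t t'
          where t: "poly_rel G t t'" "poly r x * poly t x = 1" by auto
        have r: "poly r x = - (poly q x * poly s x)" using 0 by (simp add: eq_neg_iff_add_eq_0 add.commute)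
        have "poly q x * poly (- (s * t)) x = 1" using t(2) unfolding r by (simp add: algebra_simps)
        then show ?thesis using poly_rel_uminus[OF poly_rel_mult[OF sr(1) t(1)]] by blast
      qed
    qed
  qed
  obtain r r' where r: "poly_rel G r r'" "poly q x = poly r x" "poly q' y = poly r' y"
    "Polynomial.degree r < Polynomial.degree m" using poly_reduce[OF assms(1)] .
  show ?thesis using *[OF r(1) _ r(4)] r assms(2) by simp
qed

text \<open>For the converse direction, a nonzero value at \<open>x\<close> has an inverse
  \<open>s(x)\<close>; the relation \<open>q * s - 1\<close> transports to \<open>y\<close> and
  excludes a zero there.\<close>

lemma poly_rel_root_iff:
  assumes "poly_rel G q q'"
  shows "poly q x = 0 \<longleftrightarrow> poly q' y = 0"
proof
  show "poly q x = 0 \<Longrightarrow> poly q' y = 0" by (rule poly_rel_root[OF assms])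
  show "poly q x = 0" if "poly q' y = 0"
  proof (rule ccontr)
    assume "poly q x \<noteq> 0"
    from poly_rel_inverse[OF assms this] obtain s s' where s: "poly_rel G s s'" "poly q x * poly s x = 1"
      by blast
    have "poly (q' * s' - 1) y = 0"
      by (rule poly_rel_root[OF poly_rel_minus[OF poly_rel_mult[OF assms s(1)] poly_rel_1]]) (simp add: s)
    then show False using that by simp
  qed
qed

text \<open>The new graph consists of the pairs of values, at \<open>x\<close> and at
  \<open>y\<close>, of corresponding polynomials. That it is the graph of an injective map is
  \<open>poly_rel_root_iff\<close>; that it is closed under inverses is
  \<open>poly_rel_inverse\<close>.\<close>

lemma partial_iso_adjoin:
  "\<exists>G'. partial_iso F G' \<and> G \<subseteq> G' \<and> (x, y) \<in> G'"
proof (intro exI conjI)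
  define G' where "G' = {(poly p x, poly q y) |p q. poly_rel G p q}"
  have G': "(poly p x, poly q y) \<in> G'" if "poly_rel G p q" for p q using that by (auto simp: G'_def)
  have G'E: "\<exists>p q. a = poly p x \<and> b = poly q y \<and> poly_rel G p q" if "(a, b) \<in> G'" for a b
    using that by (auto simp: G'_def)
  show "G \<subseteq> G'" using G'[OF poly_rel_const] by auto
  show "(x, y) \<in> G'" using G'[OF poly_rel_monom[OF partial_iso_closed(8), of 1]] by (simp add: poly_monom)
  show "partial_iso F G'" unfolding partial_iso_def
  proof (intro conjI allI impI ballI)
    fix a assume "a \<in> F" then show "(a, a) \<in> G'"
      using partial_iso_closed(1) \<open>G \<subseteq> G'\<close> by blast
  next
    fix a b c d assume "(a, b) \<in> G'" "(c, d) \<in> G'"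
    then obtain p q p' q' where *: "a = poly p x" "b = poly q y" "poly_rel G p q"
      "c = poly p' x" "d = poly q' y" "poly_rel G p' q'" using G'E[of a b] G'E[of c d] by auto
    show "(a + c, b + d) \<in> G'" "(a * c, b * d) \<in> G'"
      using G'[OF poly_rel_add[OF *(3,6)]] G'[OF poly_rel_mult[OF *(3,6)]] * by auto
  next
    fix a b assume "(a, b) \<in> G'"
    then obtain p q where *: "a = poly p x" "b = poly q y" "poly_rel G p q" using G'E[of a b] by auto
    show "(- a, - b) \<in> G'" using G'[OF poly_rel_uminus[OF *(3)]] * by auto
    show eq: "a = 0 \<longleftrightarrow> b = 0" using poly_rel_root_iff[OF *(3)] * by simp
    show "(inverse a, inverse b) \<in> G'"
    proof (cases "a = 0")
      case True
      then show ?thesis using eq G'[OF poly_rel_0] by simp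
    next
      case False
      from poly_rel_inverse[OF *(3)] False * obtain s s' where s: "poly_rel G s s'" "poly p x * poly s x = 1"
        by auto
      have "poly (q * s' - 1) y = 0"
        by (rule poly_rel_root[OF poly_rel_minus[OF poly_rel_mult[OF *(3) s(1)] poly_rel_1]]) (simp add: s)
      then have "inverse b = poly s' y" using * by (simp add: inverse_unique)
      moreover have "inverse a = poly s x" using s(2) * by (simp add: inverse_unique)
      ultimately show ?thesis using G'[OF s(1)] by simp
    qed
  qed
qed

end

lemma min_poly_exists:
  assumes "alg_over (Domain G) x"
  obtains m where "m \<noteq> 0" "poly_over (Domain G) m" "poly m x = 0"
    "\<And>q. q \<noteq> 0 \<Longrightarrow> poly_over (Domain G) q \<Longrightarrow> poly q x = 0 \<Longrightarrow> Polynomial.degree m \<le> Polynomial.degree q"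
proof -
  let ?P = "\<lambda>p. p \<noteq> 0 \<and> poly_over (Domain G) p \<and> poly p x = 0"
  obtain p where "?P p" using assms by (auto simp: alg_over_def)
  from ex_has_least_nat[of ?P p Polynomial.degree, OF this] show ?thesis using that by blast
qed

end

lemma partial_iso_extend:
  fixes F :: "'l::alg_closed_field set"
  assumes F: "subfield F type_ring" and G: "partial_iso F G" and x: "alg_over F x"
  shows "\<exists>G'. partial_iso F G' \<and> G \<subseteq> G' \<and> x \<in> Domain G'"
proof -
  have "F \<subseteq> Domain G" using G by (auto simp: partial_iso_def)
  then have "alg_over (Domain G) x" using x alg_over_mono by blast
  from min_poly_exists[OF F G this] obtain m where m: "m \<noteq> 0" "poly_over (Domain G) m" "poly m x = 0"
    "\<And>q. q \<noteq> 0 \<Longrightarrow> poly_over (Domain G) q \<Longrightarrow> poly q x = 0 \<Longrightarrow> Polynomial.degree m \<le> Polynomial.degree q"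
    by blast
  obtain m' where m': "poly_rel G m m'" using poly_rel_exists[OF F G m(2)] by blast
  have "Polynomial.degree m' > 0"
    using root_degree_pos[OF m(1,3)] poly_rel_degree[OF F G m'] by simp
  then obtain y where "poly m' y = 0" using alg_closed_imp_poly_has_root by blast
  from partial_iso_adjoin[OF F G m' m(1,3) this m(4)] show ?thesis by blast
qed

lemma partial_iso_converse: "partial_iso F G \<Longrightarrow> partial_iso F (G\<inverse>)"
  by (auto simp: partial_iso_def)

text \<open>By Zorn's lemma there is a graph that cannot be extended, so its domain is full. The
  converse graph cannot be extended either, so the range is full too; this will give
  surjectivity.\<close>

lemma partial_iso_maximal:
  fixes F :: "'l::alg_closed_field set"
  assumes F: "subfield F type_ring" and G: "partial_iso F G"
  obtains M where "partial_iso F M" "G \<subseteq> M" "{x. alg_over F x} \<subseteq> Domain M"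
    "{x. alg_over F x} \<subseteq> Range M"
proof -
  define S where "S = {M. partial_iso F M \<and> G \<subseteq> M}"
  have "\<exists>M\<in>S. \<forall>N\<in>S. M \<subseteq> N \<longrightarrow> N = M"
  proof (rule subset_Zorn_nonempty)
    show "S \<noteq> {}" using G by (auto simp: S_def)
    fix \<C> assume C: "\<C> \<noteq> {}" "subset.chain S \<C>"
    have *: "partial_iso F M" "G \<subseteq> M" if "M \<in> \<C>" for M using C that by (auto simp: subset.chain_def S_def)
    have two: "\<exists>M\<in>\<C>. p \<in> M \<and> q \<in> M" if "p \<in> \<Union>\<C>" "q \<in> \<Union>\<C>" for p q
    proof -
      from that obtain M N where "M \<in> \<C>" "N \<in> \<C>" "p \<in> M" "q \<in> N" by auto
      moreover from this have "M \<subseteq> N \<or> N \<subseteq> M" using C(2) by (auto simp: subset.chain_def)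
      ultimately show ?thesis by blast
    qed
    have "partial_iso F (\<Union>\<C>)" unfolding partial_iso_def
    proof (intro conjI allI impI ballI)
      fix a assume "a \<in> F" then show "(a, a) \<in> \<Union>\<C>" using C(1) *(1) by (auto simp: partial_iso_def)
    next
      fix a b c d assume "(a, b) \<in> \<Union>\<C>" "(c, d) \<in> \<Union>\<C>"
      then obtain M where M: "M \<in> \<C>" "(a, b) \<in> M" "(c, d) \<in> M" using two by blast
      show "(a + c, b + d) \<in> \<Union>\<C>" "(a * c, b * d) \<in> \<Union>\<C>"
        using partial_iso_closed(2,3)[OF F *(1)[OF M(1)] M(2,3)] M(1) by blast+
    next
      fix a b assume "(a, b) \<in> \<Union>\<C>"
      then obtain M where M: "M \<in> \<C>" "(a, b) \<in> M" by blast
      show "(- a, - b) \<in> \<Union>\<C>" "(inverse a, inverse b) \<in> \<Union>\<C>" "a = 0 \<longleftrightarrow> b = 0"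
        using partial_iso_closed(4-6)[OF F *(1)[OF M(1)] M(2)] M(1) by blast+
    qed
    then show "\<Union>\<C> \<in> S" using C(1) *(2) unfolding S_def by blast
  qed
  then obtain M where MS: "M \<in> S" and MS': "\<forall>N\<in>S. M \<subseteq> N \<longrightarrow> N = M" by blast
  have M: "partial_iso F M" "G \<subseteq> M" using MS by (simp_all add: S_def)
  have max: "N = M" if "partial_iso F N" "M \<subseteq> N" for N
    using MS' that M(2) by (simp add: S_def)
  have dom: "x \<in> Domain M" if "alg_over F x" for x
    using partial_iso_extend[OF F M(1) that] max by metis
  moreover have "x \<in> Range M" if x: "alg_over F x" for x
  proof -
    from partial_iso_extend[OF F partial_iso_converse[OF M(1)] x] obtain N where
      N: "partial_iso F N" "M\<inverse> \<subseteq> N" "x \<in> Domain N" by blast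
    have "M \<subseteq> N\<inverse>" using N(2) by auto
    from max[OF partial_iso_converse[OF N(1)] this] show ?thesis using N(3) by auto
  qed
  ultimately show ?thesis using M that by blast
qed

text \<open>Evaluation of a polynomial over \<open>F\<close> commutes with an isomorphism that fixes
  \<open>F\<close>, so \<open>x\<close> and \<open>y\<close> are roots of the same such
  polynomials.\<close>

lemma partial_iso_alg_over:
  assumes F: "subfield F type_ring" and G: "partial_iso F G" and xy: "(x, y) \<in> G"
  shows "alg_over F x \<longleftrightarrow> alg_over F y"
proof -
  have "poly p x = 0 \<longleftrightarrow> poly p y = 0" if "poly_over F p" for p
  proof -
    have "(poly p x, poly p y) \<in> G"
      using that xy unfolding poly_over_def
    proof (induction p)
      case 0 then show ?case using partial_iso_closed(7)[OF F G] by simp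
    next
      case (pCons a p)
      from pCons.prems have "a \<in> F" "\<forall>i. Polynomial.coeff p i \<in> F"
        by (metis coeff_pCons_0, metis coeff_pCons_Suc)
      with pCons show ?case by (auto intro!: partial_iso_closed[OF F G])
    qed
    then show ?thesis using partial_iso_closed(6)[OF F G] by blast
  qed
  then show ?thesis by (auto simp: alg_over_def)
qed

text \<open>The minimal polynomial of \<open>c\<close> has a second root \<open>c'\<close>, and the
  isomorphism that sends \<open>c\<close> to \<open>c'\<close> extends to the whole algebraic
  closure of \<open>F\<close>.\<close>

lemma Gal_exists_moving:
  fixes F :: "'l::alg_closed_field set"
  assumes F: "subfield F type_ring" and c: "alg_over F c" "c \<notin> F"
    and char0: "\<And>n. n > 0 \<Longrightarrow> of_nat n \<noteq> (0::'l)"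
  shows "\<exists>\<sigma>\<in>carrier (Gal {y. alg_over F y} F). \<sigma> c \<noteq> c"
proof -
  let ?E = "{y. alg_over F y}"
  have Id: "partial_iso F (Id_on F)"
    using subfield_closed[OF F] by (auto simp: partial_iso_def)
  have [simp]: "Domain (Id_on F) = F" by auto
  from min_poly_exists[OF F Id, of c] c obtain m where m: "m \<noteq> 0" "poly_over F m" "poly m c = 0"
    "\<And>q. q \<noteq> 0 \<Longrightarrow> poly_over F q \<Longrightarrow> poly q c = 0 \<Longrightarrow> Polynomial.degree m \<le> Polynomial.degree q"
    by auto
  \<comment> \<open>With \<open>c\<close> as its only root, \<open>m\<close> is a multiple of
    \<open>(X - c) ^ n\<close>. Its second coefficient is the leading one times
    \<open>- n * c\<close>, so in characteristic 0 the element \<open>c\<close> itself lies in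
    \<open>F\<close>.\<close>
  have "\<exists>c'. poly m c' = 0 \<and> c' \<noteq> c"
  proof (rule ccontr)
    assume no: "\<not> ?thesis"
    obtain A where A: "size A = Polynomial.degree m"
      "m = smult (Polynomial.lead_coeff m) (\<Prod>x\<in>#A. [:-x, 1:])"
      using alg_closed_imp_factorization[OF m(1)] by blast
    define n where "n = Polynomial.degree m"
    have lc: "Polynomial.lead_coeff m \<noteq> 0" using m(1) by simp
    have "x = c" if "x \<in># A" for x
    proof -
      have "poly (\<Prod>x\<in>#A. [:-x, 1:]) x = 0" using that by (auto simp: poly_prod_mset image_image)
      then have "poly m x = 0" by (subst A(2)) simp
      then show ?thesis using no by blast
    qed
    then have "A = replicate_mset n c" using A(1) n_def
      by (metis set_mset_subset_singletonD subsetI singleton_iff)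
    then have m_eq: "m = smult (Polynomial.lead_coeff m) ([:-c, 1:] ^ n)" using A(2) by simp
    have n0: "n > 0" using root_degree_pos[OF m(1,3)] by (simp add: n_def)
    then obtain k where k: "n = Suc k" by (cases n) auto
    have "Polynomial.coeff m k = Polynomial.lead_coeff m * (of_nat n * (- c))"
    proof -
      have "Polynomial.coeff ([:-c, 1:] ^ Suc k) k = of_nat (Suc k) * (- c)" for k
      proof (induction k)
        case (Suc k)
        have *: "Polynomial.coeff ([:-c, 1:] * q) (Suc k) = - c * Polynomial.coeff q (Suc k) + Polynomial.coeff q k"
          for q by simp
        have "Polynomial.coeff ([:-c, 1:] ^ Suc (Suc k)) (Suc k) =
            - c * Polynomial.coeff ([:-c, 1:] ^ Suc k) (Suc k) + Polynomial.coeff ([:-c, 1:] ^ Suc k) k"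
          unfolding power_Suc[of _ "Suc k"] by (rule *)
        also have "Polynomial.coeff ([:-c, 1:] ^ Suc k) (Suc k) = 1"
          using lead_coeff_power[of "[:-c,1:]" "Suc k"] degree_linear_power[of "-c" "Suc k"] by simp
        finally show ?case unfolding Suc by (simp add: algebra_simps)
      qed simp
      then show ?thesis unfolding k by (subst m_eq[unfolded k]) (simp del: power_Suc)
    qed
    then have "c = - Polynomial.coeff m k / (Polynomial.lead_coeff m * of_nat n)"
      using lc char0[OF n0] by (simp add: field_simps)
    moreover have "of_nat n \<in> F" for n by (induction n) (auto intro: subfield_closed[OF F])
    ultimately have "c \<in> F" using m(2) unfolding poly_over_def
      by (metis subfield_closed(4,5,8)[OF F])
    then show False using c by simp
  qed
  then obtain c' where c': "poly m c' = 0" "c' \<noteq> c" by blast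
  have "poly_rel (Id_on F) m m" using m(2) by (auto simp: poly_rel_def poly_over_def)
  from partial_iso_adjoin[OF F Id this m(1,3) c'(1)] m(4) obtain G where G: "partial_iso F G" "(c, c') \<in> G"
    by auto
  obtain M where M: "partial_iso F M" "G \<subseteq> M" "?E \<subseteq> Domain M" "?E \<subseteq> Range M"
    using partial_iso_maximal[OF F G(1)] .
  define \<sigma> where "\<sigma> = (\<lambda>x\<in>?E. THE y. (x, y) \<in> M)"
  have \<sigma>: "\<sigma> x = y" if "x \<in> ?E" "(x, y) \<in> M" for x y
    using that partial_iso_unique[OF F M(1)] by (auto simp: \<sigma>_def)
  have \<sigma>M: "(x, \<sigma> x) \<in> M" if "x \<in> ?E" for x
    using \<sigma>[OF that] M(3) that by blast
  have E: "subfield ?E type_ring" by (rule subfield_alg_over[OF F])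
  have "bij_betw \<sigma> ?E ?E"
  proof (rule bij_betwI')
    fix x y assume "x \<in> ?E" "y \<in> ?E"
    then show "(\<sigma> x = \<sigma> y) = (x = y)" using \<sigma>M partial_iso_unique[OF F M(1)] by metis
  next
    fix x assume "x \<in> ?E"
    then show "\<sigma> x \<in> ?E" using \<sigma>M partial_iso_alg_over[OF F M(1)] by blast
  next
    fix y assume "y \<in> ?E"
    then obtain x where "(x, y) \<in> M" using M(4) by blast
    then show "\<exists>x\<in>?E. y = \<sigma> x" using \<sigma> partial_iso_alg_over[OF F M(1)] \<open>y \<in> ?E\<close> by blast
  qed
  moreover have "\<sigma> x = x" if "x \<in> F" for x
    using \<sigma>[of x x] alg_over_self[OF F that] that M(1) by (auto simp: partial_iso_def)
  moreover have "\<sigma> (x + y) = \<sigma> x + \<sigma> y \<and> \<sigma> (x * y) = \<sigma> x * \<sigma> y" if "x \<in> ?E" "y \<in> ?E" for x y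
    using \<sigma> \<sigma>M[OF that(1)] \<sigma>M[OF that(2)] subfield_closed(3,4)[OF E that]
      partial_iso_closed(2,3)[OF F M(1)] by blast
  ultimately have "\<sigma> \<in> carrier (Gal ?E F)"
    by (simp add: Gal_def BijGroup_def Bij_def) (simp add: \<sigma>_def)
  moreover have "\<sigma> c = c'" using \<sigma>[of c c'] c G M by blast
  ultimately show ?thesis using c' by metis
qed

section \<open>Real valuations and their residues\<close>

text \<open>Zero is added by hand because the value of \<open>w\<close> at 0 is arbitrary; the same
  holds for \<open>val_max\<close>.\<close>

definition val_ring :: "('l::field \<Rightarrow> real) \<Rightarrow> 'l set" where
  "val_ring w = {a. a = 0 \<or> 0 \<le> w a}"

definition val_max :: "('l::field \<Rightarrow> real) \<Rightarrow> 'l set" where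
  "val_max w = {a. a = 0 \<or> 0 < w a}"

locale field_valuation =
  fixes w :: "'l::field \<Rightarrow> real"
  assumes valuation: "valuation type_ring w"
begin

lemma w_mult: "a \<noteq> 0 \<Longrightarrow> b \<noteq> 0 \<Longrightarrow> w (a * b) = w a + w b"
  using valuation by (simp add: valuation_def)

lemma w_add: "a \<noteq> 0 \<Longrightarrow> b \<noteq> 0 \<Longrightarrow> a + b \<noteq> 0 \<Longrightarrow> min (w a) (w b) \<le> w (a + b)"
  using valuation by (simp add: valuation_def)

lemma w_1 [simp]: "w 1 = 0"
  using w_mult[of 1 1] by simp

lemma w_minus [simp]: "w (- a) = w a"
proof (cases "a = 0")
  case False
  have "w (- 1) = 0" using w_mult[of "-1" "-1"] by simp
  then show ?thesis using w_mult[of "-1" a] False by simp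
qed simp

lemma w_inverse: "a \<noteq> 0 \<Longrightarrow> w (inverse a) = - w a"
  using w_mult[of a "inverse a"] by simp

lemma w_divide: "a \<noteq> 0 \<Longrightarrow> b \<noteq> 0 \<Longrightarrow> w (a / b) = w a - w b"
  by (simp add: divide_inverse w_mult w_inverse)

lemma w_power: "a \<noteq> 0 \<Longrightarrow> w (a ^ n) = of_nat n * w a"
  by (induction n) (auto simp: w_mult algebra_simps)

lemma val_ring_add: "a \<in> val_ring w \<Longrightarrow> b \<in> val_ring w \<Longrightarrow> a + b \<in> val_ring w"
  using w_add[of a b] by (cases "a = 0"; cases "b = 0"; cases "a + b = 0") (auto simp: val_ring_def)

lemma val_max_add: "a \<in> val_max w \<Longrightarrow> b \<in> val_max w \<Longrightarrow> a + b \<in> val_max w"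
  using w_add[of a b] by (cases "a = 0"; cases "b = 0"; cases "a + b = 0") (auto simp: val_max_def)

lemma val_ring_mult: "a \<in> val_ring w \<Longrightarrow> b \<in> val_ring w \<Longrightarrow> a * b \<in> val_ring w"
  using w_mult[of a b] by (cases "a = 0"; cases "b = 0") (auto simp: val_ring_def)

lemma val_max_mult: "a \<in> val_max w \<Longrightarrow> b \<in> val_ring w \<Longrightarrow> a * b \<in> val_max w"
  "b \<in> val_ring w \<Longrightarrow> a \<in> val_max w \<Longrightarrow> b * a \<in> val_max w"
  using w_mult[of a b] w_mult[of b a]
  by (cases "a = 0"; cases "b = 0"; auto simp: val_ring_def val_max_def)+

lemma val_minus [simp]: "- a \<in> val_ring w \<longleftrightarrow> a \<in> val_ring w" "- a \<in> val_max w \<longleftrightarrow> a \<in> val_max w"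
  by (auto simp: val_ring_def val_max_def)

lemma val_ring_diff: "a \<in> val_ring w \<Longrightarrow> b \<in> val_ring w \<Longrightarrow> a - b \<in> val_ring w"
  using val_ring_add[of a "- b"] by simp

lemma val_max_diff: "a \<in> val_max w \<Longrightarrow> b \<in> val_max w \<Longrightarrow> a - b \<in> val_max w"
  using val_max_add[of a "- b"] by simp

lemma val_max_subset: "a \<in> val_max w \<Longrightarrow> a \<in> val_ring w"
  by (auto simp: val_ring_def val_max_def)

lemma val_0_1 [simp]: "0 \<in> val_ring w" "0 \<in> val_max w" "1 \<in> val_ring w" "1 \<notin> val_max w"
  by (auto simp: val_ring_def val_max_def)

lemma val_ring_power: "a \<in> val_ring w \<Longrightarrow> a ^ n \<in> val_ring w"
  by (induction n) (auto intro: val_ring_mult)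

lemma val_ring_sum: "(\<And>i. i \<in> A \<Longrightarrow> f i \<in> val_ring w) \<Longrightarrow> sum f A \<in> val_ring w"
  by (induction A rule: infinite_finite_induct) (auto intro: val_ring_add)

lemma val_max_sum: "(\<And>i. i \<in> A \<Longrightarrow> f i \<in> val_max w) \<Longrightarrow> sum f A \<in> val_max w"
  by (induction A rule: infinite_finite_induct) (auto intro: val_max_add)

lemma val_max_prime: "a * b \<in> val_max w \<Longrightarrow> a \<in> val_ring w \<Longrightarrow> b \<in> val_ring w \<Longrightarrow> a \<in> val_max w \<or> b \<in> val_max w"
  using w_mult[of a b] by (cases "a = 0"; cases "b = 0") (auto simp: val_ring_def val_max_def)

lemma val_unit: "a \<in> val_ring w \<Longrightarrow> a \<notin> val_max w \<Longrightarrow> a \<noteq> 0 \<and> w a = 0"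
  by (auto simp: val_ring_def val_max_def)

lemma val_unit_perturb: "a - b \<in> val_max w \<Longrightarrow> b \<noteq> 0 \<Longrightarrow> w b = 0 \<Longrightarrow> a \<noteq> 0 \<and> w a = 0"
proof -
  assume *: "a - b \<in> val_max w" "b \<noteq> 0" "w b = 0"
  have b: "b \<in> val_ring w" "b \<notin> val_max w" using * by (auto simp: val_ring_def val_max_def)
  have "a \<in> val_ring w" using val_ring_add[OF val_max_subset[OF *(1)] b(1)] by simp
  moreover have "a \<notin> val_max w" using val_max_diff[of a "a - b"] * b by auto
  ultimately show ?thesis by (rule val_unit)
qed

lemma poly_val_ring: "(\<And>i. Polynomial.coeff p i \<in> val_ring w) \<Longrightarrow> y \<in> val_ring w \<Longrightarrow> poly p y \<in> val_ring w"
  unfolding poly_altdef by (intro val_ring_sum val_ring_mult val_ring_power) auto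

lemma poly_val_max: "(\<And>i. Polynomial.coeff p i \<in> val_max w) \<Longrightarrow> y \<in> val_ring w \<Longrightarrow> poly p y \<in> val_max w"
  unfolding poly_altdef by (intro val_max_sum val_max_mult val_ring_power) auto

text \<open>If \<open>w y\<close> were negative, the reciprocal \<open>z\<close> of \<open>y\<close>
  would lie in the maximal ideal. The reversed polynomial vanishes at \<open>z\<close>, which
  exhibits its constant term, the leading coefficient of \<open>p\<close>, as a multiple of
  \<open>z\<close>; but the nonzero elements of \<open>B\<close> are units.\<close>

lemma alg_over_nonneg:
  assumes B: "\<And>b. b \<in> B \<Longrightarrow> b \<noteq> 0 \<Longrightarrow> w b = 0" and y: "alg_over B y" "y \<noteq> 0"
  shows "w y \<ge> 0"
proof (rule ccontr)
  assume neg: "\<not> ?thesis"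
  obtain p where p: "p \<noteq> 0" "poly_over B p" "poly p y = 0" using y by (auto simp: alg_over_def)
  define z where "z = inverse y"
  have z: "z \<noteq> 0" "z \<in> val_max w" using y neg by (auto simp: z_def val_max_def w_inverse)
  have "poly (reflect_poly p) z = 0" using p(3) z(1) by (simp add: poly_reflect_poly_nz z_def)
  moreover obtain a q where aq: "reflect_poly p = pCons a q" by (rule pCons_cases)
  ultimately have az: "a = - (z * poly q z)" by (simp add: eq_neg_iff_add_eq_0)
  have R: "Polynomial.coeff p i \<in> val_ring w" for i
    using B[of "Polynomial.coeff p i"] p(2)
    by (cases "Polynomial.coeff p i = 0") (auto simp: poly_over_def val_ring_def)
  have "Polynomial.coeff q i \<in> val_ring w" for i
  proof -
    have "Polynomial.coeff q i = Polynomial.coeff (reflect_poly p) (Suc i)" by (simp add: aq)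
    then show ?thesis using R by (auto simp: coeff_reflect_poly)
  qed
  then have "poly q z \<in> val_ring w" using poly_val_ring val_max_subset[OF z(2)] by blast
  then have "a \<in> val_max w" unfolding az using val_max_mult(1)[OF z(2)] by simp
  moreover have "a = Polynomial.lead_coeff p"
    using arg_cong[OF aq, of "\<lambda>p. Polynomial.coeff p 0"] by simp
  ultimately show False using p B by (auto simp: val_max_def poly_over_def)
qed

text \<open>The bound holds for \<open>y\<close> and for its inverse, a root of the reversed
  polynomial.\<close>

lemma alg_over_trivial:
  assumes B: "\<And>b. b \<in> B \<Longrightarrow> b \<noteq> 0 \<Longrightarrow> w b = 0" "0 \<in> B" and y: "alg_over B y" "y \<noteq> 0"
  shows "w y = 0"
proof -
  obtain p where p: "p \<noteq> 0" "poly_over B p" "poly p y = 0" using y by (auto simp: alg_over_def)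
  have "alg_over B (inverse y)" unfolding alg_over_def
    by (rule exI[of _ "reflect_poly p"])
      (use p y(2) B(2) in \<open>auto simp: poly_over_def coeff_reflect_poly poly_reflect_poly_nz\<close>)
  then show ?thesis
    using alg_over_nonneg[OF B(1) y] alg_over_nonneg[of B "inverse y", OF B(1)] y(2) by (simp add: w_inverse)
qed

end

text \<open>A relation for \<open>y\<close> over \<open>F\<close>, scaled to be integral with one
  coefficient 1, reduces to a nonzero polynomial \<open>q\<close> over \<open>k\<close> such that
  \<open>q(y)\<close> lies in the maximal ideal. The big field being algebraically closed,
  \<open>q\<close> is a product of linear factors, and since the maximal ideal is prime it contains
  one of the \<open>y - x\<close>.\<close>

lemma residue_alg_over:
  fixes w :: "'l::alg_closed_field \<Rightarrow> real"
  assumes w: "field_valuation w"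
    and k: "subfield k type_ring" "k \<subseteq> F" "\<And>c. c \<in> k \<Longrightarrow> c \<noteq> 0 \<Longrightarrow> w c = 0"
    and F: "subfield F type_ring"
    and res: "\<And>a. a \<in> F \<Longrightarrow> a \<in> val_ring w \<Longrightarrow> \<exists>c\<in>k. a - c \<in> val_max w"
    and y: "alg_over F y" "y \<in> val_ring w"
  shows "\<exists>c. alg_over k c \<and> y - c \<in> val_max w"
proof -
  interpret field_valuation w by (rule w)
  obtain p where p: "p \<noteq> 0" "poly_over F p" "poly p y = 0" using y by (auto simp: alg_over_def)
  define I where "I = {i. i \<le> Polynomial.degree p \<and> Polynomial.coeff p i \<noteq> 0}"
  have "finite I" "I \<noteq> {}" using p(1) by (auto simp: I_def intro: exI[of _ "Polynomial.degree p"])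
  \<comment> \<open>Dividing by a coefficient of least value makes all coefficients integral and
    turns this one into 1, so the reduction cannot vanish.\<close>
  then obtain j where j: "j \<in> I" "\<And>i. i \<in> I \<Longrightarrow> w (Polynomial.coeff p j) \<le> w (Polynomial.coeff p i)"
    using arg_min_if_finite(1)[of I "\<lambda>i. w (Polynomial.coeff p i)"]
      arg_min_least[of I _ "\<lambda>i. w (Polynomial.coeff p i)"] by blast
  define p1 where "p1 = Polynomial.smult (inverse (Polynomial.coeff p j)) p"
  have pj: "Polynomial.coeff p j \<noteq> 0" using j by (simp add: I_def)
  have p1F: "Polynomial.coeff p1 i \<in> F" for i
    using p(2) by (auto simp: p1_def poly_over_def intro!: subfield_closed[OF F])
  have p1R: "Polynomial.coeff p1 i \<in> val_ring w" for i
  proof (cases "i \<in> I")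
    case True
    then show ?thesis using j(2)[OF True] pj by (auto simp: p1_def val_ring_def I_def w_mult w_inverse)
  next
    case False
    then have "Polynomial.coeff p i = 0" by (auto simp: I_def intro: coeff_eq_0 leI)
    then show ?thesis by (simp add: p1_def)
  qed
  \<comment> \<open>A choice of residues in \<open>k\<close>, with \<open>h 0 = 0\<close> as
    \<open>map_poly\<close> requires.\<close>
  define h where "h a = (if a = 0 then 0 else SOME c. c \<in> k \<and> a - c \<in> val_max w)" for a
  have h: "h a \<in> k \<and> a - h a \<in> val_max w" if "a \<in> F" "a \<in> val_ring w" for a
    using someI_ex[of "\<lambda>c. c \<in> k \<and> a - c \<in> val_max w"] res[OF that] subfield_closed(2)[OF k(1)]
    by (auto simp: h_def)
  define q where "q = map_poly h p1"
  have q: "Polynomial.coeff q i \<in> k" "Polynomial.coeff p1 i - Polynomial.coeff q i \<in> val_max w" for i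
    using h[OF p1F p1R, of i] by (auto simp: q_def coeff_map_poly h_def)
  have "poly (p1 - q) y \<in> val_max w"
    by (rule poly_val_max) (use q y in auto)
  then have qy: "poly q y \<in> val_max w" using p(3) by (simp add: p1_def)
  have kR: "c \<in> val_ring w" if "c \<in> k" for c using k(3)[OF that] by (cases "c = 0") (auto simp: val_ring_def)
  have "Polynomial.coeff p1 j = 1" using pj by (simp add: p1_def)
  then have q0: "q \<noteq> 0" using q(2)[of j] by auto
  obtain A where A: "q = Polynomial.smult (Polynomial.lead_coeff q) (\<Prod>x\<in>#A. [:-x, 1:])"
    using alg_closed_imp_factorization[OF q0] by blast
  have rt: "alg_over k x" if "x \<in># A" for x
  proof -
    have "poly (\<Prod>x\<in>#A. [:-x, 1:]) x = 0" using that by (auto simp: poly_prod_mset image_image)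
    then have "poly q x = 0" by (subst A) simp
    then show ?thesis using q0 q(1) by (auto simp: alg_over_def poly_over_def)
  qed
  \<comment> \<open>The roots of \<open>q\<close> are algebraic over \<open>k\<close>, where
    \<open>w\<close> is trivial; hence they are integral.\<close>
  have rtR: "y - x \<in> val_ring w" if "x \<in># A" for x
    using alg_over_trivial[OF k(3) subfield_closed(2)[OF k(1)] rt[OF that]]
    by (intro val_ring_diff[OF y(2)]; cases "x = 0") (auto simp: val_ring_def)
  have prodR: "(\<Prod>x\<in>#B. y - x) \<in> val_ring w" if "set_mset B \<subseteq> set_mset A" for B
    using that by (induction B) (auto intro!: val_ring_mult rtR)
  have "(\<exists>x\<in>#B. y - x \<in> val_max w)" if "set_mset B \<subseteq> set_mset A" "(\<Prod>x\<in>#B. y - x) \<in> val_max w" for B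
    using that
  proof (induction B)
    case (add x B)
    then have "set_mset B \<subseteq> set_mset A" "x \<in># A" by auto
    then show ?case using add val_max_prime[of "y - x" "\<Prod>x\<in>#B. y - x"] prodR rtR by auto
  qed simp
  moreover have "poly q y = Polynomial.lead_coeff q * (\<Prod>x\<in>#A. y - x)"
    by (subst A) (simp add: poly_prod_mset image_mset.compositionality o_def)
  moreover have "Polynomial.lead_coeff q \<in> val_ring w" "Polynomial.lead_coeff q \<notin> val_max w"
    using kR[OF q(1)] k(3)[OF q(1)[of "Polynomial.degree q"]] q0 by (auto simp: val_max_def)
  ultimately obtain x where "x \<in># A" "y - x \<in> val_max w"
    using qy val_max_prime[of "Polynomial.lead_coeff q" "\<Prod>x\<in>#A. y - x"] prodR[of A] by auto
  then show ?thesis using rt by blast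
qed

section \<open>Evaluation of polynomials and the function field\<close>

definition mono_eval :: "(nat \<Rightarrow> 'l::comm_ring_1) \<Rightarrow> monom \<Rightarrow> 'l" where
  "mono_eval a m = (\<Prod>i\<in>Poly_Mapping.keys m. a i ^ Poly_Mapping.lookup m i)"

lemma mono_eval_superset:
  "finite S \<Longrightarrow> Poly_Mapping.keys m \<subseteq> S \<Longrightarrow> mono_eval a m = (\<Prod>i\<in>S. a i ^ Poly_Mapping.lookup m i)"
  unfolding mono_eval_def by (rule prod.mono_neutral_left) (auto simp: in_keys_iff)

lemma mono_eval_add: "mono_eval a (m + m') = mono_eval a m * mono_eval a m'"
proof -
  let ?S = "Poly_Mapping.keys m \<union> Poly_Mapping.keys m'"
  have "Poly_Mapping.keys (m + m') \<subseteq> ?S" by (rule Poly_Mapping.keys_add)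
  then show ?thesis
    by (simp add: mono_eval_superset[of ?S] lookup_add power_add prod.distrib)
qed

lemma mono_eval_0 [simp]: "mono_eval a 0 = 1"
  by (simp add: mono_eval_def)

lemma mono_eval_single [simp]: "mono_eval a (Poly_Mapping.single i e) = a i ^ e"
  by (cases "e = 0") (simp_all add: mono_eval_def)

lemma mdeg_superset:
  "finite S \<Longrightarrow> Poly_Mapping.keys m \<subseteq> S \<Longrightarrow> mdeg m = (\<Sum>i\<in>S. Poly_Mapping.lookup m i)"
  unfolding mdeg_def by (rule sum.mono_neutral_left) (auto simp: in_keys_iff)

lemma mdeg_add: "mdeg (m + m') = mdeg m + mdeg m'"
proof -
  let ?S = "Poly_Mapping.keys m \<union> Poly_Mapping.keys m'"
  have "Poly_Mapping.keys (m + m') \<subseteq> ?S" by (rule Poly_Mapping.keys_add)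
  then show ?thesis
    by (simp add: mdeg_superset[of ?S] lookup_add sum.distrib)
qed

lemma mdeg_0 [simp]: "mdeg 0 = 0"
  by (simp add: mdeg_def)

lemma mdeg_single [simp]: "mdeg (Poly_Mapping.single i e) = e"
  by (cases "e = 0") (simp_all add: mdeg_def)

lemma poly_mapping_sum_single:
  fixes f :: "'a \<Rightarrow>\<^sub>0 'b::comm_monoid_add"
  shows "finite S \<Longrightarrow> Poly_Mapping.keys f \<subseteq> S \<Longrightarrow>
    (\<Sum>m\<in>S. Poly_Mapping.single m (Poly_Mapping.lookup f m)) = f"
  by (rule poly_mapping_eqI) (auto simp: lookup_sum lookup_single when_def in_keys_iff)

lemma mpoly_eval_mono: "mpoly_eval \<phi> f a = (\<Sum>m\<in>Poly_Mapping.keys f. \<phi> (Poly_Mapping.lookup f m) * mono_eval a m)"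
  by (simp add: mpoly_eval_def mono_eval_def)

locale coeff_hom =
  fixes \<phi> :: "'k::comm_ring_1 \<Rightarrow> 'l::comm_ring_1"
  assumes hom_add: "\<phi> (a + b) = \<phi> a + \<phi> b" and hom_mult: "\<phi> (a * b) = \<phi> a * \<phi> b"
    and hom_1 [simp]: "\<phi> 1 = 1"
begin

lemma hom_0 [simp]: "\<phi> 0 = 0"
  using hom_add[of 0 0] by simp

lemma hom_minus: "\<phi> (- a) = - \<phi> a"
  using hom_add[of a "- a"] by (simp add: eq_neg_iff_add_eq_0 add.commute)

lemma hom_sum: "\<phi> (sum f A) = (\<Sum>x\<in>A. \<phi> (f x))"
  by (induction A rule: infinite_finite_induct) (auto simp: hom_add)

lemma hom_prod: "\<phi> (prod f A) = (\<Prod>x\<in>A. \<phi> (f x))"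
  by (induction A rule: infinite_finite_induct) (auto simp: hom_mult)

lemma hom_power: "\<phi> (a ^ n) = \<phi> a ^ n"
  by (induction n) (auto simp: hom_mult)

lemma hom_of_nat: "\<phi> (of_nat n) = of_nat n"
  by (induction n) (auto simp: hom_add)

lemma eval_superset:
  "finite S \<Longrightarrow> Poly_Mapping.keys f \<subseteq> S \<Longrightarrow>
    mpoly_eval \<phi> f a = (\<Sum>m\<in>S. \<phi> (Poly_Mapping.lookup f m) * mono_eval a m)"
  unfolding mpoly_eval_mono by (rule sum.mono_neutral_left) (auto simp: in_keys_iff)

lemma eval_add: "mpoly_eval \<phi> (f + g) a = mpoly_eval \<phi> f a + mpoly_eval \<phi> g a"
proof -
  let ?S = "Poly_Mapping.keys f \<union> Poly_Mapping.keys g"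
  have "Poly_Mapping.keys (f + g) \<subseteq> ?S" by (rule Poly_Mapping.keys_add)
  then show ?thesis
    by (simp add: eval_superset[of ?S] lookup_add hom_add distrib_right sum.distrib)
qed

lemma eval_0 [simp]: "mpoly_eval \<phi> 0 a = 0"
  by (simp add: mpoly_eval_def)

lemma eval_single: "mpoly_eval \<phi> (Poly_Mapping.single m c) a = \<phi> c * mono_eval a m"
  by (cases "c = 0") (simp_all add: mpoly_eval_mono)

lemma eval_minus: "mpoly_eval \<phi> (- f) a = - mpoly_eval \<phi> f a"
  using eval_add[of f "- f" a] by (simp add: eq_neg_iff_add_eq_0 add.commute)

lemma eval_diff: "mpoly_eval \<phi> (f - g) a = mpoly_eval \<phi> f a - mpoly_eval \<phi> g a"
  using eval_add[of f "- g" a] by (simp add: eval_minus)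

lemma eval_sum: "mpoly_eval \<phi> (sum f A) a = (\<Sum>x\<in>A. mpoly_eval \<phi> (f x) a)"
  by (induction A rule: infinite_finite_induct) (auto simp: eval_add)

lemma eval_mult: "mpoly_eval \<phi> (f * g) a = mpoly_eval \<phi> f a * mpoly_eval \<phi> g a"
proof -
  have "f * g = (\<Sum>m\<in>Poly_Mapping.keys f. \<Sum>m'\<in>Poly_Mapping.keys g.
     Poly_Mapping.single (m + m') (Poly_Mapping.lookup f m * Poly_Mapping.lookup g m'))"
    by (subst (1) poly_mapping_sum_single[of "Poly_Mapping.keys f" f, symmetric], simp, simp,
        subst (1) poly_mapping_sum_single[of "Poly_Mapping.keys g" g, symmetric], simp, simp)
      (simp add: sum_product mult_single)
  then show ?thesis
    by (simp add: eval_sum eval_single mono_eval_add mpoly_eval_mono[of _ f] mpoly_eval_mono[of _ g]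
        sum_product hom_mult mult_ac)
qed

lemma eval_Const [simp]: "mpoly_eval \<phi> (Const c) a = \<phi> c"
  by (simp add: Const_def eval_single)

lemma eval_1 [simp]: "mpoly_eval \<phi> 1 a = 1"
  using eval_Const[of 1 a] by (simp add: Const_def)

lemma eval_Var [simp]: "mpoly_eval \<phi> (Var i) a = a i"
  by (simp add: Var_def eval_single)

lemma eval_power: "mpoly_eval \<phi> (f ^ n) a = mpoly_eval \<phi> f a ^ n"
  by (induction n) (auto simp: eval_mult)

lemma mono_eval_scale: "mono_eval (\<lambda>i. c * a i) m = c ^ mdeg m * mono_eval a m"
  by (simp add: mono_eval_def mdeg_def power_mult_distrib prod.distrib power_sum)

lemma eval_homogeneous_scale:
  assumes "homogeneous n d f"
  shows "mpoly_eval \<phi> f (\<lambda>i. c * a i) = c ^ d * mpoly_eval \<phi> f a"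
  using assms unfolding mpoly_eval_mono homogeneous_def
  by (auto simp: sum_distrib_left mono_eval_scale mult_ac intro!: sum.cong)

end

lemma coeff_hom_id: "coeff_hom (id :: 'k::comm_ring_1 \<Rightarrow> 'k)"
  by unfold_locales auto

lemma coeff_hom_to_ac: "coeff_hom (to_ac :: 'k::field \<Rightarrow> 'k alg_closure)"
  by unfold_locales auto

lemma eval_hom_base:
  assumes "coeff_hom \<phi>"
  shows "mpoly_eval \<phi> f (\<lambda>i. \<phi> (a i)) = \<phi> (mpoly_eval id f a)"
proof -
  interpret coeff_hom \<phi> by (rule assms)
  show ?thesis by (simp add: mpoly_eval_def hom_sum hom_mult hom_prod hom_power)
qed

lemma Const_add: "Const (a + b) = Const a + Const b"
  by (simp add: Const_def single_add)

lemma Const_mult: "Const (a * b) = Const a * Const b"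
  by (simp add: Const_def mult_single)

lemma Const_0 [simp]: "Const 0 = 0"
  by (simp add: Const_def)

lemma Const_1 [simp]: "Const 1 = 1"
  by (simp add: Const_def)

lemma mpoly_carrier_add: "f \<in> mpoly_carrier n \<Longrightarrow> g \<in> mpoly_carrier n \<Longrightarrow> f + g \<in> mpoly_carrier n"
  using Poly_Mapping.keys_add[of f g] by (auto simp: mpoly_carrier_def)

lemma mpoly_carrier_minus: "f \<in> mpoly_carrier n \<Longrightarrow> - f \<in> mpoly_carrier n"
  by (auto simp: mpoly_carrier_def in_keys_iff)

lemma mpoly_carrier_diff: "f \<in> mpoly_carrier n \<Longrightarrow> g \<in> mpoly_carrier n \<Longrightarrow> f - g \<in> mpoly_carrier n"
  using mpoly_carrier_add[OF _ mpoly_carrier_minus, of f n g] by simp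

lemma mpoly_carrier_mult: "f \<in> mpoly_carrier n \<Longrightarrow> g \<in> mpoly_carrier n \<Longrightarrow> f * g \<in> mpoly_carrier n"
proof -
  assume fg: "f \<in> mpoly_carrier n" "g \<in> mpoly_carrier n"
  have "Poly_Mapping.keys m \<subseteq> {..n}" if m: "m \<in> Poly_Mapping.keys (f * g)" for m
  proof -
    obtain a b where "m = a + b" "a \<in> Poly_Mapping.keys f" "b \<in> Poly_Mapping.keys g"
      using keys_mult[of f g] m by blast
    then show ?thesis using fg Poly_Mapping.keys_add[of a b] by (fastforce simp: mpoly_carrier_def)
  qed
  then show ?thesis by (auto simp: mpoly_carrier_def)
qed

lemma mpoly_carrier_0: "0 \<in> mpoly_carrier n"
  by (simp add: mpoly_carrier_def)

lemma mpoly_carrier_Const: "Const c \<in> mpoly_carrier n"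
  by (simp add: mpoly_carrier_def Const_def)

lemma mpoly_carrier_1: "1 \<in> mpoly_carrier n"
  using mpoly_carrier_Const[of 1 n] by simp

lemma mpoly_carrier_Var: "i \<le> n \<Longrightarrow> Var i \<in> mpoly_carrier n"
  by (simp add: mpoly_carrier_def Var_def)

lemma homogeneous_add: "homogeneous n d f \<Longrightarrow> homogeneous n d g \<Longrightarrow> homogeneous n d (f + g)"
  using Poly_Mapping.keys_add[of f g] by (auto simp: homogeneous_def mpoly_carrier_add)

lemma homogeneous_minus: "homogeneous n d f \<Longrightarrow> homogeneous n d (- f)"
  by (auto simp: homogeneous_def mpoly_carrier_minus in_keys_iff)

lemma homogeneous_diff: "homogeneous n d f \<Longrightarrow> homogeneous n d g \<Longrightarrow> homogeneous n d (f - g)"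
  using homogeneous_add[OF _ homogeneous_minus, of n d f g] by simp

lemma homogeneous_mult:
  assumes "homogeneous n d f" "homogeneous n e g"
  shows "homogeneous n (d + e) (f * g)"
  unfolding homogeneous_def
proof (intro conjI ballI)
  show "f * g \<in> mpoly_carrier n" using assms by (auto simp: homogeneous_def mpoly_carrier_mult)
  fix m assume "m \<in> Poly_Mapping.keys (f * g)"
  then obtain a b where "m = a + b" "a \<in> Poly_Mapping.keys f" "b \<in> Poly_Mapping.keys g"
    using keys_mult[of f g] by blast
  then show "mdeg m = d + e" using assms by (simp add: homogeneous_def mdeg_add)
qed

lemma homogeneous_Const: "homogeneous n 0 (Const c)"
  by (simp add: homogeneous_def mpoly_carrier_Const) (simp add: Const_def)

lemma homogeneous_1: "homogeneous n 0 1"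
  using homogeneous_Const[of n 1] by simp

lemma homogeneous_0: "homogeneous n d 0"
  by (simp add: homogeneous_def mpoly_carrier_0)

lemma homogeneous_Var: "i \<le> n \<Longrightarrow> homogeneous n 1 (Var i)"
  by (simp add: homogeneous_def mpoly_carrier_Var) (simp add: Var_def)

lemma homogeneous_sum: "(\<And>x. x \<in> A \<Longrightarrow> homogeneous n d (f x)) \<Longrightarrow> homogeneous n d (sum f A)"
  by (induction A rule: infinite_finite_induct) (auto simp: homogeneous_0 homogeneous_add)

lemma homogeneous_power: "homogeneous n d f \<Longrightarrow> homogeneous n (d * e) (f ^ e)"
  using homogeneous_mult[of n d f] by (induction e) (auto simp: homogeneous_1)

lemma homogeneous_single:
  "Poly_Mapping.keys m \<subseteq> {..n} \<Longrightarrow> homogeneous n (mdeg m) (Poly_Mapping.single m c)"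
  by (auto simp: homogeneous_def mpoly_carrier_def)

lemma homogeneous_hom_component: "f \<in> mpoly_carrier n \<Longrightarrow> homogeneous n d (hom_component d f)"
  unfolding hom_component_def
  by (rule homogeneous_sum) (auto simp: homogeneous_def mpoly_carrier_def)

lemma sum_hom_component:
  assumes "\<And>m. m \<in> Poly_Mapping.keys f \<Longrightarrow> mdeg m \<le> N"
  shows "(\<Sum>d\<le>N. hom_component d f) = f"
proof -
  have "(\<Sum>d\<le>N. hom_component d f) = (\<Sum>m\<in>Poly_Mapping.keys f. Poly_Mapping.single m (Poly_Mapping.lookup f m))"
    unfolding hom_component_def by (rule sum.group) (use assms in auto)
  then show ?thesis by (simp add: poly_mapping_sum_single)
qed

lemma mdeg_bound: "\<exists>N. \<forall>m\<in>Poly_Mapping.keys f. mdeg m \<le> N"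
  by (rule exI[of _ "\<Sum>m\<in>Poly_Mapping.keys f. mdeg m"]) (auto intro: member_le_sum)

text \<open>Sum and product in \<open>function_field\<close> are unions over all pairs of
  representatives. Once the classes in the union agree, the union is any one of them.\<close>

lemma UN_pairs_const:
  assumes "(f, g) \<in> A" "(f', g') \<in> B"
    and "\<And>a b a' b'. (a, b) \<in> A \<Longrightarrow> (a', b') \<in> B \<Longrightarrow> h a b a' b' = S"
  shows "(\<Union>(a, b)\<in>A. \<Union>(a', b')\<in>B. h a b a' b') = S"
proof -
  have "(\<Union>(a, b)\<in>A. \<Union>(a', b')\<in>B. h a b a' b') = (\<Union>p\<in>A. \<Union>q\<in>B. S)"
    using assms(3) by (intro SUP_cong) auto
  then show ?thesis using assms(1,2) by auto
qed

section \<open>The function field of a variety is a field\<close>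

locale proj_variety =
  fixes C :: "'k::field projective"
  assumes variety: "projective_variety C"
begin

abbreviation "n \<equiv> ambient_dim C"
abbreviation "I \<equiv> ideal_of C"
abbreviation "HF \<equiv> hom_fractions C"
abbreviation "K \<equiv> function_field C"

lemma prime: "primeideal I (mpoly_ring n)"
  using variety by (simp add: projective_variety_def)

lemma ideal: "ideal I (mpoly_ring n)"
  using prime by (simp add: primeideal_def)

lemma I_subset: "f \<in> I \<Longrightarrow> f \<in> mpoly_carrier n"
  using ideal.Icarr[OF ideal] by (auto simp: mpoly_ring_def)

lemma I_mult: "f \<in> mpoly_carrier n \<Longrightarrow> g \<in> I \<Longrightarrow> f * g \<in> I"
  using ideal.I_l_closed[OF ideal, of g f] by (simp add: mpoly_ring_def)

lemma I_add: "f \<in> I \<Longrightarrow> g \<in> I \<Longrightarrow> f + g \<in> I"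
  using additive_subgroup.a_closed[OF ideal.axioms(1)[OF ideal], of f g] by (simp add: mpoly_ring_def)

lemma I_minus: "f \<in> I \<Longrightarrow> - f \<in> I"
  using I_mult[OF mpoly_carrier_minus[OF mpoly_carrier_1], of f] by simp

lemma I_diff: "f \<in> I \<Longrightarrow> g \<in> I \<Longrightarrow> f - g \<in> I"
  using I_add[OF _ I_minus, of f g] by simp

lemma I_0 [simp]: "0 \<in> I"
  using additive_subgroup.zero_closed[OF ideal.axioms(1)[OF ideal]] by (simp add: mpoly_ring_def)

lemma I_prime: "f \<in> mpoly_carrier n \<Longrightarrow> g \<in> mpoly_carrier n \<Longrightarrow> f * g \<in> I \<Longrightarrow> f \<in> I \<or> g \<in> I"
  using primeideal.I_prime[OF prime, of f g] by (simp add: mpoly_ring_def)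

lemma I_1: "1 \<notin> I"
proof
  assume "1 \<in> I"
  then have "f \<in> I" if "f \<in> mpoly_carrier n" for f using I_mult[OF that] by fastforce
  then have "I = carrier (mpoly_ring n)" using I_subset by (auto simp: mpoly_ring_def)
  then show False using primeideal.I_notcarr[OF prime] by auto
qed

lemma I_Const: "c \<noteq> 0 \<Longrightarrow> Const c \<notin> I"
proof
  assume "c \<noteq> 0" "Const c \<in> I"
  then have "Const (inverse c) * Const c \<in> I" by (intro I_mult mpoly_carrier_Const)
  then show False using \<open>c \<noteq> 0\<close> I_1 by (simp flip: Const_mult)
qed

lemma I_power: "f \<in> mpoly_carrier n \<Longrightarrow> f \<notin> I \<Longrightarrow> f ^ e \<notin> I"
proof (induction e)
  case (Suc e)
  have "f ^ e \<in> mpoly_carrier n" using Suc.prems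
    by (induction e) (auto intro: mpoly_carrier_1 mpoly_carrier_mult)
  then show ?case using Suc I_prime[of f "f ^ e"] by auto
qed (use I_1 in auto)

lemma HF_iff: "(f, g) \<in> HF \<longleftrightarrow> (\<exists>d. homogeneous n d f \<and> homogeneous n d g \<and> g \<notin> I)"
  by (simp add: hom_fractions_def)

lemma HF_I: "homogeneous n d f \<Longrightarrow> homogeneous n d g \<Longrightarrow> g \<notin> I \<Longrightarrow> (f, g) \<in> HF"
  by (auto simp: HF_iff)

lemma HF_D: "(f, g) \<in> HF \<Longrightarrow> f \<in> mpoly_carrier n \<and> g \<in> mpoly_carrier n \<and> g \<notin> I"
  by (auto simp: HF_iff homogeneous_def)

lemma HF_mult: "(f, g) \<in> HF \<Longrightarrow> (f', g') \<in> HF \<Longrightarrow> (f * f', g * g') \<in> HF"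
proof -
  assume "(f, g) \<in> HF" "(f', g') \<in> HF"
  then obtain d e where *: "homogeneous n d f" "homogeneous n d g" "g \<notin> I"
    "homogeneous n e f'" "homogeneous n e g'" "g' \<notin> I" by (auto simp: HF_iff)
  have "g * g' \<notin> I" using * I_prime by (auto simp: homogeneous_def)
  then show ?thesis using homogeneous_mult[OF *(1,4)] homogeneous_mult[OF *(2,5)] by (intro HF_I)
qed

lemma HF_add: "(f, g) \<in> HF \<Longrightarrow> (f', g') \<in> HF \<Longrightarrow> (f * g' + f' * g, g * g') \<in> HF"
proof -
  assume "(f, g) \<in> HF" "(f', g') \<in> HF"
  then obtain d e where *: "homogeneous n d f" "homogeneous n d g" "g \<notin> I"
    "homogeneous n e f'" "homogeneous n e g'" "g' \<notin> I" by (auto simp: HF_iff)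
  have "homogeneous n (d + e) (f' * g)" using homogeneous_mult[OF *(4,2)] by (simp add: add.commute)
  then have "homogeneous n (d + e) (f * g' + f' * g)"
    by (rule homogeneous_add[OF homogeneous_mult[OF *(1,5)]])
  moreover have "g * g' \<notin> I" using * I_prime by (auto simp: homogeneous_def)
  ultimately show ?thesis using homogeneous_mult[OF *(2,5)] by (intro HF_I)
qed

text \<open>The point is transitivity of the relation between fractions: an identity holds after
  multiplication by the denominator \<open>g1\<close>, and primality of \<open>I\<close> cancels
  it.\<close>

lemma frac_class_eq_iff:
  assumes "(f, g) \<in> HF" "(f', g') \<in> HF"
  shows "frac_class C f g = frac_class C f' g' \<longleftrightarrow> f * g' - f' * g \<in> I"
proof
  assume "frac_class C f g = frac_class C f' g'"
  moreover have "(f', g') \<in> frac_class C f' g'" using assms by (simp add: frac_class_def mult.commute)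
  ultimately have "(f', g') \<in> frac_class C f g" by simp
  then show "f * g' - f' * g \<in> I" by (simp add: frac_class_def)
next
  assume *: "f * g' - f' * g \<in> I"
  have sym: "f' * g - f * g' \<in> I" using I_minus[OF *] by simp
  have main: "f2 * h - e * g2 \<in> I"
    if "f1 * h - e * g1 \<in> I" "f1 * g2 - f2 * g1 \<in> I" "(f1, g1) \<in> HF" "(f2, g2) \<in> HF" "(e, h) \<in> HF"
    for f1 g1 f2 g2 e h
  proof -
    have "g2 * (f1 * h - e * g1) - h * (f1 * g2 - f2 * g1) \<in> I"
      using HF_D[OF that(5)] HF_D[OF that(4)] by (intro I_diff[OF I_mult[OF _ that(1)] I_mult[OF _ that(2)]]) auto
    also have "g2 * (f1 * h - e * g1) - h * (f1 * g2 - f2 * g1) = g1 * (f2 * h - e * g2)"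
      by (simp add: algebra_simps)
    finally show ?thesis
      using I_prime[of g1 "f2 * h - e * g2"] HF_D[OF that(3)] HF_D[OF that(4)] HF_D[OF that(5)]
      by (auto intro: mpoly_carrier_mult mpoly_carrier_diff)
  qed
  show "frac_class C f g = frac_class C f' g'"
    unfolding frac_class_def using main[OF _ * assms] main[OF _ sym assms(2,1)] by blast
qed

lemma frac_class_eqI:
  "(f, g) \<in> HF \<Longrightarrow> (f', g') \<in> HF \<Longrightarrow> f * g' = f' * g \<Longrightarrow> frac_class C f g = frac_class C f' g'"
  by (simp add: frac_class_eq_iff)

lemma mem_frac_class_self: "(f, g) \<in> HF \<Longrightarrow> (f, g) \<in> frac_class C f g"
  by (simp add: frac_class_def mult.commute)

lemma mem_frac_class: "(f, g) \<in> HF \<Longrightarrow> (f', g') \<in> frac_class C f g \<longleftrightarrow> (f', g') \<in> HF \<and> frac_class C f g = frac_class C f' g'"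
proof -
  have "(f', g') \<in> frac_class C f g \<longleftrightarrow> (f', g') \<in> HF \<and> f * g' - f' * g \<in> I"
    by (simp add: frac_class_def)
  then show "(f, g) \<in> HF \<Longrightarrow> ?thesis" by (simp add: frac_class_eq_iff cong: conj_cong)
qed

lemma carrierE:
  assumes "A \<in> carrier K"
  obtains f g d where "A = frac_class C f g" "(f, g) \<in> HF" "homogeneous n d f" "homogeneous n d g" "g \<notin> I"
  using assms by (auto simp: function_field_def HF_iff)

lemma carrierI: "(f, g) \<in> HF \<Longrightarrow> frac_class C f g \<in> carrier K"
  by (auto simp: function_field_def)

lemma mem_carrier_class: "A \<in> carrier K \<Longrightarrow> (f, g) \<in> A \<Longrightarrow> (f, g) \<in> HF \<and> A = frac_class C f g"
  by (metis carrierE mem_frac_class)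

lemma K_one: "\<one>\<^bsub>K\<^esub> = frac_class C 1 1" and K_zero: "\<zero>\<^bsub>K\<^esub> = frac_class C 0 1"
  by (simp_all add: function_field_def)

lemma HF_1: "(1, 1) \<in> HF" and HF_0: "(0, 1) \<in> HF" and HF_Const: "(Const c, 1) \<in> HF"
  using HF_I[OF homogeneous_1 homogeneous_1 I_1] HF_I[OF homogeneous_0 homogeneous_1 I_1]
    HF_I[OF homogeneous_Const homogeneous_1 I_1] by auto

lemma HF_minus: "(f, g) \<in> HF \<Longrightarrow> (- f, g) \<in> HF"
  unfolding HF_iff using homogeneous_minus by blast

lemma K_mult:
  assumes "(f, g) \<in> HF" "(f', g') \<in> HF"
  shows "frac_class C f g \<otimes>\<^bsub>K\<^esub> frac_class C f' g' = frac_class C (f * f') (g * g')"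
proof -
  have *: "frac_class C (a * a') (b * b') = frac_class C (f * f') (g * g')"
    if "(a, b) \<in> frac_class C f g" "(a', b') \<in> frac_class C f' g'" for a b a' b'
  proof -
    have ab: "(a, b) \<in> HF" "f * b - a * g \<in> I" "(a', b') \<in> HF" "f' * b' - a' * g' \<in> I"
      using that by (auto simp: frac_class_def)
    have "f' * b' * (f * b - a * g) + a * g * (f' * b' - a' * g') \<in> I"
      using HF_D[OF assms(1)] HF_D[OF assms(2)] HF_D[OF ab(1)] HF_D[OF ab(3)]
      by (intro I_add[OF I_mult[OF _ ab(2)] I_mult[OF _ ab(4)]] mpoly_carrier_mult) auto
    also have "f' * b' * (f * b - a * g) + a * g * (f' * b' - a' * g') = f * f' * (b * b') - a * a' * (g * g')"
      by (simp add: algebra_simps)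
    finally show ?thesis
      using frac_class_eq_iff[OF HF_mult[OF assms] HF_mult[OF ab(1,3)]] by simp
  qed
  then show ?thesis
    using UN_pairs_const[OF mem_frac_class_self[OF assms(1)] mem_frac_class_self[OF assms(2)] *]
    by (simp add: function_field_def)
qed

lemma K_add:
  assumes "(f, g) \<in> HF" "(f', g') \<in> HF"
  shows "frac_class C f g \<oplus>\<^bsub>K\<^esub> frac_class C f' g' = frac_class C (f * g' + f' * g) (g * g')"
proof -
  have *: "frac_class C (a * b' + a' * b) (b * b') = frac_class C (f * g' + f' * g) (g * g')"
    if "(a, b) \<in> frac_class C f g" "(a', b') \<in> frac_class C f' g'" for a b a' b'
  proof -
    have ab: "(a, b) \<in> HF" "f * b - a * g \<in> I" "(a', b') \<in> HF" "f' * b' - a' * g' \<in> I"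
      using that by (auto simp: frac_class_def)
    have "b' * g' * (f * b - a * g) + b * g * (f' * b' - a' * g') \<in> I"
      using HF_D[OF assms(1)] HF_D[OF assms(2)] HF_D[OF ab(1)] HF_D[OF ab(3)]
      by (intro I_add[OF I_mult[OF _ ab(2)] I_mult[OF _ ab(4)]] mpoly_carrier_mult) auto
    also have "b' * g' * (f * b - a * g) + b * g * (f' * b' - a' * g') =
       (f * g' + f' * g) * (b * b') - (a * b' + a' * b) * (g * g')"
      by (simp add: algebra_simps)
    finally show ?thesis
      using frac_class_eq_iff[OF HF_add[OF assms] HF_add[OF ab(1,3)]] by simp
  qed
  then show ?thesis
    using UN_pairs_const[OF mem_frac_class_self[OF assms(1)] mem_frac_class_self[OF assms(2)] *]
    by (simp add: function_field_def)
qed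

lemma frac_class_eq_0: "(f, g) \<in> HF \<Longrightarrow> frac_class C f g = \<zero>\<^bsub>K\<^esub> \<longleftrightarrow> f \<in> I"
  by (simp add: K_zero frac_class_eq_iff HF_0)

lemma HF_inverse: "(f, g) \<in> HF \<Longrightarrow> f \<notin> I \<Longrightarrow> (g, f) \<in> HF"
  by (auto simp: HF_iff)

lemma K_cring: "cring K"
proof -
  note simps = K_add K_mult HF_add HF_mult HF_0 HF_1 carrierI K_one K_zero
  show ?thesis
  proof (rule cringI)
  show "abelian_group K"
  proof (rule abelian_groupI)
    fix x assume "x \<in> carrier K"
    then obtain f g where x: "x = frac_class C f g" "(f, g) \<in> HF" by (rule carrierE)
    have "frac_class C (- f) g \<oplus>\<^bsub>K\<^esub> x = \<zero>\<^bsub>K\<^esub>"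
      unfolding x using HF_add[OF HF_minus[OF x(2)] x(2)]
      by (simp add: K_add HF_minus[OF x(2)] x(2) frac_class_eq_0)
    then show "\<exists>y\<in>carrier K. y \<oplus>\<^bsub>K\<^esub> x = \<zero>\<^bsub>K\<^esub>"
      using carrierI[OF HF_minus[OF x(2)]] by blast
  qed ((elim carrierE)?, simp add: simps, (rule frac_class_eqI; ((simp add: simps; fail) | simp add: algebra_simps))?)+
  show "comm_monoid K"
    by (rule comm_monoidI; (elim carrierE)?, simp add: simps, (rule frac_class_eqI; ((simp add: simps; fail) | simp add: algebra_simps))?)
qed ((elim carrierE)?, simp add: simps, (rule frac_class_eqI; ((simp add: simps; fail) | simp add: algebra_simps))?)+
qed

lemma K_field: "field K"
proof (rule cring.cring_fieldI2[OF K_cring])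
  show "\<zero>\<^bsub>K\<^esub> \<noteq> \<one>\<^bsub>K\<^esub>" using frac_class_eq_0[OF HF_1] I_1 by (metis K_one)
  fix a assume "a \<in> carrier K" "a \<noteq> \<zero>\<^bsub>K\<^esub>"
  then obtain f g where a: "a = frac_class C f g" "(f, g) \<in> HF" "f \<notin> I"
    by (metis carrierE frac_class_eq_0)
  show "\<exists>b\<in>carrier K. a \<otimes>\<^bsub>K\<^esub> b = \<one>\<^bsub>K\<^esub>"
    using HF_inverse[OF a(2,3)] a
    by (intro bexI[of _ "frac_class C g f"])
      (simp_all add: K_mult HF_mult HF_1 carrierI K_one frac_class_eq_iff)
qed

end

section \<open>Embedded function fields and charts\<close>

lemma Var_power: "(Var j :: 'k::comm_ring_1 mpoly) ^ e = Poly_Mapping.single (Poly_Mapping.single j e) 1"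
  by (induction e) (auto simp: Var_def mult_single simp flip: single_add)

lemma prod_single_1:
  "(\<Prod>j\<in>S. Poly_Mapping.single (g j) (1 :: 'k::comm_ring_1)) = Poly_Mapping.single (\<Sum>j\<in>S. (g j :: monom)) 1"
  by (induction S rule: infinite_finite_induct) (auto simp: mult_single)

lemma single_eq_prod_Var:
  "Poly_Mapping.single m (c :: 'k::comm_ring_1) = Const c * (\<Prod>j\<in>Poly_Mapping.keys m. Var j ^ Poly_Mapping.lookup m j)"
  by (simp add: Var_power prod_single_1 poly_mapping_sum_single Const_def mult_single)

text \<open>This turns a quotient of arbitrary polynomials in affine coordinates into a quotient of
  forms of equal degree \<open>N\<close>. Components of degree above \<open>N\<close> are dropped,
  so \<open>N\<close> has to bound the degree.\<close>

definition homogenize :: "nat \<Rightarrow> nat \<Rightarrow> 'k::comm_ring_1 mpoly \<Rightarrow> 'k mpoly" where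
  "homogenize i N f = (\<Sum>d\<le>N. hom_component d f * Var i ^ (N - d))"

lemma homogeneous_homogenize:
  assumes "f \<in> mpoly_carrier n" "i \<le> n"
  shows "homogeneous n N (homogenize i N f)"
  unfolding homogenize_def
proof (rule homogeneous_sum)
  fix d assume "d \<in> {..N}"
  then show "homogeneous n N (hom_component d f * Var i ^ (N - d))"
    using homogeneous_mult[OF homogeneous_hom_component[OF assms(1)] homogeneous_power[OF homogeneous_Var[OF assms(2)]], of d "N - d"]
    by simp
qed

lemma (in coeff_hom) eval_homogenize:
  assumes "a i = 1" "\<And>m. m \<in> Poly_Mapping.keys f \<Longrightarrow> mdeg m \<le> N"
  shows "mpoly_eval \<phi> (homogenize i N f) a = mpoly_eval \<phi> f a"
proof -
  have "mpoly_eval \<phi> (homogenize i N f) a = mpoly_eval \<phi> (\<Sum>d\<le>N. hom_component d f) a"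
    by (simp add: homogenize_def eval_sum eval_mult eval_power assms(1))
  then show ?thesis using sum_hom_component[of f N] assms(2) by simp
qed

definition proj_class :: "(nat \<Rightarrow> 'f::field) \<Rightarrow> (nat \<Rightarrow> 'f) set" where
  "proj_class a = {(\<lambda>i. c * a i) |c. c \<noteq> 0}"

lemma proj_class_self: "a \<in> proj_class a"
  unfolding proj_class_def by (rule CollectI, rule exI[of _ 1]) auto

lemma proj_class_cong: "c \<noteq> 0 \<Longrightarrow> proj_class (\<lambda>i. c * a i) = proj_class a"
  unfolding proj_class_def
proof (intro equalityI subsetI; elim CollectE exE conjE)
  fix b d assume "c \<noteq> 0" "b = (\<lambda>i. d * (c * a i))" "d \<noteq> 0"
  then show "b \<in> {\<lambda>i. c * a i |c. c \<noteq> 0}"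
    by (intro CollectI exI[of _ "d * c"]) (auto simp: mult.assoc)
next
  fix b d assume "c \<noteq> 0" "b = (\<lambda>i. d * a i)" "d \<noteq> 0"
  then show "b \<in> {\<lambda>i. d * (c * a i) |d. d \<noteq> 0}"
    by (intro CollectI exI[of _ "d / c"]) auto
qed

context proj_variety
begin

lemma I_hom_component: "f \<in> I \<Longrightarrow> hom_component d f \<in> I"
  using variety by (simp add: projective_variety_def)

lemma chart_exists: "\<exists>i\<le>n. Var i \<notin> I"
  using variety by (simp add: projective_variety_def)

text \<open>Scaling multiplies the component of degree \<open>d\<close> by \<open>c ^ d\<close>, and
  each component of an element of \<open>I\<close> is again in \<open>I\<close>.\<close>

lemma eval_scale_I:
  assumes "coeff_hom \<phi>" "\<And>f. f \<in> I \<Longrightarrow> mpoly_eval \<phi> f a = 0" "f \<in> I"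
  shows "mpoly_eval \<phi> f (\<lambda>i. c * a i) = 0"
proof -
  interpret coeff_hom \<phi> by (rule assms)
  obtain N where N: "\<forall>m\<in>Poly_Mapping.keys f. mdeg m \<le> N" using mdeg_bound by blast
  have "mpoly_eval \<phi> f (\<lambda>i. c * a i) = (\<Sum>d\<le>N. mpoly_eval \<phi> (hom_component d f) (\<lambda>i. c * a i))"
    using sum_hom_component[of f N] N by (simp flip: eval_sum)
  also have "\<dots> = (\<Sum>d\<le>N. c ^ d * mpoly_eval \<phi> (hom_component d f) a)"
    by (rule sum.cong) (auto simp: eval_homogeneous_scale[OF homogeneous_hom_component[OF I_subset[OF assms(3)]]])
  also have "\<dots> = 0" using assms(2)[OF I_hom_component[OF assms(3)]] by simp
  finally show ?thesis .
qed

lemma proj_class_points: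
  assumes "coeff_hom \<phi>" "i \<le> n" "a i \<noteq> 0" "\<And>j. j > n \<Longrightarrow> a j = 0" "\<And>f. f \<in> I \<Longrightarrow> mpoly_eval \<phi> f a = 0"
  shows "proj_class a \<in> points \<phi> C"
  unfolding points_def
proof (intro CollectI conjI ballI)
  show "proj_class a \<in> proj_space n" unfolding proj_space_def proj_class_def using assms by blast
  fix b f assume "b \<in> proj_class a" "f \<in> I"
  then show "mpoly_eval \<phi> f b = 0" using eval_scale_I[OF assms(1,5)] by (auto simp: proj_class_def)
qed

lemma points_rep:
  assumes "x \<in> points \<phi> C"
  obtains a i where "i \<le> n" "a i = 1" "\<And>j. j > n \<Longrightarrow> a j = 0" "x = proj_class a"
    "\<And>f. f \<in> I \<Longrightarrow> mpoly_eval \<phi> f a = 0"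
proof -
  from assms obtain b where b: "\<exists>i\<le>n. b i \<noteq> 0" "\<forall>i>n. b i = 0" "x = proj_class b"
    by (auto simp: points_def proj_space_def proj_class_def)
  then obtain i where i: "i \<le> n" "b i \<noteq> 0" by blast
  define a where "a = (\<lambda>j. inverse (b i) * b j)"
  have x: "x = proj_class a" unfolding a_def b(3) using proj_class_cong[of "inverse (b i)" b] i by simp
  show ?thesis
    by (rule that[of i a]) (use i b x proj_class_self[of a] assms in \<open>auto simp: a_def points_def\<close>)
qed

text \<open>The denominator is a form, so whether it vanishes does not depend on the coordinate
  vector chosen for the point.\<close>

lemma local_ring_iff:
  assumes A: "A \<in> carrier K"
  shows "A \<in> local_ring C (proj_class a) \<longleftrightarrow>
    (\<exists>f g. (f, g) \<in> HF \<and> A = frac_class C f g \<and> mpoly_eval id g a \<noteq> 0)"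
proof -
  interpret coeff_hom id by (rule coeff_hom_id)
  have "(\<forall>b\<in>proj_class a. mpoly_eval id g b \<noteq> 0) \<longleftrightarrow> mpoly_eval id g a \<noteq> 0" if "(f, g) \<in> HF" for f g
  proof -
    from that obtain d where "homogeneous n d g" by (auto simp: HF_iff)
    then show ?thesis using proj_class_self[of a] by (auto simp: proj_class_def eval_homogeneous_scale)
  qed
  moreover have "(f, g) \<in> A \<longleftrightarrow> (f, g) \<in> HF \<and> A = frac_class C f g" for f g
    using mem_carrier_class[OF A] mem_frac_class_self by blast
  moreover have "A \<in> local_ring C (proj_class a) \<longleftrightarrow>
      (\<exists>f g. (f, g) \<in> A \<and> (\<forall>b\<in>proj_class a. mpoly_eval id g b \<noteq> 0))"
    using A by (auto simp: local_ring_def)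
  ultimately show ?thesis by blast
qed

end

section \<open>Embedded function fields and affine coordinates\<close>

locale emb_variety = proj_variety C for C :: "'k::field projective" +
  fixes \<iota> :: "('k mpoly \<times> 'k mpoly) set \<Rightarrow> 'l::field"
  assumes \<iota>: "\<iota> \<in> ring_hom (function_field C) type_ring"
begin

definition \<kappa> :: "'k \<Rightarrow> 'l" where "\<kappa> c = \<iota> (frac_class C (Const c) 1)"

abbreviation "E \<equiv> \<iota> ` carrier K"

lemma \<iota>_add: "A \<in> carrier K \<Longrightarrow> B \<in> carrier K \<Longrightarrow> \<iota> (A \<oplus>\<^bsub>K\<^esub> B) = \<iota> A + \<iota> B"
  and \<iota>_mult: "A \<in> carrier K \<Longrightarrow> B \<in> carrier K \<Longrightarrow> \<iota> (A \<otimes>\<^bsub>K\<^esub> B) = \<iota> A * \<iota> B"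
  and \<iota>_1: "\<iota> \<one>\<^bsub>K\<^esub> = 1"
  using ring_hom_add[OF \<iota>, of A B] ring_hom_mult[OF \<iota>, of A B] ring_hom_one[OF \<iota>] by simp_all

lemma K_ring: "ring K"
  using K_cring by (rule cring.axioms)

lemma \<iota>_0: "\<iota> \<zero>\<^bsub>K\<^esub> = 0"
proof -
  interpret ring K by (rule K_ring)
  have "\<iota> \<zero>\<^bsub>K\<^esub> = \<iota> \<zero>\<^bsub>K\<^esub> + \<iota> \<zero>\<^bsub>K\<^esub>"
    using \<iota>_add[of "\<zero>\<^bsub>K\<^esub>" "\<zero>\<^bsub>K\<^esub>"] l_zero zero_closed by metis
  then show ?thesis by (simp only: add_cancel_right_right)
qed

lemma \<iota>_frac_mult: "(f, g) \<in> HF \<Longrightarrow> (f', g') \<in> HF \<Longrightarrow>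
  \<iota> (frac_class C (f * f') (g * g')) = \<iota> (frac_class C f g) * \<iota> (frac_class C f' g')"
  by (simp add: \<iota>_mult carrierI flip: K_mult)

lemma \<iota>_frac_add: "(f, g) \<in> HF \<Longrightarrow> (f', g') \<in> HF \<Longrightarrow>
  \<iota> (frac_class C (f * g' + f' * g) (g * g')) = \<iota> (frac_class C f g) + \<iota> (frac_class C f' g')"
  by (simp add: \<iota>_add carrierI flip: K_add)

lemma \<iota>_frac_1: "\<iota> (frac_class C 1 1) = 1"
  using \<iota>_1 by (simp add: K_one)

lemma \<iota>_frac_self: "(f, f) \<in> HF \<Longrightarrow> \<iota> (frac_class C f f) = 1"
  using frac_class_eqI[of f f 1 1] HF_1 \<iota>_frac_1 by simp

lemma \<iota>_frac_inverse:
  assumes "(f, g) \<in> HF" "f \<notin> I"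
  shows "\<iota> (frac_class C f g) * \<iota> (frac_class C g f) = 1"
proof -
  have "(g, f) \<in> HF" using HF_inverse assms by blast
  then have "\<iota> (frac_class C f g) * \<iota> (frac_class C g f) = \<iota> (frac_class C (f * g) (g * f))"
    using \<iota>_frac_mult[OF assms(1)] by simp
  also have "\<dots> = 1"
    using \<iota>_frac_self HF_mult[OF assms(1) \<open>(g, f) \<in> HF\<close>] by (simp add: mult.commute)
  finally show ?thesis .
qed

lemma \<iota>_frac_eq_0: "(f, g) \<in> HF \<Longrightarrow> \<iota> (frac_class C f g) = 0 \<longleftrightarrow> f \<in> I"
  using \<iota>_frac_inverse[of f g] \<iota>_0 frac_class_eq_0[of f g] by force

lemma \<iota>_eq_0: "A \<in> carrier K \<Longrightarrow> \<iota> A = 0 \<longleftrightarrow> A = \<zero>\<^bsub>K\<^esub>"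
  by (metis carrierE \<iota>_frac_eq_0 frac_class_eq_0)

lemma \<kappa>_hom: "coeff_hom \<kappa>"
proof
  fix a b
  show "\<kappa> (a + b) = \<kappa> a + \<kappa> b"
    using \<iota>_frac_add[OF HF_Const[of a] HF_Const[of b]] by (simp add: \<kappa>_def Const_add)
  show "\<kappa> (a * b) = \<kappa> a * \<kappa> b"
    using \<iota>_frac_mult[OF HF_Const[of a] HF_Const[of b]] by (simp add: \<kappa>_def Const_mult)
qed (simp add: \<kappa>_def \<iota>_frac_1)

sublocale \<kappa>: coeff_hom \<kappa> by (rule \<kappa>_hom)

lemma \<kappa>_eq_0 [simp]: "\<kappa> c = 0 \<longleftrightarrow> c = 0"
  using \<iota>_frac_eq_0[OF HF_Const[of c]] I_Const[of c] by (cases "c = 0") (auto simp: \<kappa>_def)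

lemma \<kappa>_inverse: "\<kappa> (inverse c) = inverse (\<kappa> c)"
proof (cases "c = 0")
  case False
  then have "\<kappa> c * \<kappa> (inverse c) = 1" by (simp flip: \<kappa>.hom_mult)
  then show ?thesis by (simp add: inverse_unique)
qed simp

lemma range_\<kappa>: "\<iota> ` constants C = range \<kappa>"
  by (auto simp: constants_def \<kappa>_def)

lemma range_\<kappa>_subset: "range \<kappa> \<subseteq> E"
  by (auto simp: \<kappa>_def intro!: imageI carrierI HF_Const)

lemma subfield_\<kappa>: "subfield (range \<kappa>) type_ring"
  unfolding subfield_type_ring_iff
proof (intro conjI ballI)
  show "1 \<in> range \<kappa>" by (metis \<kappa>.hom_1 rangeI)
  fix x assume "x \<in> range \<kappa>" then obtain c where c: "x = \<kappa> c" by blast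
  show "- x \<in> range \<kappa>" "inverse x \<in> range \<kappa>" unfolding c by (metis \<kappa>.hom_minus rangeI, metis \<kappa>_inverse rangeI)
  fix y assume "y \<in> range \<kappa>" then obtain d where d: "y = \<kappa> d" by blast
  show "x + y \<in> range \<kappa>" "x * y \<in> range \<kappa>" unfolding c d by (metis \<kappa>.hom_add rangeI, metis \<kappa>.hom_mult rangeI)
qed

lemma \<iota>_a_inv: "A \<in> carrier K \<Longrightarrow> \<iota> (\<ominus>\<^bsub>K\<^esub> A) = - \<iota> A"
proof -
  interpret K: field K by (rule K_field)
  assume A: "A \<in> carrier K"
  then have "\<iota> A + \<iota> (\<ominus>\<^bsub>K\<^esub> A) = 0" using \<iota>_0 by (simp add: K.r_neg flip: \<iota>_add)
  then show ?thesis by (simp add: eq_neg_iff_add_eq_0 add.commute)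
qed

lemma \<iota>_m_inv:
  assumes "A \<in> carrier K" "A \<noteq> \<zero>\<^bsub>K\<^esub>"
  shows "inv\<^bsub>K\<^esub> A \<in> carrier K" "\<iota> (inv\<^bsub>K\<^esub> A) = inverse (\<iota> A)"
proof -
  interpret K: field K by (rule K_field)
  have B: "inv\<^bsub>K\<^esub> A \<in> carrier K" "A \<otimes>\<^bsub>K\<^esub> inv\<^bsub>K\<^esub> A = \<one>\<^bsub>K\<^esub>"
    using assms K.field_Units by (auto intro: K.Units_inv_closed K.Units_r_inv)
  then have "\<iota> A * \<iota> (inv\<^bsub>K\<^esub> A) = 1" using assms \<iota>_1 by (simp flip: \<iota>_mult)
  then show "inv\<^bsub>K\<^esub> A \<in> carrier K" "\<iota> (inv\<^bsub>K\<^esub> A) = inverse (\<iota> A)" using B by (simp_all add: inverse_unique)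
qed

lemma subfield_E: "subfield E type_ring"
  unfolding subfield_type_ring_iff
proof (intro conjI ballI)
  interpret K: field K by (rule K_field)
  show "1 \<in> E" using \<iota>_1 K.one_closed by force
  fix x assume "x \<in> E" then obtain A where A: "A \<in> carrier K" "x = \<iota> A" by blast
  show "- x \<in> E" using A \<iota>_a_inv K.a_inv_closed by (metis imageI)
  show "inverse x \<in> E"
    using A \<iota>_m_inv[of A] \<iota>_0 by (cases "A = \<zero>\<^bsub>K\<^esub>") (force, metis imageI)
  fix y assume "y \<in> E" then obtain B where B: "B \<in> carrier K" "y = \<iota> B" by blast
  have "\<iota> (A \<oplus>\<^bsub>K\<^esub> B) = x + y" "\<iota> (A \<otimes>\<^bsub>K\<^esub> B) = x * y" using A B \<iota>_add \<iota>_mult by auto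
  then show "x + y \<in> E" "x * y \<in> E" using A B K.add.m_closed K.m_closed by (metis imageI)+
qed

text \<open>The coordinates of the generic point in the chart where the variable \<open>i\<close> is
  inverted, padded with zeros like all coordinate vectors.\<close>

definition \<xi> :: "nat \<Rightarrow> nat \<Rightarrow> 'l" where
  "\<xi> i j = (if j \<le> n then \<iota> (frac_class C (Var j) (Var i)) else 0)"

context
  fixes i assumes i: "i \<le> n" "Var i \<notin> I"
begin

abbreviation "ev f \<equiv> mpoly_eval \<kappa> f (\<xi> i)"

lemma Var_power_I: "Var i ^ d \<notin> I" "homogeneous n d (Var i ^ d)"
  using I_power[OF mpoly_carrier_Var[OF i(1)] i(2)] homogeneous_power[OF homogeneous_Var[OF i(1)], of d]
  by auto

lemma HF_chart: "homogeneous n d f \<Longrightarrow> (f, Var i ^ d) \<in> HF"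
  using HF_I Var_power_I by blast

lemma \<xi>_self: "\<xi> i i = 1"
  using i \<iota>_frac_self[of "Var i"] HF_chart[OF homogeneous_Var[OF i(1)]] by (simp add: \<xi>_def)

lemma chart_mult: "homogeneous n d f \<Longrightarrow> homogeneous n e g \<Longrightarrow>
   \<iota> (frac_class C (f * g) (Var i ^ (d + e))) = \<iota> (frac_class C f (Var i ^ d)) * \<iota> (frac_class C g (Var i ^ e))"
  using \<iota>_frac_mult[OF HF_chart HF_chart, of d f e g] by (simp add: power_add)

lemma chart_add: "homogeneous n d f \<Longrightarrow> homogeneous n d g \<Longrightarrow>
   \<iota> (frac_class C (f + g) (Var i ^ d)) = \<iota> (frac_class C f (Var i ^ d)) + \<iota> (frac_class C g (Var i ^ d))"
proof -
  assume fg: "homogeneous n d f" "homogeneous n d g"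
  have "frac_class C (f + g) (Var i ^ d) =
        frac_class C (f * Var i ^ d + g * Var i ^ d) (Var i ^ d * Var i ^ d)"
    using HF_chart[OF fg(1)] HF_chart[OF fg(2)] HF_chart[OF homogeneous_add[OF fg]]
    by (intro frac_class_eqI HF_add) (auto simp: algebra_simps)
  then show ?thesis using \<iota>_frac_add[OF HF_chart[OF fg(1)] HF_chart[OF fg(2)]] by simp
qed

lemma chart_0: "\<iota> (frac_class C 0 (Var i ^ d)) = 0"
  using \<iota>_frac_eq_0[OF HF_chart[OF homogeneous_0]] by simp

lemma chart_sum: "finite A \<Longrightarrow> (\<And>x. x \<in> A \<Longrightarrow> homogeneous n d (f x)) \<Longrightarrow>
   \<iota> (frac_class C (sum f A) (Var i ^ d)) = (\<Sum>x\<in>A. \<iota> (frac_class C (f x) (Var i ^ d)))"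
  by (induction A rule: finite_induct) (auto simp: chart_add homogeneous_sum chart_0)

lemma chart_power: "homogeneous n d f \<Longrightarrow>
   \<iota> (frac_class C (f ^ e) (Var i ^ (d * e))) = \<iota> (frac_class C f (Var i ^ d)) ^ e"
proof (induction e)
  case (Suc e)
  then show ?case using chart_mult[OF Suc.prems homogeneous_power[OF Suc.prems, of e]] by simp
qed (simp add: \<iota>_frac_1)

lemma homogeneous_prod_Var: "finite S \<Longrightarrow> S \<subseteq> {..n} \<Longrightarrow> homogeneous n (\<Sum>j\<in>S. e j) (\<Prod>j\<in>S. Var j ^ e j)"
proof (induction S rule: finite_induct)
  case (insert j S)
  then have "homogeneous n (e j) (Var j ^ e j)" using homogeneous_power[OF homogeneous_Var, of j n "e j"] by simp
  then show ?case using homogeneous_mult[of n "e j" "Var j ^ e j"] insert by simp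
qed (simp add: homogeneous_1)

lemma chart_prod_Var: "finite S \<Longrightarrow> S \<subseteq> {..n} \<Longrightarrow>
   \<iota> (frac_class C (\<Prod>j\<in>S. Var j ^ e j) (Var i ^ (\<Sum>j\<in>S. e j))) = (\<Prod>j\<in>S. \<xi> i j ^ e j)"
proof (induction S rule: finite_induct)
  case (insert j S)
  then have j: "j \<le> n" "S \<subseteq> {..n}" by auto
  have "\<iota> (frac_class C (Var j ^ e j * (\<Prod>j\<in>S. Var j ^ e j)) (Var i ^ (e j + (\<Sum>j\<in>S. e j)))) =
     \<iota> (frac_class C (Var j ^ e j) (Var i ^ e j)) * \<iota> (frac_class C (\<Prod>j\<in>S. Var j ^ e j) (Var i ^ (\<Sum>j\<in>S. e j)))"
    using homogeneous_power[OF homogeneous_Var[OF j(1)], of "e j"]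
    by (intro chart_mult homogeneous_prod_Var insert j) simp
  also have "\<iota> (frac_class C (Var j ^ e j) (Var i ^ e j)) = \<xi> i j ^ e j"
    using chart_power[OF homogeneous_Var[OF j(1)], of "e j"] j by (simp add: \<xi>_def)
  finally show ?case using insert j by simp
qed (simp add: \<iota>_frac_1)

text \<open>Both sides are additive in \<open>f\<close>, and on a monomial of degree
  \<open>d\<close> the power of \<open>Var i\<close> in the denominator splits into one share for
  each variable.\<close>

lemma chart_eval:
  assumes f: "homogeneous n d f"
  shows "ev f = \<iota> (frac_class C f (Var i ^ d))"
proof -
  have m: "Poly_Mapping.keys m \<subseteq> {..n}" "mdeg m = d" if "m \<in> Poly_Mapping.keys f" for m
    using f that by (auto simp: homogeneous_def mpoly_carrier_def)
  have "\<iota> (frac_class C f (Var i ^ d)) =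
    \<iota> (frac_class C (\<Sum>m\<in>Poly_Mapping.keys f. Poly_Mapping.single m (Poly_Mapping.lookup f m)) (Var i ^ d))"
    by (simp add: poly_mapping_sum_single)
  also have "\<dots> = (\<Sum>m\<in>Poly_Mapping.keys f. \<iota> (frac_class C (Poly_Mapping.single m (Poly_Mapping.lookup f m)) (Var i ^ d)))"
    using homogeneous_single[OF m(1)] m(2) by (intro chart_sum) auto
  also have "\<dots> = ev f" unfolding mpoly_eval_mono
  proof (rule sum.cong)
    fix m assume mf: "m \<in> Poly_Mapping.keys f"
    have "\<iota> (frac_class C (Const c * (\<Prod>j\<in>Poly_Mapping.keys m. Var j ^ Poly_Mapping.lookup m j))
        (Var i ^ (0 + (\<Sum>j\<in>Poly_Mapping.keys m. Poly_Mapping.lookup m j)))) =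
      \<iota> (frac_class C (Const c) (Var i ^ 0)) * \<iota> (frac_class C (\<Prod>j\<in>Poly_Mapping.keys m. Var j ^ Poly_Mapping.lookup m j)
        (Var i ^ (\<Sum>j\<in>Poly_Mapping.keys m. Poly_Mapping.lookup m j)))" for c
      by (intro chart_mult homogeneous_prod_Var homogeneous_Const m mf) simp
    then show "\<iota> (frac_class C (Poly_Mapping.single m (Poly_Mapping.lookup f m)) (Var i ^ d)) =
       \<kappa> (Poly_Mapping.lookup f m) * mono_eval (\<xi> i) m"
      using m[OF mf] chart_prod_Var[OF _ m(1)[OF mf]]
      by (simp add: single_eq_prod_Var[of m] mdeg_def \<kappa>_def mono_eval_def)
  qed simp
  finally show ?thesis by simp
qed

lemma ev_eq_0_iff: "homogeneous n d f \<Longrightarrow> ev f = 0 \<longleftrightarrow> f \<in> I"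
  by (simp add: chart_eval \<iota>_frac_eq_0 HF_chart)

lemma ev_I: "f \<in> I \<Longrightarrow> ev f = 0"
proof -
  assume f: "f \<in> I"
  obtain N where N: "\<forall>m\<in>Poly_Mapping.keys f. mdeg m \<le> N" using mdeg_bound by blast
  have "ev f = (\<Sum>d\<le>N. ev (hom_component d f))"
    using sum_hom_component[of f N] N by (simp flip: \<kappa>.eval_sum)
  also have "\<dots> = 0"
    using ev_eq_0_iff[OF homogeneous_hom_component[OF I_subset[OF f]]] I_hom_component[OF f] by simp
  finally show ?thesis .
qed

lemma \<iota>_frac_eval: "(f, g) \<in> HF \<Longrightarrow> \<iota> (frac_class C f g) = ev f / ev g \<and> ev g \<noteq> 0"
proof -
  assume fg: "(f, g) \<in> HF"
  then obtain d where d: "homogeneous n d f" "homogeneous n d g" "g \<notin> I" by (auto simp: HF_iff)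
  have "ev g \<noteq> 0" using ev_eq_0_iff[OF d(2)] d(3) by simp
  have "frac_class C f (Var i ^ d) = frac_class C (f * g) (g * Var i ^ d)"
    using fg HF_chart[OF d(1)] HF_mult[OF fg HF_chart[OF d(2)]]
    by (intro frac_class_eqI) (auto simp: algebra_simps)
  then have "ev f = \<iota> (frac_class C f g) * ev g"
    using \<iota>_frac_mult[OF fg HF_chart[OF d(2)]] by (simp add: chart_eval[OF d(1)] chart_eval[OF d(2)])
  then show ?thesis using \<open>ev g \<noteq> 0\<close> by simp
qed

end

end

section \<open>Nakayama's lemma, Taylor expansion and tangent vectors\<close>

text \<open>Submodules of the big ring. In particular \<open>is_module S S\<close> serves as the
  statement that \<open>S\<close> is closed under sums and products.\<close>

definition is_module :: "'l::comm_ring_1 set \<Rightarrow> 'l set \<Rightarrow> bool" where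
  "is_module S J \<longleftrightarrow> 0 \<in> J \<and> (\<forall>x\<in>J. \<forall>y\<in>J. x + y \<in> J) \<and> (\<forall>r\<in>S. \<forall>x\<in>J. r * x \<in> J)"

lemma module_closed:
  assumes "is_module S J"
  shows "0 \<in> J" "x \<in> J \<Longrightarrow> y \<in> J \<Longrightarrow> x + y \<in> J" "r \<in> S \<Longrightarrow> x \<in> J \<Longrightarrow> r * x \<in> J"
  using assms by (auto simp: is_module_def)

lemma module_sum: "is_module S J \<Longrightarrow> (\<And>i. i \<in> A \<Longrightarrow> f i \<in> J) \<Longrightarrow> sum f A \<in> J"
  by (induction A rule: infinite_finite_induct) (auto simp: module_closed)

text \<open>Nakayama's lemma by elimination: the relation for \<open>t\<close> is solved for
  \<open>t\<close>, as \<open>1 - r t\<close> is invertible, and substituted into the others. The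
  coefficients of these stay in \<open>\<mm>\<close>, so there is one generator less.\<close>

lemma nakayama:
  fixes S :: "'l::field set"
  assumes S: "is_module S S" and m: "is_module S \<mm>" "\<mm> \<subseteq> S"
    and unit: "\<And>r. r \<in> \<mm> \<Longrightarrow> 1 - r \<noteq> 0 \<and> inverse (1 - r) \<in> S"
    and N: "is_module S N" and T: "finite T"
    and rel: "\<And>t. t \<in> T \<Longrightarrow> \<exists>\<nu>\<in>N. \<exists>r. (\<forall>s\<in>T. r s \<in> \<mm>) \<and> t = \<nu> + (\<Sum>s\<in>T. r s * s)"
  shows "T \<subseteq> N"
  using T rel
proof (induction T rule: finite_induct)
  case (insert t T)
  obtain \<nu> r where t: "\<nu> \<in> N" "\<And>s. s \<in> insert t T \<Longrightarrow> r s \<in> \<mm>" "t = \<nu> + (r t * t + (\<Sum>s\<in>T. r s * s))"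
    using insert.prems[of t] insert.hyps by auto
  define u where "u = inverse (1 - r t)"
  have u: "u \<in> S" "u * (1 - r t) = 1" using unit[OF t(2)[of t]] by (auto simp: u_def)
  have "(1 - r t) * t = \<nu> + (\<Sum>s\<in>T. r s * s)"
    using t(3) by (simp add: algebra_simps)
  then have "u * (1 - r t) * t = u * (\<nu> + (\<Sum>s\<in>T. r s * s))" by (simp add: mult.assoc)
  then have t_eq: "t = u * \<nu> + (\<Sum>s\<in>T. u * r s * s)"
    by (simp add: u(2) distrib_left sum_distrib_left mult.assoc)
  have TN: "T \<subseteq> N"
  proof (rule insert.IH)
    fix s0 assume s0: "s0 \<in> T"
    obtain \<nu>0 r0 where s: "\<nu>0 \<in> N" "\<And>s. s \<in> insert t T \<Longrightarrow> r0 s \<in> \<mm>"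
      "s0 = \<nu>0 + (r0 t * t + (\<Sum>s\<in>T. r0 s * s))"
      using insert.prems[of s0] insert.hyps s0 by auto
    have "s0 = (\<nu>0 + r0 t * (u * \<nu>)) + (\<Sum>s\<in>T. (r0 s + r0 t * u * r s) * s)"
      by (subst s(3), subst t_eq) (simp add: algebra_simps sum.distrib sum_distrib_left)
    moreover have "\<nu>0 + r0 t * (u * \<nu>) \<in> N"
      using s t(1) u(1) m(2) by (intro module_closed[OF N]) auto
    moreover have "r0 s + r0 t * u * r s \<in> \<mm>" if "s \<in> T" for s
      using s(2) t(2) u(1) m(2) that by (intro module_closed[OF m(1)] module_closed(3)[OF S]) auto
    ultimately show "\<exists>\<nu>\<in>N. \<exists>r. (\<forall>s\<in>T. r s \<in> \<mm>) \<and> s0 = \<nu> + (\<Sum>s\<in>T. r s * s)"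
      by (intro bexI[of _ "\<nu>0 + r0 t * (u * \<nu>)"] exI[of _ "\<lambda>s. r0 s + r0 t * u * r s"] conjI ballI)
  qed
  have "t \<in> N"
    by (subst t_eq, intro module_closed[OF N] module_sum[OF N] module_closed(3)[OF S])
      (use t u(1) m(2) TN in auto)
  then show ?case using TN by simp
qed simp

section \<open>Derivatives, Euler's identity and first-order Taylor expansion\<close>

definition mono_deriv :: "(nat \<Rightarrow> 'k::comm_ring_1) \<Rightarrow> nat \<Rightarrow> monom \<Rightarrow> 'k" where
  "mono_deriv a l m = of_nat (Poly_Mapping.lookup m l) * mono_eval a (m - Poly_Mapping.single l 1)"

lemma monom_minus_single_add:
  fixes m :: monom
  assumes "Poly_Mapping.lookup m l > 0"
  shows "(m - Poly_Mapping.single l 1) + Poly_Mapping.single l 1 = m"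
  using assms by (intro poly_mapping_eqI) (auto simp: lookup_add lookup_minus lookup_single when_def)

lemma mono_deriv_mult: "a l * mono_deriv a l m = of_nat (Poly_Mapping.lookup m l) * mono_eval a m"
proof (cases "Poly_Mapping.lookup m l = 0")
  case False
  then have "mono_eval a m = mono_eval a (m - Poly_Mapping.single l 1) * a l"
    using monom_minus_single_add[of m l] mono_eval_add[of a "m - Poly_Mapping.single l 1" "Poly_Mapping.single l 1"]
    by simp
  then show ?thesis by (simp add: mono_deriv_def mult_ac)
qed (simp add: mono_deriv_def)

text \<open>The Leibniz rule for a monomial times one variable. An exponent of \<open>l\<close>
  truncates at 0 only where the factor \<open>of_nat\<close> is 0.\<close>

lemma mono_deriv_add_single:
  "mono_deriv a l (m + Poly_Mapping.single j 1) = a j * mono_deriv a l m + (if l = j then mono_eval a m else 0)"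
proof (cases "l = j")
  case True
  have "m + Poly_Mapping.single j 1 - Poly_Mapping.single j 1 = m" by simp
  then show ?thesis using mono_deriv_mult[of a j m] True
    by (simp add: mono_deriv_def[of a j "m + _"] lookup_add algebra_simps)
next
  case False
  show ?thesis
  proof (cases "Poly_Mapping.lookup m l = 0")
    case True
    then show ?thesis using False by (simp add: mono_deriv_def lookup_add lookup_single)
  next
    case pos: False
    have "m + Poly_Mapping.single j 1 - Poly_Mapping.single l 1 = (m - Poly_Mapping.single l 1) + Poly_Mapping.single j 1"
      using pos False by (intro poly_mapping_eqI) (auto simp: lookup_add lookup_minus lookup_single when_def)
    then show ?thesis using False
      by (simp add: mono_deriv_def lookup_add lookup_single mono_eval_add mult_ac)
  qed
qed

lemma eval_partial_deriv:
  "mpoly_eval id (partial_deriv l f) a = (\<Sum>m\<in>Poly_Mapping.keys f. Poly_Mapping.lookup f m * mono_deriv a l m)"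
proof -
  interpret coeff_hom id by (rule coeff_hom_id)
  show ?thesis by (simp add: partial_deriv_def eval_sum eval_single mono_deriv_def mult_ac)
qed

lemma euler_mono:
  assumes "Poly_Mapping.keys m \<subseteq> {..n}"
  shows "(\<Sum>l\<le>n. a l * mono_deriv a l m) = of_nat (mdeg m) * mono_eval a m"
  using mdeg_superset[OF _ assms] by (simp add: mono_deriv_mult flip: sum_distrib_right)

text \<open>Euler's identity on each homogeneous component turns the sum into the sum of
  \<open>d\<close> times the value of the component of degree \<open>d\<close>. Geometrically, the
  gradients at \<open>a\<close> of equations of a cone are orthogonal to \<open>a\<close>.\<close>

lemma euler:
  fixes f :: "'k::comm_ring_1 mpoly"
  assumes f: "f \<in> mpoly_carrier n" and zero: "\<And>d. mpoly_eval id (hom_component d f) a = 0"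
  shows "(\<Sum>l\<le>n. a l * mpoly_eval id (partial_deriv l f) a) = 0"
proof -
  interpret coeff_hom "id :: 'k \<Rightarrow> 'k" by (rule coeff_hom_id)
  obtain N where N: "\<forall>m\<in>Poly_Mapping.keys f. mdeg m \<le> N" using mdeg_bound by blast
  have "(\<Sum>l\<le>n. a l * mpoly_eval id (partial_deriv l f) a) =
    (\<Sum>m\<in>Poly_Mapping.keys f. Poly_Mapping.lookup f m * (\<Sum>l\<le>n. a l * mono_deriv a l m))"
    by (simp add: eval_partial_deriv sum_distrib_left mult_ac) (rule sum.swap)
  also have "\<dots> = (\<Sum>m\<in>Poly_Mapping.keys f. of_nat (mdeg m) * (Poly_Mapping.lookup f m * mono_eval a m))"
    using f by (intro sum.cong) (auto simp: euler_mono mpoly_carrier_def mult_ac)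
  also have "\<dots> = (\<Sum>d\<le>N. \<Sum>m\<in>{m\<in>Poly_Mapping.keys f. mdeg m = d}. of_nat (mdeg m) * (Poly_Mapping.lookup f m * mono_eval a m))"
    using N by (intro sum.group[symmetric]) auto
  also have "\<dots> = (\<Sum>d\<le>N. of_nat d * mpoly_eval id (hom_component d f) a)"
    by (simp add: hom_component_def eval_sum eval_single sum_distrib_left)
  also have "\<dots> = 0" by (simp add: zero)
  finally show ?thesis .
qed

context coeff_hom
begin

context
  fixes S J :: "'l set" and a :: "nat \<Rightarrow> 'k" and \<xi> :: "nat \<Rightarrow> 'l" and n :: nat
  assumes S: "is_module S S" "\<And>c. \<phi> c \<in> S" "\<And>j. j \<le> n \<Longrightarrow> \<xi> j \<in> S" and J: "is_module S J"
begin

lemma mono_eval_closed: "Poly_Mapping.keys m \<subseteq> {..n} \<Longrightarrow> mono_eval \<xi> m \<in> S"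
proof -
  assume m: "Poly_Mapping.keys m \<subseteq> {..n}"
  have 1: "1 \<in> S" using S(2)[of 1] by simp
  have pow: "\<xi> j ^ e \<in> S" if "j \<le> n" for j e
    by (induction e) (auto simp: 1 S(3) that module_closed(3)[OF S(1)])
  have "(\<Prod>j\<in>A. \<xi> j ^ Poly_Mapping.lookup m j) \<in> S" if "A \<subseteq> {..n}" for A
    using that by (induction A rule: infinite_finite_induct) (auto simp: 1 pow module_closed(3)[OF S(1)])
  then show ?thesis using m by (simp add: mono_eval_def)
qed

lemma eval_closed: "f \<in> mpoly_carrier n \<Longrightarrow> mpoly_eval \<phi> f \<xi> \<in> S"
  unfolding mpoly_eval_mono
  by (intro module_sum[OF S(1)] module_closed(3)[OF S(1)] S(2) mono_eval_closed) (auto simp: mpoly_carrier_def)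

text \<open>Induction on the degree, splitting off one variable \<open>j\<close>. With
  \<open>T\<close> the error for the smaller monomial, the new error is \<open>\<xi> j * T\<close>
  plus multiples of the products \<open>h j * h l\<close>, which lie in \<open>J\<close> by
  assumption.\<close>

lemma taylor_mono:
  assumes h: "\<And>j l. j \<le> n \<Longrightarrow> l \<le> n \<Longrightarrow> (\<xi> j - \<phi> (a j)) * (\<xi> l - \<phi> (a l)) \<in> J"
    and m: "Poly_Mapping.keys m \<subseteq> {..n}"
  shows "mono_eval \<xi> m - \<phi> (mono_eval a m) - (\<Sum>l\<le>n. \<phi> (mono_deriv a l m) * (\<xi> l - \<phi> (a l))) \<in> J"
  using m
proof (induction "mdeg m" arbitrary: m)
  case 0
  have "Poly_Mapping.lookup m l = 0" for l
    using 0(1) by (cases "l \<in> Poly_Mapping.keys m") (auto simp: mdeg_def in_keys_iff)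
  then have "m = 0" by (intro poly_mapping_eqI) simp
  then show ?case by (simp add: mono_deriv_def module_closed(1)[OF J])
next
  case (Suc N)
  then have "Poly_Mapping.keys m \<noteq> {}" by (auto simp: mdeg_def)
  then obtain j where j: "j \<in> Poly_Mapping.keys m" by blast
  define m' where "m' = m - Poly_Mapping.single j 1"
  have m_eq: "m = m' + Poly_Mapping.single j 1"
    unfolding m'_def by (rule monom_minus_single_add[symmetric]) (use j in \<open>simp add: in_keys_iff\<close>)
  have jn: "j \<le> n" using j Suc.prems by auto
  have m'n: "Poly_Mapping.keys m' \<subseteq> {..n}"
  proof
    fix l assume "l \<in> Poly_Mapping.keys m'"
    then have "Poly_Mapping.lookup m l \<noteq> 0" by (cases "Poly_Mapping.lookup m l") (auto simp: m'_def in_keys_iff lookup_minus)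
    then have "l \<in> Poly_Mapping.keys m" by (simp add: in_keys_iff)
    then show "l \<in> {..n}" using Suc.prems by blast
  qed
  have "N = mdeg m'" using Suc.hyps(2) by (simp add: m_eq mdeg_add)
  define h where "h l = \<xi> l - \<phi> (a l)" for l
  define D where "D = (\<Sum>l\<le>n. \<phi> (mono_deriv a l m') * h l)"
  define T where "T = mono_eval \<xi> m' - \<phi> (mono_eval a m') - D"
  have T: "T \<in> J" using Suc.hyps(1)[OF \<open>N = mdeg m'\<close> m'n] by (simp add: T_def D_def h_def)
  have "(\<Sum>l\<le>n. \<phi> (mono_deriv a l m) * h l) = \<phi> (a j) * D + \<phi> (mono_eval a m') * h j"
  proof -
    have "(\<Sum>l\<le>n. \<phi> (mono_deriv a l m) * h l) =
      (\<Sum>l\<le>n. \<phi> (a j) * (\<phi> (mono_deriv a l m') * h l) + (if l = j then \<phi> (mono_eval a m') * h l else 0))"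
      unfolding m_eq mono_deriv_add_single by (intro sum.cong) (auto simp: hom_add hom_mult algebra_simps)
    then show ?thesis using jn by (simp add: sum.distrib D_def sum_distrib_left)
  qed
  then have "mono_eval \<xi> m - \<phi> (mono_eval a m) - (\<Sum>l\<le>n. \<phi> (mono_deriv a l m) * h l) =
     \<phi> (a j) * T + h j * (mono_eval \<xi> m' - \<phi> (mono_eval a m'))"
    by (simp add: m_eq mono_eval_add hom_mult T_def h_def algebra_simps)
  also have "h j * (mono_eval \<xi> m' - \<phi> (mono_eval a m')) = h j * T + (\<Sum>l\<le>n. \<phi> (mono_deriv a l m') * (h j * h l))"
    by (simp add: T_def D_def algebra_simps sum_distrib_left)
  also have "\<phi> (a j) * T + (h j * T + (\<Sum>l\<le>n. \<phi> (mono_deriv a l m') * (h j * h l))) =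
     \<xi> j * T + (\<Sum>l\<le>n. \<phi> (mono_deriv a l m') * (h j * h l))"
    by (simp add: h_def algebra_simps)
  also have "\<dots> \<in> J"
  proof -
    have "h j * h l \<in> J" if "l \<le> n" for l using h[OF jn that] by (simp add: h_def)
    then show ?thesis
      by (intro module_closed(2)[OF J module_closed(3)[OF J S(3)[OF jn] T]]
          module_sum[OF J module_closed(3)[OF J S(2)]]) auto
  qed
  finally show ?case by (simp add: h_def)
qed

lemma taylor:
  assumes h: "\<And>j l. j \<le> n \<Longrightarrow> l \<le> n \<Longrightarrow> (\<xi> j - \<phi> (a j)) * (\<xi> l - \<phi> (a l)) \<in> J"
    and f: "f \<in> mpoly_carrier n"
  shows "mpoly_eval \<phi> f \<xi> - \<phi> (mpoly_eval id f a) -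
    (\<Sum>l\<le>n. \<phi> (mpoly_eval id (partial_deriv l f) a) * (\<xi> l - \<phi> (a l))) \<in> J"
proof -
  let ?T = "\<lambda>m. mono_eval \<xi> m - \<phi> (mono_eval a m) - (\<Sum>l\<le>n. \<phi> (mono_deriv a l m) * (\<xi> l - \<phi> (a l)))"
  have "(\<Sum>l\<le>n. \<phi> (mpoly_eval id (partial_deriv l f) a) * (\<xi> l - \<phi> (a l))) =
    (\<Sum>m\<in>Poly_Mapping.keys f. \<phi> (Poly_Mapping.lookup f m) * (\<Sum>l\<le>n. \<phi> (mono_deriv a l m) * (\<xi> l - \<phi> (a l))))"
    by (simp add: eval_partial_deriv hom_sum hom_mult sum_distrib_left sum_distrib_right mult.assoc) (rule sum.swap)
  then have "mpoly_eval \<phi> f \<xi> - \<phi> (mpoly_eval id f a) -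
    (\<Sum>l\<le>n. \<phi> (mpoly_eval id (partial_deriv l f) a) * (\<xi> l - \<phi> (a l))) =
    (\<Sum>m\<in>Poly_Mapping.keys f. \<phi> (Poly_Mapping.lookup f m) * ?T m)"
    by (simp add: mpoly_eval_mono hom_sum hom_mult right_diff_distrib sum_subtractf)
  also have "\<dots> \<in> J"
    using f by (intro module_sum[OF J] module_closed(3)[OF J] S(2) taylor_mono h) (auto simp: mpoly_carrier_def)
  finally show ?thesis .
qed

text \<open>If the differences \<open>\<xi> j - \<phi> (a j)\<close> lie in \<open>J\<close>, so do
  their products and the linear term of the Taylor expansion. It is applied to the maximal ideal of
  \<open>w\<close> and to the principal ideal of a uniformizer.\<close>

lemma eval_diff_mem:
  assumes h: "\<And>j. j \<le> n \<Longrightarrow> \<xi> j - \<phi> (a j) \<in> J" and f: "f \<in> mpoly_carrier n"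
  shows "mpoly_eval \<phi> f \<xi> - \<phi> (mpoly_eval id f a) \<in> J"
proof -
  have minus1: "- 1 \<in> S" using S(2)[of "- 1"] by (simp add: hom_minus)
  have "(\<xi> j - \<phi> (a j)) * (\<xi> l - \<phi> (a l)) \<in> J" if "j \<le> n" "l \<le> n" for j l
  proof -
    have "- 1 * \<phi> (a j) \<in> S" by (intro module_closed(3)[OF S(1)] minus1 S)
    then have "\<xi> j + - 1 * \<phi> (a j) \<in> S" by (intro module_closed(2)[OF S(1)] S that)
    then show ?thesis using module_closed(3)[OF J _ h[OF that(2)]] by simp
  qed
  from taylor[OF this f]
  have "mpoly_eval \<phi> f \<xi> - \<phi> (mpoly_eval id f a) -
    (\<Sum>l\<le>n. \<phi> (mpoly_eval id (partial_deriv l f) a) * (\<xi> l - \<phi> (a l))) \<in> J" .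
  moreover have "(\<Sum>l\<le>n. \<phi> (mpoly_eval id (partial_deriv l f) a) * (\<xi> l - \<phi> (a l))) \<in> J"
    by (intro module_sum[OF J] module_closed(3)[OF J] S h) auto
  ultimately show ?thesis using module_closed(2)[OF J] by fastforce
qed

end

end

section \<open>Linear algebra behind the Jacobian criterion\<close>

lemma fun_vector_space: "vector_space (\<lambda>(c::'f::field) v (i::nat). c * v i)"
  by unfold_locales (auto simp: algebra_simps fun_eq_iff)

definition unit_fun :: "nat \<Rightarrow> nat \<Rightarrow> 'f::field" where
  "unit_fun j = (\<lambda>l. if l = j then 1 else 0)"

text \<open>The rows are orthogonal to \<open>a\<close> and \<open>unit_fun i\<close> is not, since
  \<open>a i = 1\<close>. Adding it to a basis of the rows therefore gives at least \<open>n\<close>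
  independent vectors in a space of dimension \<open>n + 1\<close>, so that one more vector
  \<open>\<beta>\<close> suffices. The rank is known over the algebraic closure, while the vectors
  are wanted over k.\<close>

lemma span_complement:
  fixes V :: "(nat \<Rightarrow> 'k::field) set"
  assumes supp: "\<And>v j. v \<in> V \<Longrightarrow> j > n \<Longrightarrow> v j = 0"
    and perp: "\<And>v. v \<in> V \<Longrightarrow> (\<Sum>j\<le>n. a j * v j) = 0" and i: "i \<le> n" "a i = 1"
    and dim: "vector_space.dim (\<lambda>c v i. c * v i) ((\<lambda>v i. to_ac (v i)) ` V) = n - 1"
  shows "\<exists>\<beta>. \<forall>j\<le>n. \<exists>c c'. \<exists>v\<in>module.span (\<lambda>c v i. c * v i) V.
     unit_fun j = (\<lambda>l. v l + c * unit_fun i l + c' * \<beta> l)"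
proof -
  interpret V: vector_space "\<lambda>(c::'k) v (i::nat). c * v i" by (rule fun_vector_space)
  interpret W: vector_space "\<lambda>(c::'k alg_closure) v (i::nat). c * v i" by (rule fun_vector_space)
  define U :: "(nat \<Rightarrow> 'k) set" where "U = unit_fun ` {..n}"
  have U: "finite U" "card U \<le> n + 1" using card_image_le[of "{..n}" unit_fun] by (auto simp: U_def)
  have span_U: "v \<in> V.span U" if "\<And>j. j > n \<Longrightarrow> v j = 0" for v :: "nat \<Rightarrow> 'k"
  proof -
    have sum_app: "(\<Sum>j\<in>A. f j) l = (\<Sum>j\<in>A. f j l)" for A and f :: "nat \<Rightarrow> nat \<Rightarrow> 'k" and l
      by (induction A rule: infinite_finite_induct) auto
    have "v = (\<Sum>j\<le>n. (\<lambda>l. v j * unit_fun j l))"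
    proof
      fix l
      have "(\<Sum>j\<le>n. v j * unit_fun j l) = (\<Sum>j\<le>n. if j = l then v j else 0)"
        by (rule sum.cong) (auto simp: unit_fun_def)
      then show "v l = (\<Sum>j\<le>n. (\<lambda>l. v j * unit_fun j l)) l" using that[of l]
        by (auto simp: sum_app)
    qed
    also have "\<dots> \<in> V.span U"
      by (intro V.span_sum V.span_scale V.span_base) (auto simp: U_def)
    finally show ?thesis .
  qed
  obtain B where B: "B \<subseteq> V" "V.independent B" "V \<subseteq> V.span B"
    using V.maximal_independent_subset[of V] by blast
  have "B \<subseteq> V.span U" using B(1) supp span_U by blast
  then have finB: "finite B" using V.independent_span_bound[OF U(1) B(2)] by simp
  let ?t = "\<lambda>(v::nat \<Rightarrow> 'k) i. to_ac (v i)"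
  have t_span: "?t v \<in> W.span (?t ` B)" if "v \<in> V.span B" for v
    using that
  proof (induction rule: V.span_induct_alt)
    case base
    have "?t 0 = 0" by auto
    then show ?case using W.span_zero by metis
  next
    case (step c x y)
    have "?t ((\<lambda>i. c * x i) + y) = (\<lambda>i. to_ac c * ?t x i) + ?t y" by auto
    moreover have "(\<lambda>i. to_ac c * ?t x i) \<in> W.span (?t ` B)"
      using W.span_scale[OF W.span_base[OF imageI[OF step(1), of ?t]], of "to_ac c"] by simp
    ultimately show ?case using step by (metis W.span_add)
  qed
  \<comment> \<open>A basis over k also spans the rows over the closure, so the rank over k is at
    least \<open>n - 1\<close>.\<close>
  have "W.dim (?t ` V) \<le> card (?t ` B)"
    using t_span B(3) finB by (intro W.dim_le_card) auto
  also have "\<dots> \<le> card B" by (rule card_image_le[OF finB])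
  finally have cardB: "n - 1 \<le> card B" using dim by simp
  have perpB: "(\<Sum>j\<le>n. a j * v j) = 0" if "v \<in> V.span B" for v
    using that
  proof (induction rule: V.span_induct_alt)
    case (step c x y)
    then show ?case using perp[of x] B(1)
      by (auto simp: distrib_left sum.distrib mult.left_commute[of _ c] simp flip: sum_distrib_left)
  qed simp
  have "(\<Sum>j\<le>n. a j * unit_fun i j) = (\<Sum>j\<le>n. if j = i then a j else 0)"
    by (rule sum.cong) (auto simp: unit_fun_def)
  then have "(\<Sum>j\<le>n. a j * unit_fun i j) = 1" using i by simp
  then have ei: "unit_fun i \<notin> V.span B" using perpB by fastforce
  define B1 where "B1 = insert (unit_fun i) B"
  have B1: "V.independent B1" unfolding B1_def using V.independent_insertI[OF ei B(2)] .
  have cardB1: "n \<le> card B1" using cardB finB ei V.span_base unfolding B1_def by (subst card_insert_disjoint) auto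
  have "B1 \<subseteq> V.span U" using \<open>B \<subseteq> V.span U\<close> i by (auto simp: B1_def U_def intro: V.span_base)
  from V.maximal_independent_subset_extend[OF this B1] obtain B2 where
    B2: "B1 \<subseteq> B2" "B2 \<subseteq> V.span U" "V.independent B2" "V.span U \<subseteq> V.span B2" by blast
  have finB2: "finite B2" "card B2 \<le> n + 1" using V.independent_span_bound[OF U(1) B2(3,2)] U(2) by auto
  have "card (B2 - B1) \<le> 1" using cardB1 finB2 B2(1) by (subst card_Diff_subset) (auto intro: finite_subset)
  \<comment> \<open>The difference has at most one element; if it is empty, \<open>\<beta>\<close>
    is arbitrary.\<close>
  then obtain \<beta> where "B2 - B1 \<subseteq> {\<beta>}"
    using finB2(1) by (metis card_le_Suc0_iff_eq finite_Diff One_nat_def subsetI singletonI)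
  then have "B2 \<subseteq> insert \<beta> (insert (unit_fun i) B)" by (auto simp: B1_def)
  then have sp: "V.span B2 \<subseteq> V.span (insert \<beta> (insert (unit_fun i) B))" by (rule V.span_mono)
  show ?thesis
  proof (intro exI[of _ \<beta>] allI impI)
    fix j assume "j \<le> n"
    then have "unit_fun j \<in> V.span U" by (auto simp: U_def intro: V.span_base)
    then have "unit_fun j \<in> V.span (insert \<beta> (insert (unit_fun i) B))" using B2(4) sp by blast
    then obtain c' c where v: "unit_fun j - (\<lambda>l. c' * \<beta> l) - (\<lambda>l. c * unit_fun i l) \<in> V.span B"
      by (auto simp: V.span_insert)
    have "unit_fun j = (\<lambda>l. (unit_fun j - (\<lambda>l. c' * \<beta> l) - (\<lambda>l. c * unit_fun i l)) l + c * unit_fun i l + c' * \<beta> l)"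
      by (auto simp: fun_eq_iff)
    moreover have "unit_fun j - (\<lambda>l. c' * \<beta> l) - (\<lambda>l. c * unit_fun i l) \<in> V.span V"
      using v V.span_mono[OF B(1)] by blast
    ultimately show "\<exists>c c'. \<exists>v\<in>V.span V. unit_fun j = (\<lambda>l. v l + c * unit_fun i l + c' * \<beta> l)" by blast
  qed
qed

section \<open>Centres of valuations on smooth curves\<close>

context emb_variety
begin

lemma \<iota>_inj: "A \<in> carrier K \<Longrightarrow> B \<in> carrier K \<Longrightarrow> \<iota> A = \<iota> B \<Longrightarrow> A = B"
proof -
  assume AB: "A \<in> carrier K" "B \<in> carrier K" and eq: "\<iota> A = \<iota> B"
  obtain i where i: "i \<le> n" "Var i \<notin> I" using chart_exists by blast
  obtain f g d where A: "A = frac_class C f g" "(f, g) \<in> HF" "homogeneous n d f" "homogeneous n d g"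
    using carrierE[OF AB(1)] by metis
  obtain f' g' d' where B: "B = frac_class C f' g'" "(f', g') \<in> HF" "homogeneous n d' f'" "homogeneous n d' g'"
    using carrierE[OF AB(2)] by metis
  have "ev i f * ev i g' = ev i f' * ev i g"
    using \<iota>_frac_eval[OF i A(2)] \<iota>_frac_eval[OF i B(2)] eq by (simp add: A(1) B(1) frac_eq_eq)
  then have "ev i (f * g' - f' * g) = 0" by (simp add: \<kappa>.eval_diff \<kappa>.eval_mult)
  moreover have "homogeneous n (d + d') (f * g' - f' * g)"
    using homogeneous_diff[OF homogeneous_mult[OF A(3) B(4)]] homogeneous_mult[OF B(3) A(4)]
    by (simp add: add.commute)
  ultimately have "f * g' - f' * g \<in> I" using ev_eq_0_iff[OF i] by blast
  then show "A = B" using A B by (simp add: frac_class_eq_iff)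
qed

lemma \<xi>_change: "i \<le> n \<Longrightarrow> Var i \<notin> I \<Longrightarrow> i0 \<le> n \<Longrightarrow> Var i0 \<notin> I \<Longrightarrow> j \<le> n \<Longrightarrow> \<xi> i j * \<xi> i0 i = \<xi> i0 j"
proof -
  assume a: "i \<le> n" "Var i \<notin> I" "i0 \<le> n" "Var i0 \<notin> I" "j \<le> n"
  have HF: "(Var j, Var i) \<in> HF" "(Var i, Var i0) \<in> HF" "(Var j, Var i0) \<in> HF"
    using a by (auto intro: HF_I homogeneous_Var)
  have "frac_class C (Var j * Var i) (Var i * Var i0) = frac_class C (Var j) (Var i0)"
    using HF by (intro frac_class_eqI HF_mult) (auto simp: algebra_simps)
  then show ?thesis using \<iota>_frac_mult[OF HF(1,2)] a by (simp add: \<xi>_def)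
qed

lemma \<xi>_eq_0: "i \<le> n \<Longrightarrow> Var i \<notin> I \<Longrightarrow> j \<le> n \<Longrightarrow> \<xi> i j = 0 \<longleftrightarrow> Var j \<in> I"
  using \<iota>_frac_eq_0[of "Var j" "Var i"] HF_I[OF homogeneous_Var homogeneous_Var, of j i] by (simp add: \<xi>_def)

end

text \<open>The condition \<open>res\<close> says that the residue field on \<open>E\<close> is k;
  it is what makes the centre a rational point.\<close>

locale centered_valuation = emb_variety C \<iota> + field_valuation w
  for C :: "'k::field projective" and \<iota> :: "('k mpoly \<times> 'k mpoly) set \<Rightarrow> 'l::field" and w +
  assumes triv: "\<And>c. c \<noteq> 0 \<Longrightarrow> w (\<kappa> c) = 0"
    and res: "\<And>b. b \<in> E \<Longrightarrow> b \<in> val_ring w \<Longrightarrow> \<exists>c. b - \<kappa> c \<in> val_max w"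
begin

lemma \<kappa>_val_ring: "\<kappa> c \<in> val_ring w"
  using triv[of c] by (cases "c = 0") (auto simp: val_ring_def)

lemma \<kappa>_val_max: "\<kappa> c \<in> val_max w \<longleftrightarrow> c = 0"
  using triv[of c] by (cases "c = 0") (auto simp: val_max_def)

text \<open>The valuative criterion of properness for projective space: dividing by a coordinate of
  least value makes all coordinates integral.\<close>

lemma integral_chart: "\<exists>i\<le>n. Var i \<notin> I \<and> (\<forall>j\<le>n. \<xi> i j \<in> val_ring w)"
proof -
  obtain i0 where i0: "i0 \<le> n" "Var i0 \<notin> I" using chart_exists by blast
  define J where "J = {j. j \<le> n \<and> Var j \<notin> I}"
  have "finite J" "J \<noteq> {}" using i0 by (auto simp: J_def)
  then obtain i where i: "i \<in> J" "\<And>j. j \<in> J \<Longrightarrow> w (\<xi> i0 i) \<le> w (\<xi> i0 j)"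
    using arg_min_if_finite(1)[of J "\<lambda>i. w (\<xi> i0 i)"] arg_min_least[of J _ "\<lambda>i. w (\<xi> i0 i)"] by blast
  then have i': "i \<le> n" "Var i \<notin> I" by (auto simp: J_def)
  have "\<xi> i j \<in> val_ring w" if j: "j \<le> n" for j
  proof (cases "Var j \<in> I")
    case True
    then show ?thesis using \<xi>_eq_0[OF i' j] by simp
  next
    case False
    have "w (\<xi> i j) + w (\<xi> i0 i) = w (\<xi> i0 j)"
      using w_mult[of "\<xi> i j" "\<xi> i0 i"] \<xi>_change[OF i' i0 j] \<xi>_eq_0[OF i' j] \<xi>_eq_0[OF i0 i'(1)] False i'
      by simp
    moreover have "w (\<xi> i0 i) \<le> w (\<xi> i0 j)" using i(2)[of j] False j by (simp add: J_def)
    ultimately show ?thesis by (simp add: val_ring_def)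
  qed
  then show ?thesis using i' by blast
qed

lemma val_modules: "is_module (val_ring w) (val_ring w)" "is_module (val_ring w) (val_max w)"
  unfolding is_module_def by (auto intro: val_ring_add val_ring_mult val_max_add val_max_mult)

section \<open>The local ring at the centre, in an integral chart\<close>

context
  fixes i a
  assumes i: "i \<le> n" "Var i \<notin> I" and \<xi>_ring: "\<And>j. j \<le> n \<Longrightarrow> \<xi> i j \<in> val_ring w"
    and a: "a i = 1" "\<And>j. j > n \<Longrightarrow> a j = 0" and h_max: "\<And>j. j \<le> n \<Longrightarrow> \<xi> i j - \<kappa> (a j) \<in> val_max w"
begin

abbreviation "h j \<equiv> \<xi> i j - \<kappa> (a j)"
abbreviation "val_at f \<equiv> mpoly_eval id f a"

lemma ev_at: "f \<in> mpoly_carrier n \<Longrightarrow> ev i f - \<kappa> (val_at f) \<in> val_max w"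
  by (rule \<kappa>.eval_diff_mem[OF val_modules(1) \<kappa>_val_ring \<xi>_ring val_modules(2) h_max])

text \<open>At the generic point \<open>f\<close> has value 0, so the constant
  \<open>val_at f\<close> lies in the maximal ideal, where 0 is the only constant.\<close>

lemma at_I: "f \<in> I \<Longrightarrow> val_at f = 0"
  using ev_at[OF I_subset] ev_I[OF i] \<kappa>_val_max by fastforce

lemma center_rational: "proj_class a \<in> rational_points C"
  by (rule proj_class_points[OF coeff_hom_id i(1) _ a(2) at_I]) (simp_all add: a)

lemma center_geometric: "proj_class (\<lambda>j. to_ac (a j)) \<in> geometric_points C"
proof (rule proj_class_points[OF coeff_hom_to_ac i(1)])
  show "mpoly_eval to_ac f (\<lambda>j. to_ac (a j)) = 0" if "f \<in> I" for f
    by (simp add: eval_hom_base[OF coeff_hom_to_ac] at_I[OF that])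
qed (simp_all add: a)

lemma ev_unit: "f \<in> mpoly_carrier n \<Longrightarrow> val_at f \<noteq> 0 \<Longrightarrow> ev i f \<noteq> 0 \<and> w (ev i f) = 0"
  by (rule val_unit_perturb[OF ev_at]) (simp_all add: triv)

lemma ev_ring: "f \<in> mpoly_carrier n \<Longrightarrow> ev i f \<in> val_ring w"
  by (rule \<kappa>.eval_closed[OF val_modules(1) \<kappa>_val_ring \<xi>_ring val_modules(2)])

lemma ev_max_iff: "f \<in> mpoly_carrier n \<Longrightarrow> ev i f \<in> val_max w \<longleftrightarrow> val_at f = 0"
  using ev_at[of f] ev_unit[of f] by (cases "val_at f = 0") (auto simp: val_max_def)

text \<open>The local ring at the centre inside the big field, written with arbitrary polynomials in
  the affine coordinates; \<open>L_local_ring\<close> identifies it with the quotients of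
  forms.\<close>

definition "L = {ev i f / ev i g |f g. f \<in> mpoly_carrier n \<and> g \<in> mpoly_carrier n \<and> val_at g \<noteq> 0}"

lemma L_I: "f \<in> mpoly_carrier n \<Longrightarrow> g \<in> mpoly_carrier n \<Longrightarrow> val_at g \<noteq> 0 \<Longrightarrow> ev i f / ev i g \<in> L"
  unfolding L_def by blast

lemma L_ev: "f \<in> mpoly_carrier n \<Longrightarrow> ev i f \<in> L"
  using L_I[OF _ mpoly_carrier_1, of f] by (simp add: coeff_hom.eval_1[OF coeff_hom_id])

lemma L_E:
  assumes "b \<in> L"
  obtains f g where "b = ev i f / ev i g" "f \<in> mpoly_carrier n" "g \<in> mpoly_carrier n" "val_at g \<noteq> 0"
    "ev i g \<noteq> 0" "w (ev i g) = 0"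
  using assms ev_unit unfolding L_def by blast

lemma val_at_mult: "val_at (f * g) = val_at f * val_at g"
  by (simp add: coeff_hom.eval_mult[OF coeff_hom_id])

lemma L_mult: "b \<in> L \<Longrightarrow> c \<in> L \<Longrightarrow> b * c \<in> L"
proof -
  assume b: "b \<in> L" and c: "c \<in> L"
  obtain f g where f: "b = ev i f / ev i g" "f \<in> mpoly_carrier n" "g \<in> mpoly_carrier n" "val_at g \<noteq> 0"
    using L_E[OF b] by metis
  obtain f' g' where f': "c = ev i f' / ev i g'" "f' \<in> mpoly_carrier n" "g' \<in> mpoly_carrier n" "val_at g' \<noteq> 0"
    using L_E[OF c] by metis
  have "b * c = ev i (f * f') / ev i (g * g')" by (simp add: f f' \<kappa>.eval_mult)
  then show ?thesis using L_I[of "f * f'" "g * g'"] f f' by (simp add: mpoly_carrier_mult val_at_mult)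
qed

lemma L_add: "b \<in> L \<Longrightarrow> c \<in> L \<Longrightarrow> b + c \<in> L"
proof -
  assume b: "b \<in> L" and c: "c \<in> L"
  obtain f g where f: "b = ev i f / ev i g" "f \<in> mpoly_carrier n" "g \<in> mpoly_carrier n" "val_at g \<noteq> 0" "ev i g \<noteq> 0"
    using L_E[OF b] by metis
  obtain f' g' where f': "c = ev i f' / ev i g'" "f' \<in> mpoly_carrier n" "g' \<in> mpoly_carrier n" "val_at g' \<noteq> 0" "ev i g' \<noteq> 0"
    using L_E[OF c] by metis
  have "b + c = ev i (f * g' + f' * g) / ev i (g * g')"
    unfolding f(1) f'(1) \<kappa>.eval_mult \<kappa>.eval_add by (rule add_frac_eq[OF f(5) f'(5)])
  then show ?thesis using L_I[of "f * g' + f' * g" "g * g'"] f f'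
    by (simp add: mpoly_carrier_mult mpoly_carrier_add val_at_mult)
qed

lemma L_ring: "b \<in> L \<Longrightarrow> b \<in> val_ring w"
proof -
  assume b: "b \<in> L"
  obtain f g where f: "b = ev i f / ev i g" "f \<in> mpoly_carrier n" "ev i g \<noteq> 0" "w (ev i g) = 0"
    using L_E[OF b] by metis
  then show ?thesis using ev_ring[OF f(2)] w_divide[of "ev i f" "ev i g"]
    by (cases "ev i f = 0") (auto simp: val_ring_def)
qed

text \<open>Outside the maximal ideal the numerator does not vanish at \<open>a\<close>, so
  numerator and denominator may be exchanged.\<close>

lemma L_inverse: "b \<in> L \<Longrightarrow> b \<notin> val_max w \<Longrightarrow> inverse b \<in> L"
proof -
  assume b: "b \<in> L" "b \<notin> val_max w"
  obtain f g where f: "b = ev i f / ev i g" "f \<in> mpoly_carrier n" "g \<in> mpoly_carrier n" "ev i g \<noteq> 0" "w (ev i g) = 0"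
    using L_E[OF b(1)] by metis
  have "ev i f \<notin> val_max w"
    using b(2) w_divide[of "ev i f" "ev i g"] f by (auto simp: val_max_def)
  then have "val_at f \<noteq> 0" using ev_max_iff f(2) by blast
  then show ?thesis using L_I[OF f(3,2)] f(1) by simp
qed

lemma L_\<kappa>: "\<kappa> c \<in> L"
  using L_ev[OF mpoly_carrier_Const, of c] by simp

lemma L_\<xi>: "j \<le> n \<Longrightarrow> \<xi> i j \<in> L"
  using L_ev[OF mpoly_carrier_Var, of j] by simp

lemma L_minus: "b \<in> L \<Longrightarrow> - b \<in> L"
  using L_mult[OF L_\<kappa>[of "- 1"]] by (simp add: \<kappa>.hom_minus)

lemma L_module: "is_module L L"
  using L_add L_mult L_\<kappa>[of 0] by (simp add: is_module_def)

definition "\<mm> = L \<inter> val_max w"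

lemma \<mm>_module: "is_module L \<mm>"
  using L_add L_mult L_\<kappa>[of 0] val_max_add val_max_mult(2)[OF L_ring] by (simp add: is_module_def \<mm>_def)

lemma h_\<mm>: "j \<le> n \<Longrightarrow> h j \<in> \<mm>"
  using L_add[OF L_\<xi> L_minus[OF L_\<kappa>], of j "a j"] h_max by (simp add: \<mm>_def)

lemma one_minus_\<mm>: "r \<in> \<mm> \<Longrightarrow> 1 - r \<noteq> 0 \<and> inverse (1 - r) \<in> L"
proof -
  assume r: "r \<in> \<mm>"
  have "1 - r \<in> L" using L_add[OF L_\<kappa>[of 1] L_minus, of r] r by (simp add: \<mm>_def)
  moreover have "1 - r \<notin> val_max w" using val_max_add[of "1 - r" r] r by (auto simp: \<mm>_def)
  ultimately show ?thesis using L_inverse[of "1 - r"] by auto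
qed

text \<open>The square of the maximal ideal of \<open>L\<close>: it is \<open>\<mm>\<close> times
  the ideal of the \<open>h j\<close>, and these generate \<open>\<mm>\<close> because a polynomial
  that vanishes at \<open>a\<close> is a combination of them at the generic point.\<close>

definition "J = {(\<Sum>j\<le>n. r j * h j) |r. \<forall>j\<le>n. r j \<in> \<mm>}"

lemma J_module: "is_module L J"
  unfolding is_module_def
proof (intro conjI ballI)
  show "0 \<in> J" unfolding J_def
    by (rule CollectI, rule exI[of _ "\<lambda>_. 0"]) (simp add: module_closed(1)[OF \<mm>_module])
  fix x assume "x \<in> J" then obtain r where r: "x = (\<Sum>j\<le>n. r j * h j)" "\<forall>j\<le>n. r j \<in> \<mm>" by (auto simp: J_def)
  show "c * x \<in> J" if "c \<in> L" for c unfolding J_def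
    by (rule CollectI, rule exI[of _ "\<lambda>j. c * r j"])
      (use r module_closed(3)[OF \<mm>_module that] in \<open>simp add: sum_distrib_left mult.assoc\<close>)
  fix y assume "y \<in> J" then obtain r' where r': "y = (\<Sum>j\<le>n. r' j * h j)" "\<forall>j\<le>n. r' j \<in> \<mm>" by (auto simp: J_def)
  show "x + y \<in> J" unfolding J_def
    by (rule CollectI, rule exI[of _ "\<lambda>j. r j + r' j"])
      (use r r' module_closed(2)[OF \<mm>_module] in \<open>simp add: sum.distrib distrib_right\<close>)
qed

lemma h_h_J: "j \<le> n \<Longrightarrow> l \<le> n \<Longrightarrow> h j * h l \<in> J"
proof -
  assume jl: "j \<le> n" "l \<le> n"
  have "(\<Sum>k\<le>n. (if k = l then h j else 0) * h k) = (\<Sum>k\<le>n. if k = l then h j * h k else 0)"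
    by (rule sum.cong) auto
  also have "\<dots> = h j * h l" using jl by simp
  finally show ?thesis unfolding J_def using h_\<mm>[OF jl(1)] module_closed(1)[OF \<mm>_module]
    by (intro CollectI exI[of _ "\<lambda>k. if k = l then h j else 0"]) auto
qed

text \<open>The linear form with coefficients \<open>v\<close> in the local coordinates
  \<open>h l\<close>. For the gradient of an equation it lies in \<open>J\<close>, by Taylor's
  formula.\<close>

definition "\<Phi> v = (\<Sum>l\<le>n. \<kappa> (v l) * h l)"

lemma \<Phi>_unit: "j \<le> n \<Longrightarrow> \<Phi> (unit_fun j) = h j"
proof -
  assume "j \<le> n"
  have "\<Phi> (unit_fun j) = (\<Sum>k\<le>n. if k = j then h k else 0)"
    unfolding \<Phi>_def by (rule sum.cong) (auto simp: unit_fun_def)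
  then show ?thesis using \<open>j \<le> n\<close> by simp
qed

text \<open>\<open>\<Phi>\<close> maps the gradients of the equations into \<open>J\<close>, and the
  direction \<open>unit_fun i\<close> to \<open>h i = 0\<close> because the coordinate
  \<open>i\<close> is constantly 1. The Jacobian criterion leaves a single further direction
  \<open>\<beta>\<close>, so \<open>\<Phi> \<beta>\<close> spans the cotangent space.\<close>

lemma uniformizer_mod:
  assumes smooth: "smooth_curve C"
  shows "\<exists>u\<in>\<mm>. \<forall>j\<le>n. \<exists>c. \<exists>y\<in>J. h j = \<kappa> c * u + y"
proof -
  interpret V: vector_space "\<lambda>(c::'k) v (i::nat). c * v i" by (rule fun_vector_space)
  define V where "V = {(\<lambda>l. val_at (partial_deriv l f)) |f. f \<in> I}"
  have "\<exists>\<beta>. \<forall>j\<le>n. \<exists>c c'. \<exists>v\<in>V.span V. unit_fun j = (\<lambda>l. v l + c * unit_fun i l + c' * \<beta> l)"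
  proof (rule span_complement[where i = i and a = a and n = n, OF _ _ i(1) a(1)])
    fix v j assume "v \<in> V" "n < j"
    then obtain f where f: "f \<in> I" "v = (\<lambda>l. val_at (partial_deriv l f))" by (auto simp: V_def)
    have "mono_deriv a j m = 0" if "m \<in> Poly_Mapping.keys f" for m
    proof -
      have "j \<notin> Poly_Mapping.keys m" using that I_subset[OF f(1)] \<open>n < j\<close> by (force simp: mpoly_carrier_def)
      then show ?thesis by (simp add: mono_deriv_def in_keys_iff)
    qed
    then show "v j = 0" by (simp add: f(2) eval_partial_deriv)
  next
    fix v assume "v \<in> V"
    then obtain f where f: "f \<in> I" "v = (\<lambda>l. val_at (partial_deriv l f))" by (auto simp: V_def)
    show "(\<Sum>j\<le>n. a j * v j) = 0"
      using euler[OF I_subset[OF f(1)], of a] at_I[OF I_hom_component[OF f(1)]] by (simp add: f(2))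
  next
    have "(\<lambda>v i. to_ac (v i)) ` V = {\<lambda>l. mpoly_eval to_ac (partial_deriv l f) (\<lambda>j. to_ac (a j)) |f. f \<in> I}"
      by (auto simp: V_def eval_hom_base[OF coeff_hom_to_ac] image_def)
    moreover have "jacobian_rank C (\<lambda>j. to_ac (a j)) = n - 1"
      using smooth center_geometric proj_class_self unfolding smooth_curve_def by blast
    ultimately show "vector_space.dim (\<lambda>c v i. c * v i) ((\<lambda>v i. to_ac (v i)) ` V) = n - 1"
      by (simp add: jacobian_rank_def)
  qed
  then obtain \<beta> where \<beta>: "\<And>j. j \<le> n \<Longrightarrow> \<exists>c c'. \<exists>v\<in>V.span V. unit_fun j = (\<lambda>l. v l + c * unit_fun i l + c' * \<beta> l)"
    by blast
  have span: "\<Phi> v \<in> J" if "v \<in> V.span V" for v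
    using that
  proof (induction rule: V.span_induct_alt)
    case base
    then show ?case by (simp add: \<Phi>_def module_closed(1)[OF J_module])
  next
    case (step c x y)
    from step(1) obtain f where f: "f \<in> I" "x = (\<lambda>l. val_at (partial_deriv l f))" by (auto simp: V_def)
    \<comment> \<open>An equation vanishes both at the generic point and at \<open>a\<close>, so its
      linear term alone is in \<open>J\<close>.\<close>
    have "ev i f - \<kappa> (val_at f) - \<Phi> x \<in> J"
      using \<kappa>.taylor[OF L_module L_\<kappa> L_\<xi> J_module h_h_J I_subset[OF f(1)]] by (simp add: \<Phi>_def f(2))
    then have "- \<Phi> x \<in> J" by (simp add: ev_I[OF i f(1)] at_I[OF f(1)])
    then have "\<kappa> (- c) * - \<Phi> x \<in> J" by (rule module_closed(3)[OF J_module L_\<kappa>])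
    moreover have "\<Phi> ((\<lambda>i. c * x i) + y) = \<kappa> (- c) * - \<Phi> x + \<Phi> y"
      by (simp add: \<Phi>_def \<kappa>.hom_add \<kappa>.hom_mult \<kappa>.hom_minus distrib_right sum.distrib sum_distrib_left mult.assoc sum_negf)
    ultimately show ?case using module_closed(2)[OF J_module _ step(2)] by metis
  qed
  have hi: "h i = 0" using \<xi>_self[OF i] a by simp
  show ?thesis
  proof (intro bexI[of _ "\<Phi> \<beta>"] allI impI)
    show "\<Phi> \<beta> \<in> \<mm>" unfolding \<Phi>_def
      by (intro module_sum[OF \<mm>_module] module_closed(3)[OF \<mm>_module] L_\<kappa> h_\<mm>) auto
    fix j assume j: "j \<le> n"
    obtain c c' v where v: "v \<in> V.span V" "unit_fun j = (\<lambda>l. v l + c * unit_fun i l + c' * \<beta> l)"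
      using \<beta>[OF j] by blast
    have "h j = \<Phi> (\<lambda>l. v l + c * unit_fun i l + c' * \<beta> l)" using \<Phi>_unit[OF j] v(2) by simp
    also have "\<dots> = \<Phi> v + \<kappa> c * \<Phi> (unit_fun i) + \<kappa> c' * \<Phi> \<beta>"
      by (simp add: \<Phi>_def \<kappa>.hom_add \<kappa>.hom_mult distrib_right sum.distrib sum_distrib_left mult.assoc)
    also have "\<dots> = \<kappa> c' * \<Phi> \<beta> + \<Phi> v" using \<Phi>_unit[OF i(1)] hi by simp
    finally show "\<exists>c. \<exists>y\<in>J. h j = \<kappa> c * \<Phi> \<beta> + y" using span[OF v(1)] by blast
  qed
qed

text \<open>Nakayama's lemma, with the principal ideal of \<open>u\<close> as \<open>N\<close>, puts
  all \<open>h j\<close> into \<open>N\<close>. An element of \<open>\<mm>\<close> is a polynomial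
  vanishing at \<open>a\<close>, hence a combination of the \<open>h j\<close>, divided by a
  unit.\<close>

lemma uniformizer:
  assumes smooth: "smooth_curve C"
  shows "\<exists>u\<in>\<mm>. \<forall>b\<in>\<mm>. \<exists>r\<in>L. b = r * u"
proof -
  obtain u where u: "u \<in> \<mm>" "\<And>j. j \<le> n \<Longrightarrow> \<exists>c. \<exists>y\<in>J. h j = \<kappa> c * u + y"
    using uniformizer_mod[OF smooth] by blast
  define N where "N = {r * u |r. r \<in> L}"
  have N: "is_module L N" unfolding is_module_def
  proof (intro conjI ballI)
    show "0 \<in> N" unfolding N_def using L_\<kappa>[of 0] by force
    fix x assume "x \<in> N" then obtain r where r: "x = r * u" "r \<in> L" by (auto simp: N_def)
    show "c * x \<in> N" if "c \<in> L" for c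
      using L_mult[OF that r(2)] unfolding r N_def by (auto simp: mult.assoc)
    fix y assume "y \<in> N" then obtain s where s: "y = s * u" "s \<in> L" by (auto simp: N_def)
    show "x + y \<in> N" using L_add[OF r(2) s(2)] unfolding r s N_def by (auto simp flip: distrib_right)
  qed
  have "h ` {..n} \<subseteq> N"
  proof (rule nakayama[OF L_module \<mm>_module _ one_minus_\<mm> N])
    fix t assume "t \<in> h ` {..n}"
    then obtain c y where y: "y \<in> J" "t = \<kappa> c * u + y" using u(2) by blast
    then obtain r where r: "y = (\<Sum>j\<le>n. r j * h j)" "\<forall>j\<le>n. r j \<in> \<mm>" by (auto simp: J_def)
    \<comment> \<open>\<open>nakayama\<close> speaks of a set of generators, so the coefficients of
      coinciding \<open>h j\<close> are added up.\<close>
    define R where "R s = (\<Sum>j\<in>{j\<in>{..n}. h j = s}. r j)" for s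
    have "y = (\<Sum>s\<in>h ` {..n}. \<Sum>j\<in>{j\<in>{..n}. h j = s}. r j * h j)"
      unfolding r by (rule sum.image_gen) simp
    also have "\<dots> = (\<Sum>s\<in>h ` {..n}. R s * s)"
      unfolding R_def sum_distrib_right by (intro sum.cong) auto
    finally have "t = \<kappa> c * u + (\<Sum>s\<in>h ` {..n}. R s * s)" using y by simp
    moreover have "R s \<in> \<mm>" for s unfolding R_def using r(2) by (intro module_sum[OF \<mm>_module]) auto
    moreover have "\<kappa> c * u \<in> N" using L_\<kappa> by (auto simp: N_def)
    ultimately show "\<exists>\<nu>\<in>N. \<exists>r. (\<forall>s\<in>h ` {..n}. r s \<in> \<mm>) \<and> t = \<nu> + (\<Sum>s\<in>h ` {..n}. r s * s)" by blast
  qed (auto simp: \<mm>_def)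
  then have hN: "h j \<in> N" if "j \<le> n" for j using that by blast
  have "b \<in> N" if b: "b \<in> \<mm>" for b
  proof -
    have "b \<in> L" "b \<in> val_max w" using b by (auto simp: \<mm>_def)
    obtain f g where f: "b = ev i f / ev i g" "f \<in> mpoly_carrier n" "g \<in> mpoly_carrier n" "val_at g \<noteq> 0" "ev i g \<noteq> 0"
      using L_E[OF \<open>b \<in> L\<close>] by metis
    have "ev i f \<in> val_max w"
      using val_max_mult(1)[OF \<open>b \<in> val_max w\<close> ev_ring[OF f(3)]] f by simp
    then have "val_at f = 0" using ev_max_iff f(2) by blast
    moreover have "ev i f - \<kappa> (val_at f) \<in> N"
      by (rule \<kappa>.eval_diff_mem[OF L_module L_\<kappa> L_\<xi> N hN f(2)])
    ultimately have "ev i f \<in> N" by simp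
    moreover have "1 / ev i g \<in> L" using L_I[OF mpoly_carrier_1 f(3,4)] by simp
    ultimately have "1 / ev i g * ev i f \<in> N" using module_closed(3)[OF N] by blast
    then show ?thesis by (simp add: f(1))
  qed
  then show ?thesis using u(1) by (auto simp: N_def)
qed

text \<open>Numerator and denominator are homogenized to a common degree. This changes no value
  where the coordinate \<open>i\<close> is 1, in particular neither at \<open>a\<close> nor at the
  generic point.\<close>

lemma L_local_ring: "b \<in> L \<longleftrightarrow> (\<exists>A\<in>local_ring C (proj_class a). \<iota> A = b)"
proof
  assume b: "b \<in> L"
  obtain f g where f: "b = ev i f / ev i g" "f \<in> mpoly_carrier n" "g \<in> mpoly_carrier n" "val_at g \<noteq> 0"
    using L_E[OF b] by metis
  obtain M where M: "\<forall>m\<in>Poly_Mapping.keys f. mdeg m \<le> M" using mdeg_bound by blast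
  obtain M' where M': "\<forall>m\<in>Poly_Mapping.keys g. mdeg m \<le> M'" using mdeg_bound by blast
  define N where "N = max M M'"
  define f' g' where "f' = homogenize i N f" and "g' = homogenize i N g"
  have fg': "ev i f' = ev i f" "ev i g' = ev i g" "val_at g' = val_at g"
    unfolding f'_def g'_def using M M' \<xi>_self[OF i] a(1)
    by (auto simp: N_def intro!: \<kappa>.eval_homogenize coeff_hom.eval_homogenize[OF coeff_hom_id])
  have "g' \<notin> I" using at_I[of g'] fg'(3) f(4) by auto
  then have HF: "(f', g') \<in> HF" unfolding f'_def g'_def
    using HF_I[OF homogeneous_homogenize[OF f(2) i(1), of N] homogeneous_homogenize[OF f(3) i(1), of N]]
    by simp
  then have "frac_class C f' g' \<in> local_ring C (proj_class a)"
    unfolding local_ring_iff[OF carrierI[OF HF]]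
    by (intro exI[of _ f'] exI[of _ g'] conjI HF refl) (simp add: fg'(3) f(4))
  moreover have "\<iota> (frac_class C f' g') = b" using \<iota>_frac_eval[OF i HF] fg' f by simp
  ultimately show "\<exists>A\<in>local_ring C (proj_class a). \<iota> A = b" by blast
next
  assume "\<exists>A\<in>local_ring C (proj_class a). \<iota> A = b"
  then obtain A where A: "A \<in> local_ring C (proj_class a)" "\<iota> A = b" by blast
  then have "A \<in> carrier K" by (auto simp: local_ring_def)
  from A(1) local_ring_iff[OF this] obtain f g where "(f, g) \<in> HF" "A = frac_class C f g" "val_at g \<noteq> 0" by blast
  then show "b \<in> L" using \<iota>_frac_eval[OF i] HF_D A(2) L_I by metis
qed

text \<open>The local ring is a discrete valuation ring: dividing by \<open>u\<close> as long as the
  element is in the maximal ideal must stop, since each division lowers the real value by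
  \<open>w u > 0\<close>. All values of \<open>w\<close> on nonzero elements of \<open>E\<close> are
  thus integral multiples of \<open>w u\<close>, and \<open>1 / w u\<close> normalizes
  \<open>w\<close>.\<close>

lemma center_point_valuation:
  assumes smooth: "smooth_curve C" and nontriv: "\<exists>b\<in>E. b \<noteq> 0 \<and> w b \<noteq> 0"
  shows "\<exists>v c. c > 0 \<and> point_valuation C (proj_class a) v \<and>
    (\<forall>A\<in>carrier K - {\<zero>\<^bsub>K\<^esub>}. c * w (\<iota> A) = of_int (v A))"
proof -
  obtain u where u: "u \<in> \<mm>" "\<And>b. b \<in> \<mm> \<Longrightarrow> \<exists>r\<in>L. b = r * u" using uniformizer[OF smooth] by blast
  have frac: "\<exists>p q. p \<in> L \<and> q \<in> L \<and> q \<noteq> 0 \<and> b = p / q" if b: "b \<in> E" for b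
  proof -
    obtain A where A: "A \<in> carrier K" "b = \<iota> A" using b by blast
    obtain f g where "A = frac_class C f g" "(f, g) \<in> HF" using carrierE[OF A(1)] by metis
    then show ?thesis using \<iota>_frac_eval[OF i, of f g] L_ev[of f] L_ev[of g] HF_D[of f g] A(2) by blast
  qed
  \<comment> \<open>With \<open>u = 0\<close> the maximal ideal would be zero and \<open>w\<close>
    trivial on the whole function field.\<close>
  have u0: "u \<noteq> 0"
  proof
    assume "u = 0"
    then have "\<mm> \<subseteq> {0}" using u(2) by auto
    then have w0: "w b = 0" if "b \<in> L" "b \<noteq> 0" for b
      using that val_unit[OF L_ring[OF that(1)]] by (auto simp: \<mm>_def)
    obtain b where b: "b \<in> E" "b \<noteq> 0" "w b \<noteq> 0" using nontriv by blast
    obtain p q where "p \<in> L" "q \<in> L" "q \<noteq> 0" "b = p / q" using frac[OF b(1)] by blast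
    then show False using b w0[of p] w0[of q] w_divide[of p q] by auto
  qed
  have uL: "u \<in> L" and wu: "w u > 0" using u(1) u0 by (auto simp: \<mm>_def val_max_def)
  have dvr: "\<exists>k e. e \<in> L \<and> e \<notin> val_max w \<and> b = e * u ^ k"
    if "b \<in> L" "b \<noteq> 0" "w b < of_nat N * w u" for b N
    using that
  proof (induction N arbitrary: b)
    case 0
    then show ?case using L_ring[OF 0(1)] by (auto simp: val_ring_def)
  next
    case (Suc N)
    show ?case
    proof (cases "b \<in> val_max w")
      case False
      then show ?thesis using Suc by (intro exI[of _ 0] exI[of _ b]) auto
    next
      case True
      then obtain r where r: "r \<in> L" "b = r * u" using u(2)[of b] Suc.prems by (auto simp: \<mm>_def)
      have "r \<noteq> 0" using r Suc.prems by auto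
      then have "w r < of_nat N * w u" using Suc.prems(3) u0 by (simp add: r w_mult distrib_right)
      from Suc.IH[OF r(1) \<open>r \<noteq> 0\<close> this] obtain k e where "e \<in> L" "e \<notin> val_max w" "r = e * u ^ k" by blast
      then show ?thesis using r(2) by (intro exI[of _ "Suc k"] exI[of _ e]) auto
    qed
  qed
  have dvrL: "\<exists>k e. e \<in> L \<and> e \<notin> val_max w \<and> b = e * u ^ k" if "b \<in> L" "b \<noteq> 0" for b
  proof -
    obtain N where "w b < of_nat N * w u" using ex_less_of_nat_mult[OF wu] by blast
    then show ?thesis using dvr[OF that] by blast
  qed
  have dvrE: "\<exists>k k' e. e \<in> L \<and> e \<notin> val_max w \<and> b = e * u ^ k / u ^ k' \<and> w b = (of_nat k - of_nat k') * w u"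
    if b: "b \<in> E" "b \<noteq> 0" for b
  proof -
    obtain p q where pq: "p \<in> L" "q \<in> L" "q \<noteq> 0" "b = p / q" using frac[OF b(1)] by blast
    then obtain k e where e: "e \<in> L" "e \<notin> val_max w" "p = e * u ^ k" using dvrL[of p] b by auto
    obtain k' e' where e': "e' \<in> L" "e' \<notin> val_max w" "q = e' * u ^ k'" using dvrL[of q] pq by auto
    have we: "e \<noteq> 0" "w e = 0" "e' \<noteq> 0" "w e' = 0"
      using val_unit[OF L_ring[OF e(1)] e(2)] val_unit[OF L_ring[OF e'(1)] e'(2)] by auto
    have "e * inverse e' \<in> L" using L_mult[OF e(1) L_inverse[OF e'(1,2)]] .
    moreover have "e * inverse e' \<notin> val_max w" using we by (auto simp: val_max_def w_mult w_inverse)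
    moreover have "b = e * inverse e' * u ^ k / u ^ k'" using pq e e' by (simp add: field_simps)
    moreover have "w b = (of_nat k - of_nat k') * w u"
      using pq e e' we u0 by (simp add: w_divide w_mult w_power algebra_simps)
    ultimately show ?thesis by blast
  qed
  \<comment> \<open>On nonzero elements the quotient is already an integer; the floor only changes
    its type.\<close>
  define v where "v A = \<lfloor>w (\<iota> A) / w u\<rfloor>" for A
  have v: "of_int (v A) * w u = w (\<iota> A)" if A: "A \<in> carrier K - {\<zero>\<^bsub>K\<^esub>}" for A
  proof -
    obtain k k' where kk: "w (\<iota> A) = (of_nat k - of_nat k') * w u"
      using dvrE[of "\<iota> A"] A \<iota>_eq_0 by blast
    then have *: "w (\<iota> A) / w u = of_int (int k - int k')" using wu by simp
    show ?thesis unfolding v_def * floor_of_int by (simp add: kk)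
  qed
  have v_le: "w (\<iota> A) \<le> w (\<iota> B) \<longleftrightarrow> v A \<le> v B" if "A \<in> carrier K - {\<zero>\<^bsub>K\<^esub>}" "B \<in> carrier K - {\<zero>\<^bsub>K\<^esub>}" for A B
    using mult_le_cancel_right_pos[OF wu, of "of_int (v A)" "of_int (v B)"] v[OF that(1)] v[OF that(2)] by simp
  interpret K: field K by (rule K_field)
  have "valuation K v" unfolding valuation_def
  proof (intro ballI conjI impI)
    fix A B assume AB: "A \<in> carrier K - {\<zero>\<^bsub>K\<^esub>}" "B \<in> carrier K - {\<zero>\<^bsub>K\<^esub>}"
    have nz: "\<iota> A \<noteq> 0" "\<iota> B \<noteq> 0" using AB \<iota>_eq_0 by auto
    have "A \<otimes>\<^bsub>K\<^esub> B \<in> carrier K - {\<zero>\<^bsub>K\<^esub>}" using AB K.integral_iff by auto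
    from v[OF this] have "of_int (v (A \<otimes>\<^bsub>K\<^esub> B)) * w u = of_int (v A + v B) * w u"
      using AB nz v[OF AB(1)] v[OF AB(2)] by (simp add: \<iota>_mult w_mult distrib_right)
    then show "v (A \<otimes>\<^bsub>K\<^esub> B) = v A + v B" using wu by (simp del: of_int_add)
    assume "A \<oplus>\<^bsub>K\<^esub> B \<noteq> \<zero>\<^bsub>K\<^esub>"
    then have AB': "A \<oplus>\<^bsub>K\<^esub> B \<in> carrier K - {\<zero>\<^bsub>K\<^esub>}" using AB by auto
    have "min (w (\<iota> A)) (w (\<iota> B)) \<le> w (\<iota> (A \<oplus>\<^bsub>K\<^esub> B))"
      using w_add[OF nz] AB AB' \<iota>_eq_0[of "A \<oplus>\<^bsub>K\<^esub> B"] by (simp add: \<iota>_add)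
    then show "min (v A) (v B) \<le> v (A \<oplus>\<^bsub>K\<^esub> B)"
      using v_le[OF AB(1) AB'] v_le[OF AB(2) AB'] by linarith
  qed
  moreover have "v ` (carrier K - {\<zero>\<^bsub>K\<^esub>}) = UNIV"
  proof (intro equalityI subsetI)
    fix z :: int
    obtain A where A: "A \<in> local_ring C (proj_class a)" "\<iota> A = u" using uL L_local_ring by blast
    then have uE: "u \<in> E" by (auto simp: local_ring_def)
    have "\<exists>b\<in>E. b \<noteq> 0 \<and> w b = of_int z * w u"
    proof (cases "z \<ge> 0")
      case True
      then show ?thesis using u0 subfield_closed(9)[OF subfield_E uE, of "nat z"]
        by (intro bexI[of _ "u ^ nat z"]) (auto simp: w_power)
    next
      case False
      then show ?thesis using u0 subfield_closed(6)[OF subfield_E subfield_closed(9)[OF subfield_E uE, of "nat (- z)"]]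
        by (intro bexI[of _ "inverse (u ^ nat (- z))"]) (auto simp: w_power w_inverse)
    qed
    then obtain B where B: "B \<in> carrier K" "\<iota> B \<noteq> 0" "w (\<iota> B) = of_int z * w u" by blast
    then have "v B = z" using wu by (simp add: v_def)
    then show "z \<in> v ` (carrier K - {\<zero>\<^bsub>K\<^esub>})" using B \<iota>_eq_0 by blast
  qed simp
  moreover have "{A \<in> carrier K. A = \<zero>\<^bsub>K\<^esub> \<or> 0 \<le> v A} = local_ring C (proj_class a)"
  proof (intro equalityI subsetI)
    fix A assume A: "A \<in> local_ring C (proj_class a)"
    then have AK: "A \<in> carrier K" by (auto simp: local_ring_def)
    have "\<iota> A \<in> val_ring w" using A L_local_ring L_ring by blast
    then show "A \<in> {A \<in> carrier K. A = \<zero>\<^bsub>K\<^esub> \<or> 0 \<le> v A}"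
      using AK \<iota>_eq_0[OF AK] wu by (auto simp: val_ring_def v_def)
  next
    fix A assume "A \<in> {A \<in> carrier K. A = \<zero>\<^bsub>K\<^esub> \<or> 0 \<le> v A}"
    then have A: "A \<in> carrier K" "A = \<zero>\<^bsub>K\<^esub> \<or> 0 \<le> v A" by auto
    have "\<iota> A \<in> L"
    proof (cases "A = \<zero>\<^bsub>K\<^esub>")
      case True
      then show ?thesis using \<iota>_0 L_\<kappa>[of 0] by simp
    next
      case False
      then obtain k k' e where e: "e \<in> L" "\<iota> A = e * u ^ k / u ^ k'" "w (\<iota> A) = (of_nat k - of_nat k') * w u"
        using dvrE[of "\<iota> A"] A \<iota>_eq_0 by blast
      have "0 \<le> w (\<iota> A)" using v[of A] A False wu
        by (metis DiffI of_int_0_le_iff less_imp_le mult_nonneg_nonneg singletonD)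
      \<comment> \<open>No power of \<open>u\<close> remains in the denominator, so the valuation
        ring is not larger than the local ring.\<close>
      then have "k' \<le> k" using e(3) wu by (simp add: zero_le_mult_iff)
      then have "\<iota> A = e * u ^ (k - k')" using e(2) u0 by (simp add: power_diff)
      moreover have "u ^ m \<in> L" for m by (induction m) (use L_mult[OF uL] L_\<kappa>[of 1] in auto)
      ultimately show ?thesis using L_mult[OF e(1)] by simp
    qed
    then obtain A' where A': "A' \<in> local_ring C (proj_class a)" "\<iota> A' = \<iota> A" using L_local_ring by blast
    then have "A' \<in> carrier K" by (auto simp: local_ring_def)
    then show "A \<in> local_ring C (proj_class a)" using \<iota>_inj[OF A(1), of A'] A' by simp
  qed
  ultimately have "point_valuation C (proj_class a) v" by (simp add: point_valuation_def)
  moreover have "1 / w u * w (\<iota> A) = of_int (v A)" if "A \<in> carrier K - {\<zero>\<^bsub>K\<^esub>}" for A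
    using v[OF that] wu by (simp add: field_simps)
  ultimately show ?thesis using wu by (intro exI[of _ v] exI[of _ "1 / w u"]) auto
qed

end

text \<open>In an integral chart the residues of the coordinates are constants by
  \<open>res\<close>; they are the coordinates of the centre.\<close>

lemma valuation_center:
  assumes smooth: "smooth_curve C" and nontriv: "\<exists>b\<in>E. b \<noteq> 0 \<and> w b \<noteq> 0"
  shows "\<exists>x\<in>rational_points C. \<exists>v c. c > 0 \<and> point_valuation C x v \<and>
    (\<forall>A\<in>carrier K - {\<zero>\<^bsub>K\<^esub>}. c * w (\<iota> A) = of_int (v A))"
proof -
  obtain i where i: "i \<le> n" "Var i \<notin> I" "\<And>j. j \<le> n \<Longrightarrow> \<xi> i j \<in> val_ring w"
    using integral_chart by blast
  have "\<exists>c. \<xi> i j - \<kappa> c \<in> val_max w" if "j \<le> n" for j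
  proof (rule res[OF _ i(3)[OF that]])
    show "\<xi> i j \<in> E" using HF_I[OF homogeneous_Var[OF that] homogeneous_Var[OF i(1)] i(2)] that
      by (auto simp: \<xi>_def intro!: imageI carrierI)
  qed
  then obtain b where b: "\<And>j. j \<le> n \<Longrightarrow> \<xi> i j - \<kappa> (b j) \<in> val_max w" by metis
  define a where "a j = (if j = i then 1 else if j \<le> n then b j else 0)" for j
  have a: "a i = 1" "\<And>j. j > n \<Longrightarrow> a j = 0" using i(1) by (auto simp: a_def)
  have h: "\<xi> i j - \<kappa> (a j) \<in> val_max w" if "j \<le> n" for j
    using b[OF that] that \<xi>_self[OF i(1,2)] by (auto simp: a_def)
  show ?thesis
    using center_rational[OF i a h] center_point_valuation[OF i a h smooth nontriv] by blast
qed

end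

section \<open>Embeddings of the rational function field\<close>

lemma poly_over_add: "subfield k type_ring \<Longrightarrow> poly_over k p \<Longrightarrow> poly_over k q \<Longrightarrow> poly_over (k :: 'l::field set) (p + q)"
  by (auto simp: poly_over_def intro: subfield_closed)

lemma poly_over_mult: "subfield k type_ring \<Longrightarrow> poly_over k p \<Longrightarrow> poly_over k q \<Longrightarrow> poly_over (k :: 'l::field set) (p * q)"
  by (auto simp: poly_over_def coeff_mult intro!: subfield_closed subfield_sum)

lemma poly_over_0: "subfield k type_ring \<Longrightarrow> poly_over (k :: 'l::field set) 0"
  by (auto simp: poly_over_def intro: subfield_closed)

lemma poly_over_1: "subfield k type_ring \<Longrightarrow> poly_over (k :: 'l::field set) 1"
  by (auto simp: poly_over_def intro: subfield_closed)

lemma poly_over_monom: "subfield k type_ring \<Longrightarrow> c \<in> k \<Longrightarrow> poly_over (k :: 'l::field set) (Polynomial.monom c e)"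
  by (auto simp: poly_over_def intro: subfield_closed)

lemma poly_over_sum: "subfield k type_ring \<Longrightarrow> (\<And>i. i \<in> A \<Longrightarrow> poly_over k (f i)) \<Longrightarrow> poly_over (k :: 'l::field set) (sum f A)"
  by (induction A rule: infinite_finite_induct) (auto intro: poly_over_add poly_over_0)

lemma poly_closed: "subfield F type_ring \<Longrightarrow> poly_over F p \<Longrightarrow> x \<in> F \<Longrightarrow> poly p x \<in> (F :: 'l::field set)"
  unfolding poly_altdef poly_over_def by (intro subfield_sum subfield_closed) auto

text \<open>A relation for \<open>u\<close> over \<open>k(\<tau>)\<close> is rearranged by powers of \<open>\<tau>\<close>.\<close>

lemma alg_over_exchange:
  fixes k :: "'l::field set"
  assumes k: "subfield k type_ring" and F': "subfield F' type_ring" "k \<subseteq> F'" "u \<in> F'"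
    and F: "\<And>b. b \<in> F \<Longrightarrow> \<exists>p q. poly_over k p \<and> poly_over k q \<and> poly q \<tau> \<noteq> 0 \<and> b = poly p \<tau> / poly q \<tau>"
    and u: "alg_over F u" "\<not> alg_over k u"
  shows "alg_over F' \<tau>"
proof -
  obtain r where r: "r \<noteq> 0" "poly_over F r" "poly r u = 0" using u by (auto simp: alg_over_def)
  \<comment> \<open>A common denominator of all coefficients of \<open>r\<close>, built up as the
    product of their denominators.\<close>
  have "\<exists>d. poly_over k d \<and> poly d \<tau> \<noteq> 0 \<and> (\<forall>i. \<exists>p. poly_over k p \<and> poly d \<tau> * Polynomial.coeff r i = poly p \<tau>)"
    using r(2)
  proof (induction r)
    case 0
    then show ?case using poly_over_1[OF k] poly_over_0[OF k]
      by (intro exI[of _ 1]) (auto intro!: exI[of _ 0])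
  next
    case (pCons a r)
    have "a \<in> F" "poly_over F r" using pCons.prems unfolding poly_over_def
      by (metis coeff_pCons_0, metis coeff_pCons_Suc)
    from F[OF this(1)] obtain p q where pq: "poly_over k p" "poly_over k q" "poly q \<tau> \<noteq> 0" "a = poly p \<tau> / poly q \<tau>"
      by blast
    from pCons.IH[OF \<open>poly_over F r\<close>] obtain d where d: "poly_over k d" "poly d \<tau> \<noteq> 0"
      "\<And>i. \<exists>p. poly_over k p \<and> poly d \<tau> * Polynomial.coeff r i = poly p \<tau>" by blast
    have "\<exists>p. poly_over k p \<and> poly (d * q) \<tau> * Polynomial.coeff (pCons a r) i = poly p \<tau>" for i
    proof (cases i)
      case 0
      then show ?thesis using pq d(1)
        by (intro exI[of _ "d * p"]) (auto intro: poly_over_mult[OF k])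
    next
      case (Suc j)
      from d(3)[of j] obtain p' where "poly_over k p'" "poly d \<tau> * Polynomial.coeff r j = poly p' \<tau>" by blast
      then show ?thesis using pq(2) Suc
        by (intro exI[of _ "q * p'"]) (auto intro: poly_over_mult[OF k] simp: mult_ac)
    qed
    then show ?case using poly_over_mult[OF k d(1) pq(2)] d(2) pq(3) by (intro exI[of _ "d * q"]) auto
  qed
  then obtain d where d: "poly d \<tau> \<noteq> 0"
    "\<And>i. \<exists>p. poly_over k p \<and> poly d \<tau> * Polynomial.coeff r i = poly p \<tau>" by blast
  from d(2) obtain P where P: "\<And>i. poly_over k (P i)" "\<And>i. poly d \<tau> * Polynomial.coeff r i = poly (P i) \<tau>" by metis
  define N where "N = Polynomial.degree r"
  \<comment> \<open>The relation \<open>d(\<tau>) * r(u) = 0\<close>, read as a polynomial in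
    \<open>\<tau>\<close> whose coefficients are polynomials in \<open>u\<close>.\<close>
  define Q where "Q = (\<Sum>j\<le>N. Polynomial.smult (u ^ j) (P j))"
  have "poly Q \<tau> = (\<Sum>j\<le>N. poly d \<tau> * (Polynomial.coeff r j * u ^ j))"
    unfolding Q_def poly_sum by (intro sum.cong) (auto simp: P(2)[symmetric] mult_ac)
  also have "\<dots> = poly d \<tau> * poly r u" by (simp add: poly_altdef N_def sum_distrib_left)
  also have "\<dots> = 0" using r by simp
  finally have Q\<tau>: "poly Q \<tau> = 0" .
  have "poly_over F' Q" unfolding Q_def
  proof (rule poly_over_sum[OF F'(1)])
    fix j show "poly_over F' (Polynomial.smult (u ^ j) (P j))"
      using P(1)[of j] F'(2) subfield_closed(9)[OF F'(1,3), of j]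
      by (auto simp: poly_over_def intro: subfield_closed(4)[OF F'(1)])
  qed
  moreover have "Q \<noteq> 0"
  proof
    assume Q0: "Q = 0"
    \<comment> \<open>If \<open>Q\<close> vanished, each of its coefficients would be a polynomial
      relation for \<open>u\<close> over \<open>k\<close>. One of these relations is nonzero,
      because \<open>P N\<close> comes from the leading coefficient of \<open>r\<close>.\<close>
    have "P N \<noteq> 0" using P(2)[of N] d(1) r(1) by (auto simp: N_def)
    then obtain i where i: "Polynomial.coeff (P N) i \<noteq> 0" by (auto simp: poly_eq_iff)
    define R where "R = (\<Sum>j\<le>N. Polynomial.monom (Polynomial.coeff (P j) i) j)"
    have "poly R u = Polynomial.coeff Q i"
      by (simp add: R_def Q_def poly_sum poly_monom coeff_sum mult.commute)
    then have "poly R u = 0" using Q0 by simp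
    moreover have "Polynomial.coeff R N = Polynomial.coeff (P N) i"
      by (simp add: R_def coeff_sum)
    then have "R \<noteq> 0" using i by auto
    moreover have "poly_over k R" unfolding R_def
      using P(1) by (intro poly_over_sum[OF k] poly_over_monom[OF k]) (auto simp: poly_over_def)
    ultimately show False using u(2) by (auto simp: alg_over_def)
  qed
  ultimately show ?thesis using Q\<tau> by (auto simp: alg_over_def)
qed

section \<open>The projective line and the embeddings of its function field\<close>

lemma mpoly_ring_cring: "cring (mpoly_ring n :: 'k::comm_ring_1 mpoly ring)"
proof (rule cringI)
  show "abelian_group (mpoly_ring n :: 'k mpoly ring)"
  proof (rule abelian_groupI)
    fix f :: "'k mpoly" assume "f \<in> carrier (mpoly_ring n)"
    then show "\<exists>g\<in>carrier (mpoly_ring n). g \<oplus>\<^bsub>mpoly_ring n\<^esub> f = \<zero>\<^bsub>mpoly_ring n\<^esub>"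
      by (intro bexI[of _ "- f"]) (auto simp: mpoly_ring_def mpoly_carrier_minus)
  qed (auto simp: mpoly_ring_def mpoly_carrier_add mpoly_carrier_0 algebra_simps)
  show "comm_monoid (mpoly_ring n :: 'k mpoly ring)"
    by (rule comm_monoidI) (auto simp: mpoly_ring_def mpoly_carrier_mult mpoly_carrier_1 algebra_simps)
qed (auto simp: mpoly_ring_def algebra_simps)

lemma projective_variety_line: "projective_variety (projective_line :: 'k::field projective)"
proof -
  interpret cring "mpoly_ring 1 :: 'k mpoly ring" by (rule mpoly_ring_cring)
  have "primeideal {0} (mpoly_ring 1 :: 'k mpoly ring)"
  proof (rule primeidealI)
    show "ideal {0} (mpoly_ring 1 :: 'k mpoly ring)" using zeroideal by (simp add: mpoly_ring_def)
    have "(1 :: 'k mpoly) \<noteq> 0" "(1 :: 'k mpoly) \<in> carrier (mpoly_ring 1)"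
      by (simp_all add: mpoly_ring_def mpoly_carrier_1)
    then show "carrier (mpoly_ring 1 :: 'k mpoly ring) \<noteq> {0}" by blast
  qed (auto simp: mpoly_ring_def intro: mpoly_ring_cring[unfolded mpoly_ring_def])
  moreover have "(Var 0 :: 'k mpoly) \<noteq> 0"
    by (simp add: Var_def) (metis lookup_single_eq lookup_zero zero_neq_one)
  ultimately show ?thesis
    by (auto simp: projective_variety_def projective_line_def hom_component_def)
qed

text \<open>The only equation is 0, so the Jacobian has rank 0, which is the codimension
  \<open>1 - 1\<close>.\<close>

lemma smooth_line: "smooth_curve (projective_line :: 'k::field projective)"
proof -
  interpret W: vector_space "\<lambda>(c::'k alg_closure) v (i::nat). c * v i" by (rule fun_vector_space)
  interpret coeff_hom "to_ac :: 'k \<Rightarrow> _" by (rule coeff_hom_to_ac)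
  have "W.dim {\<lambda>i. mpoly_eval to_ac (partial_deriv i f) a |f :: 'k mpoly. f \<in> {0}} = 0" for a
  proof -
    have "{\<lambda>i. mpoly_eval to_ac (partial_deriv i f) a |f :: 'k mpoly. f \<in> {0}} \<subseteq> W.span {}"
      by (auto simp: partial_deriv_def fun_eq_iff zero_fun_def)
    from W.dim_le_card[OF this] show ?thesis by simp
  qed
  then show ?thesis by (simp add: smooth_curve_def projective_line_def jacobian_rank_def)
qed

definition line_point :: "'l \<Rightarrow> nat \<Rightarrow> 'l::comm_ring_1" where
  "line_point \<tau> j = (if j = 0 then 1 else \<tau>)"

definition line_poly :: "('k \<Rightarrow> 'l) \<Rightarrow> 'k::comm_ring_1 mpoly \<Rightarrow> 'l::comm_ring_1 poly" where
  "line_poly \<phi> f = (\<Sum>m\<in>Poly_Mapping.keys f. Polynomial.monom (\<phi> (Poly_Mapping.lookup f m)) (Poly_Mapping.lookup m 1))"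

lemma mono_eval_line: "Poly_Mapping.keys m \<subseteq> {..1} \<Longrightarrow> mono_eval (line_point \<tau>) m = \<tau> ^ Poly_Mapping.lookup m 1"
  by (subst mono_eval_superset[of "{..1}"]) (auto simp: line_point_def numeral_2_eq_2 atMost_Suc)

lemma poly_line_poly: "f \<in> mpoly_carrier 1 \<Longrightarrow> poly (line_poly \<phi> f) \<tau> = mpoly_eval \<phi> f (line_point \<tau>)"
  unfolding line_poly_def poly_sum mpoly_eval_mono
  by (intro sum.cong) (auto simp: mono_eval_line mpoly_carrier_def poly_monom)

text \<open>In a form in two variables the exponent of one variable determines the monomial, so
  setting the other variable to 1 causes no cancellation.\<close>

lemma line_poly_nonzero:
  assumes "homogeneous 1 d f" "f \<noteq> 0" "\<And>c. \<phi> c = 0 \<Longrightarrow> c = 0"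
  shows "line_poly \<phi> f \<noteq> 0"
proof -
  obtain m where m: "m \<in> Poly_Mapping.keys f" using assms(2) by fastforce
  have eq: "m' = m" if m': "m' \<in> Poly_Mapping.keys f" "Poly_Mapping.lookup m' 1 = Poly_Mapping.lookup m 1" for m'
  proof -
    have keys: "Poly_Mapping.keys m \<subseteq> {..1}" "Poly_Mapping.keys m' \<subseteq> {..1}" "mdeg m = d" "mdeg m' = d"
      using assms(1) m m' by (auto simp: homogeneous_def mpoly_carrier_def)
    have "mdeg l = Poly_Mapping.lookup l 0 + Poly_Mapping.lookup l 1" if "Poly_Mapping.keys l \<subseteq> {..1}" for l
      by (subst mdeg_superset[OF _ that]) (auto simp: atMost_Suc)
    then have "Poly_Mapping.lookup m' 0 = Poly_Mapping.lookup m 0" using keys m'(2) by (metis add_right_cancel)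
    moreover have "Poly_Mapping.lookup l j = 0" if "j > 1" "Poly_Mapping.keys l \<subseteq> {..1}" for j and l :: monom
      using that by (metis atMost_iff in_keys_iff leD subsetD)
    ultimately show ?thesis using m'(2) keys
      by (intro poly_mapping_eqI) (metis One_nat_def less_one linorder_neqE_nat)
  qed
  have "Polynomial.coeff (line_poly \<phi> f) (Poly_Mapping.lookup m 1) =
    (\<Sum>m'\<in>Poly_Mapping.keys f. if m' = m then \<phi> (Poly_Mapping.lookup f m') else 0)"
    unfolding line_poly_def coeff_sum using eq by (intro sum.cong) auto
  also have "\<dots> = \<phi> (Poly_Mapping.lookup f m)" using m by simp
  also have "\<dots> \<noteq> 0" using m assms(3) by (auto simp: in_keys_iff)
  finally show ?thesis by auto
qed

text \<open>For transcendental \<open>\<tau>\<close>, the homomorphism that sends the affine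
  coordinate of the line to \<open>\<tau>\<close>. The chosen representative does not matter, by
  \<open>line_emb_frac\<close>.\<close>

definition line_emb :: "('k \<Rightarrow> 'l) \<Rightarrow> 'l \<Rightarrow> ('k::field mpoly \<times> 'k mpoly) set \<Rightarrow> 'l::field" where
  "line_emb \<phi> \<tau> A = (let (f, g) = SOME p. p \<in> A in
     mpoly_eval \<phi> f (line_point \<tau>) / mpoly_eval \<phi> g (line_point \<tau>))"

interpretation line: proj_variety projective_line
  by unfold_locales (rule projective_variety_line)

lemma line_simps [simp]: "ambient_dim projective_line = 1" "ideal_of projective_line = {0}"
  by (simp_all add: projective_line_def)

locale line_embedding = coeff_hom \<phi> for \<phi> :: "'k::field \<Rightarrow> 'l::field" +
  fixes \<tau> :: 'l
  assumes k: "subfield (range \<phi>) type_ring" and \<tau>: "\<not> alg_over (range \<phi>) \<tau>"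
begin

abbreviation "lev f \<equiv> mpoly_eval \<phi> f (line_point \<tau>)"

lemma \<phi>_eq_0: "\<phi> c = 0 \<Longrightarrow> c = 0"
  using hom_mult[of c "inverse c"] by (cases "c = 0") auto

lemma line_poly_over: "poly_over (range \<phi>) (line_poly \<phi> f)"
  unfolding line_poly_def by (intro poly_over_sum[OF k] poly_over_monom[OF k]) auto

lemma lev_nonzero: "homogeneous 1 d f \<Longrightarrow> f \<noteq> 0 \<Longrightarrow> lev f \<noteq> 0"
proof
  assume f: "homogeneous 1 d f" "f \<noteq> 0" "lev f = 0"
  then have "poly (line_poly \<phi> f) \<tau> = 0" by (simp add: poly_line_poly homogeneous_def)
  then show False using \<tau> line_poly_over line_poly_nonzero[OF f(1,2)] \<phi>_eq_0 by (auto simp: alg_over_def)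
qed

lemma line_emb_frac:
  assumes "(f, g) \<in> hom_fractions projective_line"
  shows "line_emb \<phi> \<tau> (frac_class projective_line f g) = lev f / lev g" "lev g \<noteq> 0"
proof -
  have nz: "lev g \<noteq> 0" if fg: "(f, g) \<in> hom_fractions projective_line" for f g
    using fg lev_nonzero[of _ g] by (auto simp: line.HF_iff)
  then show "lev g \<noteq> 0" using assms by blast
  let ?p = "SOME p. p \<in> frac_class projective_line f g"
  have "?p \<in> frac_class projective_line f g"
    by (rule someI) (rule line.mem_frac_class_self[OF assms])
  then obtain f' g' where p: "?p = (f', g')" "(f', g') \<in> hom_fractions projective_line" "f * g' - f' * g = 0"
    by (auto simp: frac_class_def)
  have "lev f * lev g' = lev f' * lev g"
    using arg_cong[OF p(3), of lev] by (simp add: eval_diff eval_mult)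
  then show "line_emb \<phi> \<tau> (frac_class projective_line f g) = lev f / lev g"
    using nz[OF assms] nz[OF p(2)] p(1) by (simp add: line_emb_def frac_eq_eq)
qed

lemma line_emb_hom: "line_emb \<phi> \<tau> \<in> ring_hom (function_field projective_line) type_ring"
proof (rule ring_hom_memI)
  fix A B assume "A \<in> carrier (function_field (projective_line :: 'k projective))" "B \<in> carrier (function_field (projective_line :: 'k projective))"
  then obtain f g f' g' where A: "A = frac_class projective_line f g" "(f, g) \<in> hom_fractions projective_line"
    and B: "B = frac_class projective_line f' g'" "(f', g') \<in> hom_fractions projective_line"
    by (metis line.carrierE)
  show "line_emb \<phi> \<tau> (A \<otimes>\<^bsub>function_field projective_line\<^esub> B) = line_emb \<phi> \<tau> A \<otimes>\<^bsub>type_ring\<^esub> line_emb \<phi> \<tau> B"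
    using line_emb_frac[OF line.HF_mult[OF A(2) B(2)]] line_emb_frac[OF A(2)] line_emb_frac[OF B(2)]
    by (simp add: A(1) B(1) line.K_mult[OF A(2) B(2)] eval_mult)
  show "line_emb \<phi> \<tau> (A \<oplus>\<^bsub>function_field projective_line\<^esub> B) = line_emb \<phi> \<tau> A \<oplus>\<^bsub>type_ring\<^esub> line_emb \<phi> \<tau> B"
    using line_emb_frac[OF line.HF_add[OF A(2) B(2)]] line_emb_frac[OF A(2)] line_emb_frac[OF B(2)]
    by (simp add: A(1) B(1) line.K_add[OF A(2) B(2)] eval_mult eval_add add_frac_eq)
next
  show "line_emb \<phi> \<tau> \<one>\<^bsub>function_field projective_line\<^esub> = \<one>\<^bsub>type_ring\<^esub>"
    using line_emb_frac[OF line.HF_1] by (simp add: line.K_one)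
qed simp

sublocale emb: emb_variety projective_line "line_emb \<phi> \<tau>"
  by unfold_locales (rule line_emb_hom)

lemma emb_\<kappa>: "emb.\<kappa> = \<phi>"
  using line_emb_frac[OF line.HF_Const] by (simp add: emb.\<kappa>_def fun_eq_iff)

lemma emb_\<tau>: "\<tau> \<in> emb.E"
proof -
  have HF: "(Var 1, Var 0) \<in> hom_fractions (projective_line :: 'k projective)"
  proof (rule line.HF_I)
    show "(Var 0 :: 'k mpoly) \<notin> ideal_of projective_line"
      by (simp add: Var_def) (metis lookup_single_eq lookup_zero zero_neq_one)
  qed (use homogeneous_Var in auto)
  have "line_emb \<phi> \<tau> (frac_class projective_line (Var 1) (Var 0)) = \<tau>"
    using line_emb_frac[OF HF] by (simp add: line_point_def)
  then show ?thesis using line.carrierI[OF HF] by (metis imageI)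
qed

lemma emb_E_quotient:
  assumes "b \<in> emb.E"
  shows "\<exists>p q. poly_over (range \<phi>) p \<and> poly_over (range \<phi>) q \<and> poly q \<tau> \<noteq> 0 \<and> b = poly p \<tau> / poly q \<tau>"
proof -
  obtain A where A: "A \<in> carrier (function_field projective_line)" "b = line_emb \<phi> \<tau> A" using assms by blast
  obtain f g where fg: "A = frac_class projective_line f g" "(f, g) \<in> hom_fractions projective_line"
    using line.carrierE[OF A(1)] by metis
  have "f \<in> mpoly_carrier 1" "g \<in> mpoly_carrier 1" using line.HF_D[OF fg(2)] by auto
  then show ?thesis using line_emb_frac[OF fg(2)] line_poly_over A(2) fg(1)
    by (intro exI[of _ "line_poly \<phi> f"] exI[of _ "line_poly \<phi> g"]) (simp add: poly_line_poly)
qed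

lemma emb_E_subset:
  assumes "subfield F type_ring" "range \<phi> \<subseteq> F" "\<tau> \<in> F"
  shows "emb.E \<subseteq> F"
proof
  fix b assume "b \<in> emb.E"
  from emb_E_quotient[OF this] obtain p q where "poly_over (range \<phi>) p" "poly_over (range \<phi>) q" "b = poly p \<tau> / poly q \<tau>"
    by blast
  moreover from this have "poly_over F p" "poly_over F q" using assms(2) by (auto simp: poly_over_def)
  ultimately show "b \<in> F" using poly_closed[OF assms(1) _ assms(3)] subfield_closed(8)[OF assms(1)] by blast
qed

end

section \<open>Transfer of sections\<close>

context proj_variety
begin

lemma point_valuation_local:
  assumes "point_valuation C x v" "A \<in> carrier K" "A \<noteq> \<zero>\<^bsub>K\<^esub>"
  shows "0 \<le> v A \<longleftrightarrow> A \<in> local_ring C x"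
  using assms by (auto simp: point_valuation_def)

lemma point_valuation_inverse:
  assumes v: "point_valuation C x v" and fg: "(f, g) \<in> HF" "f \<notin> I"
  shows "v (frac_class C g f) = - v (frac_class C f g)"
proof -
  have gf: "(g, f) \<in> HF" using HF_inverse fg by blast
  have nz: "frac_class C f g \<in> carrier K - {\<zero>\<^bsub>K\<^esub>}" "frac_class C g f \<in> carrier K - {\<zero>\<^bsub>K\<^esub>}"
    using fg gf frac_class_eq_0 carrierI HF_D by auto
  have "frac_class C f g \<otimes>\<^bsub>K\<^esub> frac_class C g f = \<one>\<^bsub>K\<^esub>"
    using frac_class_eqI[OF HF_mult[OF fg(1) gf] HF_1]
    by (simp add: K_mult[OF fg(1) gf] K_one mult.commute)
  moreover have mult: "v (A \<otimes>\<^bsub>K\<^esub> B) = v A + v B" if "A \<in> carrier K - {\<zero>\<^bsub>K\<^esub>}" "B \<in> carrier K - {\<zero>\<^bsub>K\<^esub>}" for A B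
    using v that by (simp add: point_valuation_def valuation_def)
  ultimately have "v \<one>\<^bsub>K\<^esub> = v (frac_class C f g) + v (frac_class C g f)" using mult[OF nz] by simp
  moreover have "v \<one>\<^bsub>K\<^esub> = 0"
  proof -
    interpret K: field K by (rule K_field)
    show ?thesis using mult[of "\<one>\<^bsub>K\<^esub>" "\<one>\<^bsub>K\<^esub>"] by simp
  qed
  ultimately show ?thesis by simp
qed

text \<open>Otherwise \<open>g / f\<close> would be regular at the point, say equal to
  \<open>f1 / g1\<close>. Then \<open>g * g1 - f1 * f\<close> lies in \<open>I\<close>, but its
  value at \<open>a\<close> is \<open>g(a) g1(a)\<close>, which is nonzero.\<close>

lemma point_valuation_pos:
  assumes I0: "\<And>f. f \<in> I \<Longrightarrow> mpoly_eval id f a = 0"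
    and v: "point_valuation C (proj_class a) v" and fg: "(f, g) \<in> HF" "f \<notin> I"
    and at: "mpoly_eval id f a = 0" "mpoly_eval id g a \<noteq> 0"
  shows "v (frac_class C f g) > 0"
proof (rule ccontr)
  assume "\<not> ?thesis"
  then have "0 \<le> v (frac_class C g f)" using point_valuation_inverse[OF v fg] by simp
  moreover have gf: "(g, f) \<in> HF" using HF_inverse fg by blast
  moreover have nz: "frac_class C g f \<noteq> \<zero>\<^bsub>K\<^esub>" using gf frac_class_eq_0 fg HF_D by auto
  ultimately have "frac_class C g f \<in> local_ring C (proj_class a)"
    using point_valuation_local[OF v carrierI] by blast
  then obtain f1 g1 where 1: "(f1, g1) \<in> HF" "frac_class C g f = frac_class C f1 g1" "mpoly_eval id g1 a \<noteq> 0"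
    using local_ring_iff[OF carrierI[OF gf]] by blast
  then have "g * g1 - f1 * f \<in> I" using frac_class_eq_iff gf by blast
  then have "mpoly_eval id (g * g1 - f1 * f) a = 0" by (rule I0)
  then show False using at 1(3)
    by (simp add: coeff_hom.eval_diff[OF coeff_hom_id] coeff_hom.eval_mult[OF coeff_hom_id])
qed

text \<open>\<open>A\<close> is a linear form that vanishes at \<open>x\<close> and not at
  \<open>x'\<close>, divided by \<open>Var i\<close>. As \<open>Var i\<close> may vanish at
  \<open>x'\<close>, it is the inverse \<open>B\<close> that is regular there.\<close>

lemma separate_points:
  assumes x: "x \<in> rational_points C" "x' \<in> rational_points C" "x \<noteq> x'"
    and v: "point_valuation C x v" "point_valuation C x' v'"
  obtains A B where "A \<in> carrier K" "A \<noteq> \<zero>\<^bsub>K\<^esub>" "B \<in> carrier K" "B \<noteq> \<zero>\<^bsub>K\<^esub>" "A \<otimes>\<^bsub>K\<^esub> B = \<one>\<^bsub>K\<^esub>"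
    "v A > 0" "v' B \<ge> 0"
proof -
  interpret id: coeff_hom "id :: 'k \<Rightarrow> 'k" by (rule coeff_hom_id)
  obtain a i where a: "i \<le> n" "a i = 1" "\<And>j. j > n \<Longrightarrow> a j = 0" "x = proj_class a"
    "\<And>f. f \<in> I \<Longrightarrow> mpoly_eval id f a = 0" using points_rep[OF x(1)] by metis
  obtain a' i' where a': "i' \<le> n" "a' i' = 1" "\<And>j. j > n \<Longrightarrow> a' j = 0" "x' = proj_class a'"
    "\<And>f. f \<in> I \<Longrightarrow> mpoly_eval id f a' = 0" using points_rep[OF x(2)] by metis
  \<comment> \<open>As \<open>a i = 1\<close>, proportional coordinate vectors could only differ by
    the factor \<open>a' i\<close>.\<close>
  have "\<exists>j. a' j \<noteq> a' i * a j"
  proof (rule ccontr)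
    assume "\<not> ?thesis"
    then have "\<And>j. a' j = a' i * a j" by blast
    then obtain b where b: "a' = (\<lambda>j. b * a j)" by blast
    then have "b \<noteq> 0" using a'(2) by auto
    then have "x' = x" using proj_class_cong[of b a] a(4) a'(4) b by simp
    then show False using x(3) by simp
  qed
  then obtain j where j: "a' j \<noteq> a' i * a j" by blast
  have jn: "j \<le> n"
  proof (rule ccontr)
    assume "\<not> ?thesis"
    then show False using j a(3)[of j] a'(3)[of j] by simp
  qed
  define f where "f = Var j - Const (a j) * Var i"
  have hf: "homogeneous n 1 f" unfolding f_def
    using homogeneous_mult[OF homogeneous_Const homogeneous_Var[OF a(1)], of "a j"] homogeneous_Var[OF jn]
    by (intro homogeneous_diff) auto
  have fa: "mpoly_eval id f a = 0" "mpoly_eval id f a' \<noteq> 0"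
    using a(2) j by (simp_all add: f_def id.eval_diff id.eval_mult mult.commute)
  have fI: "f \<notin> I" using fa(2) a'(5) by blast
  have VI: "Var i \<notin> I" using a(2,5) by fastforce
  have HF: "(f, Var i) \<in> HF" "(Var i, f) \<in> HF"
    using HF_I hf homogeneous_Var[OF a(1)] fI VI by blast+
  have "v (frac_class C f (Var i)) > 0"
    using point_valuation_pos[OF a(5) v(1)[unfolded a(4)] HF(1) fI fa(1)] a(2) by simp
  moreover have "frac_class C (Var i) f \<in> local_ring C x'"
    unfolding a'(4) local_ring_iff[OF carrierI[OF HF(2)]]
    by (intro exI[of _ "Var i"] exI[of _ f] conjI HF(2) refl fa)
  then have "v' (frac_class C (Var i) f) \<ge> 0"
    using point_valuation_local[OF v(2) carrierI[OF HF(2)]] frac_class_eq_0[OF HF(2)] VI by simp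
  moreover have "frac_class C f (Var i) \<otimes>\<^bsub>K\<^esub> frac_class C (Var i) f = \<one>\<^bsub>K\<^esub>"
    using frac_class_eqI[OF HF_mult[OF HF] HF_1] by (simp add: K_mult[OF HF] K_one mult.commute)
  ultimately show ?thesis
    using that[OF carrierI[OF HF(1)] _ carrierI[OF HF(2)]] frac_class_eq_0[OF HF(1)] frac_class_eq_0[OF HF(2)] fI VI
    by blast
qed

end

section \<open>Valuations and algebraic elements under an embedding\<close>

context emb_variety
begin

text \<open>A quotient \<open>f / g\<close> regular at the rational point has the constant
  \<open>f(a) / g(a)\<close> as its residue, and nonzero constants are units of the local ring.
  Normalization gives an element of value 1.\<close>

lemma point_valuation_centered:
  assumes x: "x \<in> rational_points C" and v: "point_valuation C x v" and w: "valuation type_ring w"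
    and restr: "\<forall>A\<in>carrier K - {\<zero>\<^bsub>K\<^esub>}. w (\<iota> A) = real_of_int (v A)"
  shows "centered_valuation C \<iota> w" "\<exists>b\<in>E. b \<noteq> 0 \<and> w b \<noteq> 0"
proof -
  note wv = bspec[OF restr]
  interpret id: coeff_hom "id :: 'k \<Rightarrow> 'k" by (rule coeff_hom_id)
  interpret field_valuation w by unfold_locales (rule w)
  obtain a i where a: "i \<le> n" "a i = 1" "x = proj_class a"
    "\<And>f. f \<in> I \<Longrightarrow> mpoly_eval id f a = 0" using points_rep[OF x] by metis
  obtain i0 where i0: "i0 \<le> n" "Var i0 \<notin> I" using chart_exists by blast
  show "centered_valuation C \<iota> w"
  proof unfold_locales
    fix c :: 'k assume c: "c \<noteq> 0"
    have nonneg: "w (\<kappa> c) \<ge> 0" if "c \<noteq> 0" for c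
    proof -
      have nz: "frac_class C (Const c) 1 \<noteq> \<zero>\<^bsub>K\<^esub>" using frac_class_eq_0[OF HF_Const] I_Const[OF that] by simp
      have "frac_class C (Const c) 1 \<in> local_ring C x"
        unfolding a(3) local_ring_iff[OF carrierI[OF HF_Const]]
        by (intro exI[of _ "Const c"] exI[of _ 1] conjI HF_Const refl) simp
      then have "v (frac_class C (Const c) 1) \<ge> 0"
        using point_valuation_local[OF v carrierI[OF HF_Const] nz] by simp
      then show ?thesis using wv[of "frac_class C (Const c) 1"] carrierI[OF HF_Const] nz by (simp add: \<kappa>_def)
    qed
    have "w (\<kappa> (inverse c)) = - w (\<kappa> c)" using w_inverse[of "\<kappa> c"] c by (simp add: \<kappa>_inverse)
    then show "w (\<kappa> c) = 0" using nonneg[of c] nonneg[of "inverse c"] c by simp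
  next
    fix b assume b: "b \<in> E" "b \<in> val_ring w"
    then obtain A where A: "A \<in> carrier K" "b = \<iota> A" by blast
    show "\<exists>c. b - \<kappa> c \<in> val_max w"
    proof (cases "A = \<zero>\<^bsub>K\<^esub>")
      case True
      then show ?thesis using A \<iota>_0 by (intro exI[of _ 0]) simp
    next
      case False
      then have "w b = real_of_int (v A)" "b \<noteq> 0" using wv A \<iota>_eq_0 by auto
      then have "0 \<le> v A" using b(2) by (auto simp: val_ring_def)
      then have "A \<in> local_ring C x" using point_valuation_local[OF v A(1) False] by simp
      then obtain f g where fg: "(f, g) \<in> HF" "A = frac_class C f g" "mpoly_eval id g a \<noteq> 0"
        using local_ring_iff[OF A(1)] a(3) by blast
      define c where "c = mpoly_eval id f a / mpoly_eval id g a"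
      define f' where "f' = f - Const c * g"
      obtain d where d: "homogeneous n d f" "homogeneous n d g" "g \<notin> I" using fg(1) by (auto simp: HF_iff)
      have "homogeneous n d (Const c * g)" using homogeneous_mult[OF homogeneous_Const d(2), of c] by simp
      then have HF': "(f', g) \<in> HF" unfolding f'_def using d by (intro HF_I[of d] homogeneous_diff)
      have f'a: "mpoly_eval id f' a = 0" using fg(3) by (simp add: f'_def c_def id.eval_diff id.eval_mult)
      have eq: "\<iota> (frac_class C f' g) = b - \<kappa> c"
        using \<iota>_frac_eval[OF i0 fg(1)] \<iota>_frac_eval[OF i0 HF'] A(2) fg(2)
        by (simp add: f'_def \<kappa>.eval_diff \<kappa>.eval_mult field_simps)
      show ?thesis
      proof (cases "f' \<in> I")
        case True
        then show ?thesis using eq \<iota>_frac_eq_0[OF HF'] by (intro exI[of _ c]) simp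
      next
        case False
        have "v (frac_class C f' g) > 0"
          by (rule point_valuation_pos[OF a(4) v[unfolded a(3)] HF' False f'a fg(3)])
        then have "w (b - \<kappa> c) > 0"
          using wv[of "frac_class C f' g"] eq carrierI[OF HF'] frac_class_eq_0[OF HF'] False by simp
        then show ?thesis by (auto simp: val_max_def)
      qed
    qed
  qed
  have "1 \<in> v ` (carrier K - {\<zero>\<^bsub>K\<^esub>})" using v by (simp add: point_valuation_def)
  then obtain A where "1 = v A" "A \<in> carrier K - {\<zero>\<^bsub>K\<^esub>}" by (rule imageE)
  then show "\<exists>b\<in>E. b \<noteq> 0 \<and> w b \<noteq> 0" using wv[of A] \<iota>_eq_0[of A] by (intro bexI[of _ "\<iota> A"]) auto
qed

text \<open>\<open>decomposition_groups\<close> asks for an extension of the normalized valuation.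
  Scaling \<open>w\<close> by \<open>c > 0\<close> provides it and leaves the stabilizer
  unchanged.\<close>

lemma decomposition_groupI:
  assumes w: "valuation type_ring w" and c: "c > 0" and v: "point_valuation C x v"
    and wv: "\<forall>A\<in>carrier K - {\<zero>\<^bsub>K\<^esub>}. c * w (\<iota> A) = real_of_int (v A)"
  shows "{\<sigma>\<in>carrier (G_X C \<iota>). \<forall>y. y \<noteq> 0 \<longrightarrow> w (\<sigma> y) = w y} \<in> decomposition_groups C \<iota> x"
proof -
  have "valuation type_ring (\<lambda>y. c * w y)"
    unfolding valuation_def
  proof (intro ballI conjI impI)
    fix a b :: 'l assume ab: "a \<in> carrier type_ring - {\<zero>\<^bsub>type_ring\<^esub>}" "b \<in> carrier type_ring - {\<zero>\<^bsub>type_ring\<^esub>}"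
    then show "c * w (a \<otimes>\<^bsub>type_ring\<^esub> b) = c * w a + c * w b"
      using w by (simp add: valuation_def distrib_left)
    assume "a \<oplus>\<^bsub>type_ring\<^esub> b \<noteq> \<zero>\<^bsub>type_ring\<^esub>"
    then have "c * min (w a) (w b) \<le> c * w (a \<oplus>\<^bsub>type_ring\<^esub> b)"
      using w ab c by (intro mult_left_mono) (auto simp: valuation_def)
    then show "min (c * w a) (c * w b) \<le> c * w (a \<oplus>\<^bsub>type_ring\<^esub> b)"
      using c by (simp add: min_mult_distrib_left)
  qed
  moreover have "{\<sigma>\<in>carrier (G_X C \<iota>). \<forall>y. y \<noteq> 0 \<longrightarrow> w (\<sigma> y) = w y} =
     {\<sigma>\<in>carrier (G_X C \<iota>). \<forall>y. y \<noteq> 0 \<longrightarrow> c * w (\<sigma> y) = c * w y}" using c by simp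
  ultimately show ?thesis unfolding decomposition_groups_def using v wv
    by (intro CollectI exI[of _ "\<lambda>y. c * w y"] conjI exI[of _ v]) auto
qed

lemma decomposition_groupE:
  assumes "D \<in> decomposition_groups C \<iota> x"
  obtains w v where "valuation type_ring w" "point_valuation C x v"
    "\<forall>A\<in>carrier K - {\<zero>\<^bsub>K\<^esub>}. w (\<iota> A) = real_of_int (v A)"
    "D = {\<sigma>\<in>carrier (G_X C \<iota>). \<forall>y. y \<noteq> 0 \<longrightarrow> w (\<sigma> y) = w y}"
  using assms unfolding decomposition_groups_def
proof (elim CollectE exE conjE)
  fix w v
  assume "D = {\<sigma>\<in>carrier (G_X C \<iota>). \<forall>y. y \<noteq> 0 \<longrightarrow> w (\<sigma> y) = w y}"
    "valuation type_ring w" "point_valuation C x v"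
    "\<forall>A\<in>carrier K - {\<zero>\<^bsub>K\<^esub>}. w (\<iota> A) = real_of_int (v A)"
  then show thesis by (intro that[of w v]) auto
qed

lemma constants_carrier: "A \<in> constants C \<Longrightarrow> A \<in> carrier K"
  by (auto simp: constants_def carrierI HF_Const)

lemma \<iota>_eval:
  assumes "set xs \<subseteq> carrier K" "x \<in> carrier K"
  shows "ring.eval K xs x \<in> carrier K \<and> \<iota> (ring.eval K xs x) = poly (Poly (rev (map \<iota> xs))) (\<iota> x)"
  using assms(1)
proof (induction xs)
  interpret K: field K by (rule K_field)
  case Nil
  then show ?case by (simp add: \<iota>_0)
next
  interpret K: field K by (rule K_field)
  case (Cons a xs)
  have pow: "\<iota> (x [^]\<^bsub>K\<^esub> (m::nat)) = \<iota> x ^ m" for m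
    by (induction m) (auto simp: \<iota>_1 \<iota>_mult assms(2))
  from Cons assms(2) show ?case
    by (simp add: \<iota>_add \<iota>_mult pow Poly_append poly_monom mult.commute)
qed

text \<open>Transcendence is injectivity of evaluation on coefficient lists over the constants. A
  relation over \<open>range \<kappa>\<close> pulls back to a nonempty list with the same value as
  the empty one.\<close>

lemma transcendental_\<iota>:
  assumes t: "t \<in> carrier K" and tr: "ring.transcendental K (constants C) t"
  shows "\<not> alg_over (range \<kappa>) (\<iota> t)"
proof
  interpret K: field K by (rule K_field)
  assume "alg_over (range \<kappa>) (\<iota> t)"
  then obtain p where p: "p \<noteq> 0" "poly_over (range \<kappa>) p" "poly p (\<iota> t) = 0" by (auto simp: alg_over_def)
  define g where "g b = (SOME A. A \<in> constants C \<and> \<iota> A = b)" for b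
  have g: "g b \<in> constants C \<and> \<iota> (g b) = b" if "b \<in> range \<kappa>" for b
  proof -
    have "\<exists>A. A \<in> constants C \<and> \<iota> A = b" using that unfolding range_\<kappa>[symmetric] by auto
    then show ?thesis unfolding g_def by (rule someI_ex)
  qed
  have sc: "b \<in> range \<kappa>" if "b \<in> set (coeffs p)" for b
  proof -
    have "b \<in> range (Polynomial.coeff p)" using that range_coeff[of p] by blast
    then show ?thesis using p(2) by (auto simp: poly_over_def)
  qed
  define xs where "xs = rev (map g (coeffs p))"
  have xs: "set xs \<subseteq> constants C" "map \<iota> xs = rev (coeffs p)" "xs \<noteq> []"
    using g sc p(1) by (auto simp: xs_def rev_map[symmetric] intro!: map_idI)
  have "\<iota> (hd xs) = Polynomial.lead_coeff p"
    using xs(2,3) p(1) by (metis hd_map hd_rev last_coeffs_eq_coeff_degree)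
  then have "hd xs \<noteq> \<zero>\<^bsub>K\<^esub>" using p(1) \<iota>_0 by auto
  then have "xs \<in> carrier (constants C [X]\<^bsub>K\<^esub>)" using xs by (simp add: univ_poly_def polynomial_def)
  moreover have "[] \<in> carrier (constants C [X]\<^bsub>K\<^esub>)" by (simp add: univ_poly_def polynomial_def)
  moreover have "K.eval xs t \<in> carrier K \<and> \<iota> (K.eval xs t) = 0"
    using \<iota>_eval[OF _ t, of xs] xs p(3) constants_carrier by auto
  then have "K.eval xs t = K.eval [] t" using \<iota>_eq_0[of "K.eval xs t"] by simp
  ultimately show False using tr xs(3) unfolding K.transcendental_def inj_on_def by blast
qed

lemma algebraic_\<iota>:
  assumes G: "subfield G K" and y: "y \<in> carrier K" and alg: "ring.algebraic K G y"
  shows "alg_over (\<iota> ` G) (\<iota> y)"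
proof -
  interpret K: field K by (rule K_field)
  have GK: "G \<subseteq> carrier K" using subfieldE(3)[OF G] .
  obtain p where p: "p \<in> carrier (G [X]\<^bsub>K\<^esub>)" "p \<noteq> []" "K.eval p y = \<zero>\<^bsub>K\<^esub>"
    using K.algebraicE[OF subfieldE(1)[OF G] y] alg by (auto simp: over_def)
  have sp: "set p \<subseteq> G" "hd p \<noteq> \<zero>\<^bsub>K\<^esub>" using p(1,2) by (auto simp: univ_poly_def polynomial_def)
  define q where "q = Poly (rev (map \<iota> p))"
  have "\<iota> (hd p) \<noteq> 0" using sp p(2) GK \<iota>_eq_0 hd_in_set by blast
  have "q \<noteq> 0"
  proof
    assume "q = 0"
    then have "Polynomial.coeff q (length p - 1) = 0" by simp
    then show False using p(2) \<open>\<iota> (hd p) \<noteq> 0\<close>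
      by (simp add: q_def nth_default_def rev_nth hd_conv_nth split: if_splits)
  qed
  have "0 \<in> \<iota> ` G" using \<iota>_0 subringE(2)[OF subfieldE(1)[OF G]] by force
  have "poly_over (\<iota> ` G) q" unfolding poly_over_def
  proof
    fix i
    have "rev (map \<iota> p) ! i \<in> \<iota> ` G" if "i < length (rev (map \<iota> p))"
      using nth_mem[OF that] sp(1) by auto
    then show "Polynomial.coeff q i \<in> \<iota> ` G" using \<open>0 \<in> \<iota> ` G\<close>
      unfolding q_def coeff_Poly_eq nth_default_def by simp
  qed
  moreover have "poly q (\<iota> y) = 0"
    using \<iota>_eval[OF _ y, of p] sp(1) GK p(3) \<iota>_0 by (auto simp: q_def)
  ultimately show ?thesis using \<open>q \<noteq> 0\<close> by (auto simp: alg_over_def)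
qed

lemma generate_field_\<iota>:
  assumes F: "subfield F type_ring" "range \<kappa> \<subseteq> F" and t: "t \<in> carrier K" "\<iota> t \<in> F"
  shows "\<iota> ` generate_field K (insert t (constants C)) \<subseteq> F"
proof -
  interpret K: field K by (rule K_field)
  have H: "insert t (constants C) \<subseteq> carrier K" using t constants_carrier by auto
  have "\<iota> b \<in> F" if "b \<in> generate_field K (insert t (constants C))" for b
    using that
  proof (induction rule: generate_field.induct)
    case one
    then show ?case using \<iota>_1 subfield_closed(1)[OF F(1)] by simp
  next
    case (incl b)
    then show ?case using t F(2) range_\<kappa> by blast
  next
    case (a_inv b)
    then show ?case using \<iota>_a_inv subfield_closed(5)[OF F(1)] K.generate_field_in_carrier[OF H] by simp
  next
    case (m_inv b)
    then show ?case using \<iota>_m_inv subfield_closed(6)[OF F(1)] K.generate_field_in_carrier[OF H] by simp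
  next
    case (eng_add b c)
    then show ?case using \<iota>_add subfield_closed(3)[OF F(1)] K.generate_field_in_carrier[OF H] by simp
  next
    case (eng_mult b c)
    then show ?case using \<iota>_mult subfield_closed(4)[OF F(1)] K.generate_field_in_carrier[OF H] by simp
  qed
  then show ?thesis by blast
qed

text \<open>One-dimensionality provides a single transcendental element \<open>t\<close>. As
  \<open>u\<close> is algebraic over k(t), the exchange argument makes \<open>\<iota> t\<close>
  algebraic over k(u); then \<open>E\<close> and finally the whole field follow by
  transitivity.\<close>

lemma alg_over_line:
  assumes dim: "one_dimensional C" and u: "u \<in> E" "\<not> alg_over (range \<kappa>) u"
    and ext: "\<And>y. alg_over E y"
  shows "alg_over (line_emb \<kappa> u ` carrier (function_field projective_line)) y"
proof -
  interpret K: field K by (rule K_field)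
  obtain t where t: "t \<in> carrier K" "ring.transcendental K (constants C) t"
    "\<And>y. y \<in> carrier K \<Longrightarrow> ring.algebraic K (generate_field K (insert t (constants C))) y"
    using dim by (auto simp: one_dimensional_def)
  let ?G = "generate_field K (insert t (constants C))"
  have G: "subfield ?G K" by (rule K.generate_field_is_subfield) (use t constants_carrier in auto)
  have tr: "\<not> alg_over (range \<kappa>) (\<iota> t)" by (rule transcendental_\<iota>[OF t(1,2)])
  interpret lt: line_embedding \<kappa> "\<iota> t" by (intro line_embedding.intro line_embedding_axioms.intro \<kappa>_hom subfield_\<kappa> tr)
  interpret lu: line_embedding \<kappa> u by (intro line_embedding.intro line_embedding_axioms.intro \<kappa>_hom subfield_\<kappa> u(2))
  have G_alg: "alg_over (\<iota> ` ?G) b" if "b \<in> E" for b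
    using that algebraic_\<iota>[OF G _ t(3)] by blast
  have lt: "\<iota> ` ?G \<subseteq> lt.emb.E"
    using lt.emb.range_\<kappa>_subset lt.emb_\<tau>
    by (intro generate_field_\<iota>[OF lt.emb.subfield_E _ t(1)]) (auto simp: lt.emb_\<kappa>)
  have "alg_over lt.emb.E u" using alg_over_mono[OF lt G_alg[OF u(1)]] .
  then have \<tau>: "alg_over lu.emb.E (\<iota> t)"
    using alg_over_exchange[OF subfield_\<kappa> lu.emb.subfield_E _ lu.emb_\<tau> lt.emb_E_quotient _ u(2)]
      lu.emb.range_\<kappa>_subset by (simp add: lu.emb_\<kappa>)
  define A where "A = {y. alg_over lu.emb.E y}"
  have A: "subfield A type_ring" unfolding A_def by (rule subfield_alg_over[OF lu.emb.subfield_E])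
  have "range \<kappa> \<subseteq> A" unfolding A_def
    using lu.emb.range_\<kappa>_subset alg_over_self[OF lu.emb.subfield_E] by (auto simp: lu.emb_\<kappa>)
  then have GA: "\<iota> ` ?G \<subseteq> A" using \<tau> by (intro generate_field_\<iota>[OF A _ t(1)]) (auto simp: A_def)
  have closed: "b \<in> A" if "alg_over A b" for b
    using alg_over_trans[OF lu.emb.subfield_E, of b] that by (simp add: A_def)
  have "E \<subseteq> A" using closed alg_over_mono[OF GA G_alg] by blast
  then have "y \<in> A" using closed alg_over_mono[OF _ ext] by blast
  then show ?thesis by (simp add: A_def)
qed

lemma separable_closure_alg_over:
  assumes "algebraic_closure type_ring E"
  shows "alg_over E y"
proof -
  interpret ac: algebraic_closure type_ring E by (rule assms)
  show ?thesis using ac.algebraic_extension[of y] algebraic_iff_alg_over[OF subfield_E] by (simp add: over_def)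
qed

text \<open>Polynomials over \<open>F\<close> are polynomials over the whole field, where they
  split; what an algebraic closure of \<open>F\<close> requires beyond that is the assumption
  \<open>alg\<close>.\<close>

lemma algebraic_closure_subfield:
  fixes F :: "'l set"
  assumes ac: "algebraic_closure type_ring E" and F: "subfield F type_ring" and alg: "\<And>y. alg_over F y"
  shows "algebraic_closure type_ring F"
proof -
  interpret ac: algebraic_closure type_ring E by (rule assms)
  have alg': "(ac.algebraic over F) y" for y using alg[of y] algebraic_iff_alg_over[OF F] by (simp add: over_def)
  have split: "ac.splitted P" if "P \<in> carrier (F [X]\<^bsub>type_ring\<^esub>)" for P
  proof -
    have "P \<in> carrier (UNIV [X]\<^bsub>type_ring\<^esub>)" using that by (auto simp: univ_poly_def polynomial_def)
    then show ?thesis using ac.roots_over_carrier by simp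
  qed
  show ?thesis unfolding algebraic_closure_def algebraic_closure_axioms_def
    using F alg' split ac.field_axioms by simp
qed

lemma separable_closure_line:
  assumes "algebraic_closure type_ring E" "one_dimensional C" "u \<in> E" "\<not> alg_over (range \<kappa>) u"
  shows "algebraic_closure type_ring (line_emb \<kappa> u ` carrier (function_field projective_line))"
proof -
  interpret lu: line_embedding \<kappa> u by (intro line_embedding.intro line_embedding_axioms.intro \<kappa>_hom subfield_\<kappa> assms(4))
  show ?thesis
    by (rule algebraic_closure_subfield[OF assms(1) lu.emb.subfield_E
          alg_over_line[OF assms(2-4) separable_closure_alg_over[OF assms(1)]]])
qed

lemma base_closure_alg_over: "base_closure C \<iota> = {y. alg_over (range \<kappa>) y}"
  unfolding base_closure_def range_\<kappa> using algebraic_iff_alg_over[OF subfield_\<kappa>] by simp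

end

section \<open>Galois groups over a smaller base field, and transfer of sections\<close>

lemma carrier_Gal_UNIV:
  "\<sigma> \<in> carrier (Gal UNIV F) \<Longrightarrow> \<sigma> (x + y) = \<sigma> x + \<sigma> y \<and> \<sigma> (x * y) = \<sigma> x * \<sigma> y"
  "\<sigma> \<in> carrier (Gal UNIV F) \<Longrightarrow> x \<in> F \<Longrightarrow> \<sigma> x = x"
  by (auto simp: Gal_def)

lemma Gal_antimono: "F' \<subseteq> F \<Longrightarrow> carrier (Gal E F) \<subseteq> carrier (Gal E F')"
  by (auto simp: Gal_def)

lemma topspace_krull: "topspace (krull_topology E F) = carrier (Gal E F)"
  unfolding krull_topology_def topology_generated_by_topspace by blast

lemma krull_continuous_antimono:
  assumes cont: "continuous_map T (krull_topology E F) s" and F: "F' \<subseteq> F"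
  shows "continuous_map T (krull_topology E F') s"
proof -
  have s: "s g \<in> carrier (Gal E F)" if "g \<in> topspace T" for g
    using continuous_map_image_subset_topspace[OF cont] that by (auto simp: topspace_krull)
  show ?thesis unfolding krull_topology_def continuous_on_generated_topo_iff
  proof (intro conjI allI impI)
    fix U assume "U \<in> {{\<tau>\<in>carrier (Gal E F'). \<forall>x\<in>S. \<tau> x = \<sigma> x} |\<sigma> S. \<sigma> \<in> carrier (Gal E F') \<and> finite S \<and> S \<subseteq> E}"
    then obtain \<sigma> S where U: "U = {\<tau>\<in>carrier (Gal E F'). \<forall>x\<in>S. \<tau> x = \<sigma> x}" "finite S" "S \<subseteq> E" by blast
    show "openin T (s -` U \<inter> topspace T)"
    proof (cases "s -` U \<inter> topspace T = {}")
      case False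
      then obtain g where g: "g \<in> topspace T" "s g \<in> U" by blast
      \<comment> \<open>A basic open set that meets the image of \<open>s\<close> can be recentred
        at \<open>s g\<close>, which fixes \<open>F\<close>, whereas its original centre is only
        known to fix \<open>F'\<close>.\<close>
      define V where "V = {\<tau>\<in>carrier (Gal E F). \<forall>x\<in>S. \<tau> x = s g x}"
      have "openin (krull_topology E F) V" unfolding krull_topology_def V_def
        by (rule topology_generated_by_Basis) (use s[OF g(1)] U in blast)
      from openin_continuous_map_preimage[OF cont this]
      have "openin T {x \<in> topspace T. s x \<in> V}" .
      also have "{x \<in> topspace T. s x \<in> V} = s -` U \<inter> topspace T"
        using s g Gal_antimono[OF F, of E] by (auto simp: V_def U(1))
      finally show ?thesis .
    qed simp
  next
    show "s ` topspace T \<subseteq> \<Union>{{\<tau>\<in>carrier (Gal E F'). \<forall>x\<in>S. \<tau> x = \<sigma> x} |\<sigma> S. \<sigma> \<in> carrier (Gal E F') \<and> finite S \<and> S \<subseteq> E}"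
      using s Gal_antimono[OF F, of E] by blast
  qed
qed

text \<open>\<open>base_closure\<close> depends only on the embedded constants, so
  \<open>G_k\<close> with its topology is literally the same; the target group becomes
  larger.\<close>

lemma section_transfer:
  assumes s: "is_section C \<iota> s" and const: "\<iota>' ` constants C' = \<iota> ` constants C"
    and sub: "\<iota>' ` carrier (function_field C') \<subseteq> \<iota> ` carrier (function_field C)"
  shows "is_section C' \<iota>' s"
proof -
  have base: "base_closure C' \<iota>' = base_closure C \<iota>" by (simp add: base_closure_def const)
  have "s \<in> hom (G_k C \<iota>) (G_X C' \<iota>')"
  proof (rule homI)
    have sh: "s \<in> hom (G_k C \<iota>) (G_X C \<iota>)" using s by (simp add: is_section_def)
    show "s g \<in> carrier (G_X C' \<iota>')" if "g \<in> carrier (G_k C \<iota>)" for g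
      using hom_in_carrier[OF sh that] Gal_antimono[OF sub, of UNIV] by blast
    show "s (g \<otimes>\<^bsub>G_k C \<iota>\<^esub> g') = s g \<otimes>\<^bsub>G_X C' \<iota>'\<^esub> s g'"
      if "g \<in> carrier (G_k C \<iota>)" "g' \<in> carrier (G_k C \<iota>)" for g g'
      using hom_mult[OF sh that] by (simp add: Gal_def)
  qed
  moreover have "continuous_map (krull_topology (base_closure C \<iota>) (\<iota> ` constants C))
       (krull_topology UNIV (\<iota>' ` carrier (function_field C'))) s"
    by (rule krull_continuous_antimono[OF _ sub]) (use s in \<open>simp add: is_section_def\<close>)
  ultimately show ?thesis using s by (simp add: is_section_def base const pr_X_def)
qed

section \<open>Existence and uniqueness of the point of a section\<close>

locale birational_section = emb_variety C \<iota>
  for C :: "'k::field_char_0 projective" and \<iota> :: "('k mpoly \<times> 'k mpoly) set \<Rightarrow> 'k sep_field" +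
  fixes s
  assumes smooth: "smooth_curve C" and dim: "one_dimensional C"
    and sep: "algebraic_closure type_ring E" and s: "is_section C \<iota> s"
    and line: "BGASC (projective_line :: 'k projective)"
begin

lemma s_G_X: "g \<in> carrier (G_k C \<iota>) \<Longrightarrow> s g \<in> carrier (G_X C \<iota>)"
  using s by (auto simp: is_section_def hom_def)

lemma s_lift: "g \<in> carrier (G_k C \<iota>) \<Longrightarrow> alg_over (range \<kappa>) c \<Longrightarrow> s g c = g c"
  using s unfolding is_section_def pr_X_def base_closure_alg_over by (metis mem_Collect_eq restrict_apply')

text \<open>By \<open>Gal_exists_moving\<close> some \<open>g\<close> moves any algebraic element
  outside k. Characteristic 0 passes to the big field through \<open>\<kappa>\<close>.\<close>

lemma fixed_constants:
  assumes c: "alg_over (range \<kappa>) c" and fixed: "\<And>g. g \<in> carrier (G_k C \<iota>) \<Longrightarrow> g c = c"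
  shows "c \<in> range \<kappa>"
proof (rule ccontr)
  assume "c \<notin> range \<kappa>"
  moreover have "of_nat m \<noteq> (0 :: 'k sep_field)" if "m > 0" for m
    using \<kappa>_eq_0[of "of_nat m"] that unfolding \<kappa>.hom_of_nat by simp
  ultimately obtain g where "g \<in> carrier (Gal {y. alg_over (range \<kappa>) y} (range \<kappa>))" "g c \<noteq> c"
    using Gal_exists_moving[OF subfield_\<kappa> c] by blast
  then show False using fixed by (simp add: base_closure_alg_over range_\<kappa>)
qed

context
  fixes u assumes u: "u \<in> E" "\<not> alg_over (range \<kappa>) u"
begin

interpretation lu: line_embedding \<kappa> u by (intro line_embedding.intro line_embedding_axioms.intro \<kappa>_hom subfield_\<kappa> u(2))

lemma line_const: "line_emb \<kappa> u ` constants projective_line = \<iota> ` constants C"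
  by (simp add: lu.emb.range_\<kappa> lu.emb_\<kappa> range_\<kappa>)

lemma line_subset: "line_emb \<kappa> u ` carrier (function_field projective_line) \<subseteq> E"
  by (rule lu.emb_E_subset[OF subfield_E range_\<kappa>_subset u(1)])

lemma line_G_k: "G_k projective_line (line_emb \<kappa> u) = G_k C \<iota>"
  by (simp add: base_closure_def line_const)

text \<open>The function field of the line is embedded so that its coordinate becomes
  \<open>u\<close>; the big field is again its separable closure, and the hypothesis on the line
  applies to \<open>s\<close> itself.\<close>

lemma line_center:
  "\<exists>!x. x \<in> rational_points (projective_line :: 'k projective) \<and>
    (\<exists>D\<in>decomposition_groups projective_line (line_emb \<kappa> u) x. s ` carrier (G_k C \<iota>) \<subseteq> D)"
proof -
  have closure: "separable_closure projective_line (line_emb \<kappa> u)"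
    unfolding separable_closure_def
    using lu.line_emb_hom separable_closure_line[OF sep dim u] by blast
  have "is_section projective_line (line_emb \<kappa> u) s"
    by (rule section_transfer[OF s line_const line_subset])
  from line[unfolded BGASC_def, THEN spec, THEN mp, OF closure, THEN spec, THEN mp, OF this]
  show ?thesis unfolding line_G_k .
qed

lemma line_alg_over: "alg_over (line_emb \<kappa> u ` carrier (function_field projective_line)) y"
  by (rule alg_over_line[OF dim u separable_closure_alg_over[OF sep]])

text \<open>This moves a valuation from the curve to the line, as uniqueness requires. Triviality on
  k and the residue field k are inherited by the subfield k(u); the valuation is nontrivial there
  because the whole field is algebraic over k(u).\<close>

lemma line_center_of_valuation:
  assumes w: "centered_valuation C \<iota> w" and inv: "\<And>g y. g \<in> carrier (G_k C \<iota>) \<Longrightarrow> y \<noteq> 0 \<Longrightarrow> w (s g y) = w y"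
    and nontriv: "\<exists>b\<in>E. b \<noteq> 0 \<and> w b \<noteq> 0"
  shows "\<exists>x v c. x \<in> rational_points projective_line \<and> c > 0 \<and> point_valuation projective_line x v \<and>
    (\<forall>A\<in>carrier (function_field projective_line) - {\<zero>\<^bsub>function_field projective_line\<^esub>}. c * w (line_emb \<kappa> u A) = real_of_int (v A)) \<and>
    (\<exists>D\<in>decomposition_groups projective_line (line_emb \<kappa> u) x. s ` carrier (G_k C \<iota>) \<subseteq> D)"
proof -
  interpret w: centered_valuation C \<iota> w by (rule w)
  interpret lw: centered_valuation projective_line "line_emb \<kappa> u" w
    by unfold_locales (use w.triv w.res line_subset in \<open>auto simp: lu.emb_\<kappa>\<close>)
  have "\<exists>b\<in>lu.emb.E. b \<noteq> 0 \<and> w b \<noteq> 0"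
  proof (rule ccontr)
    assume "\<not> ?thesis"
    then have "w b = 0" if "b \<noteq> 0" for b
      using w.alg_over_trivial[OF _ subfield_closed(2)[OF lu.emb.subfield_E] line_alg_over that] by blast
    then show False using nontriv by blast
  qed
  from lw.valuation_center[OF smooth_line this] obtain x v c where *: "x \<in> rational_points (projective_line :: 'k projective)" "c > 0"
    "point_valuation projective_line x v"
    "\<forall>A\<in>carrier (function_field projective_line) - {\<zero>\<^bsub>function_field projective_line\<^esub>}. c * w (line_emb \<kappa> u A) = real_of_int (v A)"
    by blast
  have "s ` carrier (G_k C \<iota>) \<subseteq> {\<sigma>\<in>carrier (G_X projective_line (line_emb \<kappa> u)). \<forall>y. y \<noteq> 0 \<longrightarrow> w (\<sigma> y) = w y}"
    using s_G_X Gal_antimono[OF line_subset, of UNIV] inv by blast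
  then show ?thesis using * lu.emb.decomposition_groupI[OF w.valuation *(2-4)] by blast
qed

end

lemma center_exists:
  "\<exists>x\<in>rational_points C. \<exists>D\<in>decomposition_groups C \<iota> x. s ` carrier (G_k C \<iota>) \<subseteq> D"
proof -
  obtain t where t: "t \<in> carrier K" "ring.transcendental K (constants C) t"
    using dim by (auto simp: one_dimensional_def)
  define u where "u = \<iota> t"
  have u: "u \<in> E" "\<not> alg_over (range \<kappa>) u" using t transcendental_\<iota>[OF t] by (auto simp: u_def)
  interpret lu: line_embedding \<kappa> u by (intro line_embedding.intro line_embedding_axioms.intro \<kappa>_hom subfield_\<kappa> u(2))
  obtain x D where x: "x \<in> rational_points (projective_line :: 'k projective)"
    "D \<in> decomposition_groups projective_line (line_emb \<kappa> u) x" "s ` carrier (G_k C \<iota>) \<subseteq> D"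
    using line_center[OF u] by blast
  from lu.emb.decomposition_groupE[OF x(2)]
  obtain w v where w: "valuation type_ring w" "point_valuation projective_line x v"
    "\<forall>A\<in>carrier (function_field projective_line) - {\<zero>\<^bsub>function_field projective_line\<^esub>}. w (line_emb \<kappa> u A) = real_of_int (v A)"
    and D: "D = {\<sigma>\<in>carrier (G_X projective_line (line_emb \<kappa> u)). \<forall>y. y \<noteq> 0 \<longrightarrow> w (\<sigma> y) = w y}"
    .
  have inv: "w (s g y) = w y" if "g \<in> carrier (G_k C \<iota>)" "y \<noteq> 0" for g y
    using x(3) D that by blast
  interpret lw: centered_valuation projective_line "line_emb \<kappa> u" w
    by (rule lu.emb.point_valuation_centered(1)[OF x(1) w(2,1,3)])
  have lw_nontriv: "\<exists>b\<in>lu.emb.E. b \<noteq> 0 \<and> w b \<noteq> 0"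
    by (rule lu.emb.point_valuation_centered(2)[OF x(1) w(2,1,3)])
  have triv: "w c = 0" if "c \<in> range \<kappa>" "c \<noteq> 0" for c
    using that lw.triv by (auto simp: lu.emb_\<kappa>)
  have triv_alg: "w c = 0" if "alg_over (range \<kappa>) c" "c \<noteq> 0" for c
    using lw.alg_over_trivial[OF triv subfield_closed(2)[OF subfield_\<kappa>] that] .
  interpret w: centered_valuation C \<iota> w
  proof unfold_locales
    show "w (\<kappa> c) = 0" if "c \<noteq> 0" for c using triv[of "\<kappa> c"] that by simp
    fix b assume b: "b \<in> E" "b \<in> val_ring w"
    \<comment> \<open>The residue field on k(u) is k, as the centre on the line is a rational point.
      Since \<open>b\<close> is algebraic over k(u), it has a residue algebraic over k.\<close>
    have "\<exists>c. alg_over (range \<kappa>) c \<and> b - c \<in> val_max w"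
    proof (rule residue_alg_over[OF lw.field_valuation_axioms subfield_\<kappa> _ triv lu.emb.subfield_E _ line_alg_over[OF u] b(2)])
      show "range \<kappa> \<subseteq> lu.emb.E" using lu.emb.range_\<kappa>_subset by (simp add: lu.emb_\<kappa>)
      show "\<exists>c\<in>range \<kappa>. a - c \<in> val_max w" if "a \<in> lu.emb.E" "a \<in> val_ring w" for a
        using lw.res[OF that] by (auto simp: lu.emb_\<kappa>)
    qed
    then obtain c where c: "alg_over (range \<kappa>) c" "b - c \<in> val_max w" by blast
    have "g c = c" if g: "g \<in> carrier (G_k C \<iota>)" for g
    proof (rule ccontr)
      assume ne: "g c \<noteq> c"
      have "s g b = s g (b - c) + s g c" using carrier_Gal_UNIV(1)[OF s_G_X[OF g], of "b - c" c] by simp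
      moreover have "s g b = b" using carrier_Gal_UNIV(2)[OF s_G_X[OF g] b(1)] .
      ultimately have eq: "s g (b - c) = b - g c" using s_lift[OF g c(1)] by (simp add: algebra_simps)
      have "b - g c \<in> val_max w"
      proof (cases "b - c = 0")
        case True
        have "s g 0 = s g 0 + s g 0"
          using conjunct1[OF carrier_Gal_UNIV(1)[OF s_G_X[OF g], of 0 0]] by (simp only: add_0)
        then have "s g 0 = 0" by (simp only: add_cancel_right_right)
        then show ?thesis using eq True by simp
      next
        case False
        then show ?thesis using inv[OF g False] c(2) eq by (auto simp: val_max_def)
      qed
      then have "(b - g c) - (b - c) \<in> val_max w" using c(2) by (rule lw.val_max_diff)
      \<comment> \<open>Two elements algebraic over k with the same residue are equal, because
        \<open>w\<close> is 0 on their difference unless that difference vanishes.\<close>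
      then have m: "c - g c \<in> val_max w" by simp
      have "g c \<in> base_closure C \<iota>"
        using g c(1) unfolding base_closure_alg_over by (auto simp: Gal_def BijGroup_def Bij_def bij_betw_def)
      then have "alg_over (range \<kappa>) (c - g c)"
        using subfield_closed(7)[OF subfield_alg_over[OF subfield_\<kappa>], of c "g c"] c(1)
        by (simp add: base_closure_alg_over)
      then have "w (c - g c) = 0" using ne by (intro triv_alg) auto
      then show False using m ne by (simp add: val_max_def)
    qed
    then show "\<exists>c. b - \<kappa> c \<in> val_max w" using fixed_constants[OF c(1)] c(2) by blast
  qed
  have "\<exists>b\<in>E. b \<noteq> 0 \<and> w b \<noteq> 0" using lw_nontriv line_subset[OF u] by blast
  from w.valuation_center[OF smooth this] obtain y v' c where y: "y \<in> rational_points C" "c > 0"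
    "point_valuation C y v'" "\<forall>A\<in>carrier K - {\<zero>\<^bsub>K\<^esub>}. c * w (\<iota> A) = real_of_int (v' A)" by blast
  have "s ` carrier (G_k C \<iota>) \<subseteq> {\<sigma>\<in>carrier (G_X C \<iota>). \<forall>y. y \<noteq> 0 \<longrightarrow> w (\<sigma> y) = w y}"
    using s_G_X inv by blast
  then show ?thesis using y(1) decomposition_groupI[OF w(1) y(2-4)] by blast
qed

lemma center_unique:
  assumes x: "x \<in> rational_points C" "D \<in> decomposition_groups C \<iota> x" "s ` carrier (G_k C \<iota>) \<subseteq> D"
    and x': "x' \<in> rational_points C" "D' \<in> decomposition_groups C \<iota> x'" "s ` carrier (G_k C \<iota>) \<subseteq> D'"
  shows "x = x'"
proof (rule ccontr)
  assume ne: "x \<noteq> x'"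
  obtain w v where w: "valuation type_ring w" "point_valuation C x v"
    "\<forall>A\<in>carrier K - {\<zero>\<^bsub>K\<^esub>}. w (\<iota> A) = real_of_int (v A)"
    and D: "D = {\<sigma>\<in>carrier (G_X C \<iota>). \<forall>y. y \<noteq> 0 \<longrightarrow> w (\<sigma> y) = w y}"
    using decomposition_groupE[OF x(2)] .
  obtain w' v' where w': "valuation type_ring w'" "point_valuation C x' v'"
    "\<forall>A\<in>carrier K - {\<zero>\<^bsub>K\<^esub>}. w' (\<iota> A) = real_of_int (v' A)"
    and D': "D' = {\<sigma>\<in>carrier (G_X C \<iota>). \<forall>y. y \<noteq> 0 \<longrightarrow> w' (\<sigma> y) = w' y}"
    using decomposition_groupE[OF x'(2)] .
  note cw = point_valuation_centered[OF x(1) w(2,1,3)]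
  note cw' = point_valuation_centered[OF x'(1) w'(2,1,3)]
  have inv: "w (s g y) = w y" "w' (s g y) = w' y" if "g \<in> carrier (G_k C \<iota>)" "y \<noteq> 0" for g y
    using x(3) x'(3) D D' that by blast+
  obtain A B where AB: "A \<in> carrier K" "A \<noteq> \<zero>\<^bsub>K\<^esub>" "B \<in> carrier K" "B \<noteq> \<zero>\<^bsub>K\<^esub>" "A \<otimes>\<^bsub>K\<^esub> B = \<one>\<^bsub>K\<^esub>"
    "v A > 0" "v' B \<ge> 0" using separate_points[OF x(1) x'(1) ne w(2) w'(2)] .
  define u where "u = \<iota> A"
  have u0: "u \<noteq> 0" and wu: "w u > 0" using AB bspec[OF w(3), of A] \<iota>_eq_0[OF AB(1)] by (auto simp: u_def)
  have "u * \<iota> B = 1" using \<iota>_mult[OF AB(1,3)] AB(5) \<iota>_1 by (simp add: u_def)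
  then have iB: "inverse u = \<iota> B" by (rule inverse_unique)
  interpret w: centered_valuation C \<iota> w by (rule cw)
  have "w c = 0" if "c \<in> range \<kappa>" "c \<noteq> 0" for c using that w.triv by auto
  \<comment> \<open>Nonzero elements algebraic over k have value 0, whereas
    \<open>w u > 0\<close>.\<close>
  then have u: "u \<in> E" "\<not> alg_over (range \<kappa>) u"
    using w.alg_over_trivial[OF _ subfield_closed(2)[OF subfield_\<kappa>] _ u0] wu AB(1) by (auto simp: u_def)
  interpret lu: line_embedding \<kappa> u by (intro line_embedding.intro line_embedding_axioms.intro \<kappa>_hom subfield_\<kappa> u(2))
  let ?P = "projective_line :: 'k projective"
  obtain y vy c where y: "y \<in> rational_points ?P" "c > 0" "point_valuation ?P y vy"
    "\<forall>A\<in>carrier (function_field ?P) - {\<zero>\<^bsub>function_field ?P\<^esub>}. c * w (line_emb \<kappa> u A) = real_of_int (vy A)"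
    "\<exists>D\<in>decomposition_groups ?P (line_emb \<kappa> u) y. s ` carrier (G_k C \<iota>) \<subseteq> D"
    using line_center_of_valuation[OF u cw(1) inv(1) cw(2)] by blast
  obtain y' vy' c' where y': "y' \<in> rational_points ?P" "c' > 0" "point_valuation ?P y' vy'"
    "\<forall>A\<in>carrier (function_field ?P) - {\<zero>\<^bsub>function_field ?P\<^esub>}. c' * w' (line_emb \<kappa> u A) = real_of_int (vy' A)"
    "\<exists>D\<in>decomposition_groups ?P (line_emb \<kappa> u) y'. s ` carrier (G_k C \<iota>) \<subseteq> D"
    using line_center_of_valuation[OF u cw'(1) inv(2) cw'(2)] by blast
  \<comment> \<open>The image of \<open>s\<close> preserves both valuations, so the uniqueness
    assumed for the line identifies their centres.\<close>
  have "y = y'" using line_center[OF u] y(1,5) y'(1,5) by blast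
  have "inverse u \<in> lu.emb.E" using subfield_closed(6)[OF lu.emb.subfield_E lu.emb_\<tau>] .
  \<comment> \<open>\<open>T\<close> is the inverse of the coordinate of the line. It has a pole at
    \<open>y\<close> but nonnegative value at \<open>y'\<close>, so it would lie in just one of two
    equal local rings.\<close>
  then obtain T where T: "T \<in> carrier (function_field ?P)" "line_emb \<kappa> u T = inverse u" by (metis imageE)
  have T0: "T \<noteq> \<zero>\<^bsub>function_field ?P\<^esub>" using lu.emb.\<iota>_0 T(2) u0 by auto
  have "real_of_int (vy T) = - (c * w u)" using y(4) T T0 w.w_inverse[OF u0] by force
  then have "vy T < 0" using mult_pos_pos[OF y(2) wu] by linarith
  moreover have "real_of_int (vy' T) = c' * real_of_int (v' B)" using y'(4) T T0 bspec[OF w'(3), of B] AB iB by force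
  then have "vy' T \<ge> 0" using AB(7) y'(2) by (metis less_imp_le mult_nonneg_nonneg of_int_0_le_iff)
  ultimately show False
    using line.point_valuation_local[OF y(3) T(1) T0] line.point_valuation_local[OF y'(3) T(1) T0] \<open>y = y'\<close>
    by auto
qed

end

theorem lemma2p1:
  assumes "BGASC (projective_line :: 'k::field_char_0 projective)"
  shows "\<forall>C :: 'k projective. smooth_geom_connected_curve C \<longrightarrow> BGASC C"
proof (intro allI impI)
  fix C :: "'k projective" assume C: "smooth_geom_connected_curve C"
  show "BGASC C" unfolding BGASC_def
  proof (intro allI impI)
    fix \<iota> :: "('k mpoly \<times> 'k mpoly) set \<Rightarrow> 'k sep_field" and s
    assume "separable_closure C \<iota>" "is_section C \<iota> s"
    then interpret birational_section C \<iota> s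
      using C assms
      by (intro birational_section.intro birational_section_axioms.intro emb_variety.intro
          emb_variety_axioms.intro proj_variety.intro)
        (auto simp: smooth_geom_connected_curve_def separable_closure_def)
    show "\<exists>!x. x \<in> rational_points C \<and> (\<exists>D\<in>decomposition_groups C \<iota> x. s ` carrier (G_k C \<iota>) \<subseteq> D)"
    proof (rule ex_ex1I)
      show "\<exists>x. x \<in> rational_points C \<and> (\<exists>D\<in>decomposition_groups C \<iota> x. s ` carrier (G_k C \<iota>) \<subseteq> D)"
        using center_exists by blast
      fix x x'
      assume "x \<in> rational_points C \<and> (\<exists>D\<in>decomposition_groups C \<iota> x. s ` carrier (G_k C \<iota>) \<subseteq> D)"
        and "x' \<in> rational_points C \<and> (\<exists>D\<in>decomposition_groups C \<iota> x'. s ` carrier (G_k C \<iota>) \<subseteq> D)"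
      then show "x = x'" by (elim conjE bexE) (rule center_unique)
    qed
  qed
qed

end
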